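(* Let $(S,R)$ be a skein presentation such that $\mathcal F=\mathrm{ForC}\langle S\mid R\rangle$ is an Ore forest-skein category, and let $G=\mathrm{Frac}(\mathcal F,1)$ and $H=\mathrm{Frac}(\mathcal F_\infty)$. Fix a colour $a\in S$. (A) $G$ admits the group presentation with generating set $\{b_j,\widehat b_j:\ b\in S,\ j\in\{1,2\}\}$ and relations (1) $[a_1^{-1}x_i\,,\,a_1^{-j}\,\widehat y_2\,a_1^{j}]=e$ for all $i,j\in\{1,2\}$ and $x,y\in S$ with $(x,i)\neq(a,1)$; (2) $[a_1^{-1}x_i\,,\,a_1^{-j}\,y_2\,a_1^{j}]=e$ for all $i,j\in\{1,2\}$ and $x,y\in S$ with $(x,i)\neq(a,1)$; (3) $\widehat a_1=\widehat a_2=e$; (4) $U_i=U'_i$ and $\widehat U_i=\widehat U'_i$ for all $(u,u')\in R$ and $i\in\{1,2\}$, where in the words $U_i,U_i',\widehat U_i,\widehat U_i'$ each letter $b_k$ (resp. $\widehat b_k$) with $k\ge 3$ stands for $a_1^{2-k}b_2a_1^{k-2}$ (resp. $a_1^{2-k}\widehat b_2a_1^{k-2}$). In particular, if $S$ is finite then $G$ is finitely generated, with a generating set of cardinality $4|S|-2$; if $S$ and $R$ are both finite then $G$ is finitely presented, with a presentation having $4|R|+8|S|^2-4|S|+2$ relations. Likewise $H$ is finitely generated if $S$ is finite, and finitely presented if $S$ and $R$ are finite. (B) The subgroup of $G$ generated by $\{b_j:\ b\in S,\ j\in\{1,2\}\}$ is isomorphic to $H$, and $H$ admits the presentation with these generators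 and with relations (2) together with $U_i=U_i'$ for $(u,u')\in R$, $i\in\{1,2\}$. (C) $G$ admits the infinite presentation with generating set $\{b_j,\widehat b_j:\ b\in S,\ j\geq1\}$ and relations (1') $x_qy_j=y_jx_{q+1}$ for all $1\le j<q$, $x,y\in S$; (2') $\widehat x_qy_j=y_j\widehat x_{q+1}$ for all $1\le j<q$, $x,y\in S$; (3') $\widehat a_n=e$ for all $n\ge1$; (4') $U_i=U_i'$ and $\widehat U_i=\widehat U_i'$ for all $(u,u')\in R$, $i\in\{1,2\}$. The group $H$ admits the infinite presentation with generating set $\{b_j:\ b\in S,\ j\ge1\}$ and relations (1') together with $U_i=U_i'$ for $(u,u')\in R$, $i\in\{1,2\}$.
   Context: Trees are finite ordered rooted binary trees (each vertex has $0$ or $2$ children); vertices without children are leaves, the others are interior vertices; $I$ is the trivial tree with one vertex. A forest is a finite list of trees, with roots and leaves ordered from left to right. For a nonempty set $S$ of colours, a coloured forest is a forest with a map from its interior vertices to $S$. If $f$ has as many leaves as $g$ has roots, $f\circ g$ (or $fg$) is obtained by stacking $g$ on top of $f$, gluing the $j$th root of $g$ to the $j$th leaf of $f$; $f\otimes g$ is the horizontal concatenation. $Y_a$ is the tree with a single interior vertex, coloured $a$, and $a_{j,n}=I^{\otimes j-1}\otimes Y_a\otimes I^{\otimes n-j}$ for $1\le j\le n$. A skein presentation is a pair $(S,R)$ with $R$ a set of pairs of coloured trees over $S$ having the same number of leaves. $\mathrm{ForC}\langle S\mid R\rangle$ is the quotient of the set of all coloured forests over $S$ by the smallest equivalence relation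 containing $R$ and closed under composition and tensor product with arbitrary forests; it is a small monoidal category (the presented forest-skein category) for $\circ,\otimes$. It is an Ore category if it is left-cancellative ($fg=fh\Rightarrow g=h$) and has Ore's property (for $f,g$ with the same number of roots there are $p,q$ with $fp=gq$). $\mathrm{Frac}(\mathcal F,1)$ is the group of classes $[t,s]=t\circ s^{-1}$ of pairs of trees of $\mathcal F$ with the same number of leaves modulo the equivalence relation generated by $(t,s)\sim(tf,sf)$, with product $[t,s][t',s']=[tp,s'p']$ whenever $sp=t'p'$. $\mathcal F_\infty$ is the monoid of sequences $(f_n)_{n\ge1}$ of trees of $\mathcal F$ with all but finitely many $f_n$ trivial, composed by stacking; it is left-cancellative with Ore's property when $\mathcal F$ is Ore, and $\mathrm{Frac}(\mathcal F_\infty)$ is its group of right fractions $fg^{-1}$. Words attached to a skein relation $(u,u')\in R$: write $u=c^{1}_{i_1,1}\circ c^{2}_{i_2,2}\circ\cdots\circ c^{n}_{i_n,n}$ with $c^k\in S$, $1\le i_k\le k$ ($n$ the number of interior vertices of $u$). For $j\geq 1$, $U_j$ is the word whose $k$th letter is $c^k_{i_k+j-1}$, and $\widehat U_j$ is the word whose $k$th letter is $\widehat{c^k}_{\,i_k+j-1}$ if $i_k=k$ and $c^k_{i_k+j-1}$ if $i_k<k$. Here $b_j,\widehat b_j$ ($b\in S$, $j\ge1$) are formal symbols. $U'_j,\widehat U'_j$ are defined in the same way from $u'$. $[g,h]$ denotes the commutator.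
   Formalization: In (1) and (2), y_2 (hatted in (1)) is replaced by y_{i+1}, where y_3 = a_1^{-1} y_2 a_1; only i = 2 changes. As printed, i = 2, j = 1, x = y = a forces a_1 and a_2 to commute, false already for S = {a}, R empty, where G is Thompson's group F. *)

theory Defs
  imports "HOL-Algebra.Generated_Groups" "HOL-Library.Tree"
begin

definition equiv_gen :: "'a set \<Rightarrow> ('a \<times> 'a) set \<Rightarrow> ('a \<times> 'a) set" where
  "equiv_gen A r = Restr ((r \<union> r\<inverse>)\<^sup>*) A"


section \<open>Group presentations\<close>

text \<open>A word is a list of signed letters: \<^term>\<open>(x, True)\<close> is the letter \<open>x\<close> and
  \<^term>\<open>(x, False)\<close> its formal inverse.\<close>

type_synonym 'x word = "('x \<times> bool) list"

definition words :: "'x set \<Rightarrow> 'x word set" where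
  "words X = lists (X \<times> UNIV)"

definition pos :: "'x \<Rightarrow> 'x word" where
  "pos x = [(x, True)]"

definition word_inv :: "'x word \<Rightarrow> 'x word" where
  "word_inv w = rev (map (\<lambda>(x, b). (x, \<not> b)) w)"

definition word_comm :: "'x word \<Rightarrow> 'x word \<Rightarrow> 'x word" where
  "word_comm v w = v @ w @ word_inv v @ word_inv w"

definition free_rel :: "'x set \<Rightarrow> ('x word \<times> 'x word) set" where
  "free_rel X = equiv_gen (words X)
     {(v @ [(x, b), (x, \<not> b)] @ w, v @ w) | v w x b. v \<in> words X \<and> w \<in> words X \<and> x \<in> X}"

definition free_group :: "'x set \<Rightarrow> 'x word set monoid" where
  "free_group X =
     \<lparr>carrier = words X // free_rel X,
      monoid.mult = (\<lambda>A B. \<Union>v\<in>A. \<Union>w\<in>B. free_rel X `` {v @ w}),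
      one = free_rel X `` {[]}\<rparr>"

definition normal_closure :: "('g, 'm) monoid_scheme \<Rightarrow> 'g set \<Rightarrow> 'g set" where
  "normal_closure G A =
     generate G {g \<otimes>\<^bsub>G\<^esub> r \<otimes>\<^bsub>G\<^esub> inv\<^bsub>G\<^esub> g | g r. g \<in> carrier G \<and> r \<in> A}"

text \<open>A pair \<^term>\<open>(v, w)\<close> of words stands for the relation \<open>v = w\<close>.\<close>

definition relator_closure :: "'x set \<Rightarrow> ('x word \<times> 'x word) set \<Rightarrow> 'x word set set" where
  "relator_closure X rels = normal_closure (free_group X)
     {free_rel X `` {v} \<otimes>\<^bsub>free_group X\<^esub> inv\<^bsub>free_group X\<^esub> (free_rel X `` {w}) | v w. (v, w) \<in> rels}"

definition presented_group :: "'x set \<Rightarrow> ('x word \<times> 'x word) set \<Rightarrow> 'x word set set monoid" where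
  "presented_group X rels = free_group X Mod relator_closure X rels"

definition presented_gen :: "'x set \<Rightarrow> ('x word \<times> 'x word) set \<Rightarrow> 'x \<Rightarrow> 'x word set set" where
  "presented_gen X rels x = relator_closure X rels #>\<^bsub>free_group X\<^esub> (free_rel X `` {pos x})"

text \<open>\<open>G\<close> admits the presentation with generators \<open>X\<close> and relations \<open>rels\<close>, the symbol
  \<open>x\<close> naming the element \<^term>\<open>\<gamma> x\<close> of \<open>G\<close>.\<close>

definition has_presentation ::
  "('g, 'm) monoid_scheme \<Rightarrow> 'x set \<Rightarrow> ('x word \<times> 'x word) set \<Rightarrow> ('x \<Rightarrow> 'g) \<Rightarrow> bool" where
  "has_presentation G X rels \<gamma> \<longleftrightarrow>
     group G \<and> rels \<subseteq> words X \<times> words X \<and>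
     (\<exists>\<phi> \<in> iso (presented_group X rels) G. \<forall>x\<in>X. \<phi> (presented_gen X rels x) = \<gamma> x)"

definition finitely_generated :: "('g, 'm) monoid_scheme \<Rightarrow> bool" where
  "finitely_generated G \<longleftrightarrow> (\<exists>A. finite A \<and> A \<subseteq> carrier G \<and> generate G A = carrier G)"

definition finitely_presented :: "('g, 'm) monoid_scheme \<Rightarrow> bool" where
  "finitely_presented G \<longleftrightarrow>
     (\<exists>(X :: nat set) rels \<gamma>. finite X \<and> finite rels \<and> has_presentation G X rels \<gamma>)"


section \<open>Coloured forests and forest-skein categories\<close>

text \<open>A tree coloured by \<open>'c\<close> is an element of the library type \<^typ>\<open>'c tree\<close>: interior vertices
  are the \<^const>\<open>Node\<close>s, \<^const>\<open>Leaf\<close> is the trivial tree, and \<^term>\<open>size1 t\<close> is the number of leaves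
  of \<open>t\<close>. The operation \<open>forest_comp f g\<close> is meaningful only if \<^term>\<open>forest_leaves f = length g\<close>.\<close>

type_synonym 'c forest = "'c tree list"

definition forests :: "'c set \<Rightarrow> 'c forest set" where
  "forests S = {f. \<forall>t\<in>set f. set_tree t \<subseteq> S}"

definition forest_leaves :: "'c forest \<Rightarrow> nat" where
  "forest_leaves f = sum_list (map size1 f)"

fun graft :: "'c tree \<Rightarrow> 'c forest \<Rightarrow> 'c tree" where
  "graft Leaf g = hd g"
| "graft (Node l c r) g = Node (graft l (take (size1 l) g)) c (graft r (drop (size1 l) g))"

fun forest_comp :: "'c forest \<Rightarrow> 'c forest \<Rightarrow> 'c forest" where
  "forest_comp [] g = []"
| "forest_comp (t # f) g = graft t (take (size1 t) g) # forest_comp f (drop (size1 t) g)"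

definition elementary :: "'c \<Rightarrow> nat \<Rightarrow> nat \<Rightarrow> 'c forest" where
  "elementary c j n = replicate (j - 1) Leaf @ [Node Leaf c Leaf] @ replicate (n - j) Leaf"

definition skein_presentation :: "'c set \<Rightarrow> ('c tree \<times> 'c tree) set \<Rightarrow> bool" where
  "skein_presentation S R \<longleftrightarrow>
     S \<noteq> {} \<and> (\<forall>(u, u') \<in> R. set_tree u \<subseteq> S \<and> set_tree u' \<subseteq> S \<and> size1 u = size1 u')"

inductive_set skein_rel :: "'c set \<Rightarrow> ('c tree \<times> 'c tree) set \<Rightarrow> ('c forest \<times> 'c forest) set"
  for S R where
  base: "(u, u') \<in> R \<Longrightarrow> ([u], [u']) \<in> skein_rel S R"
| refl: "f \<in> forests S \<Longrightarrow> (f, f) \<in> skein_rel S R"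
| sym: "(f, g) \<in> skein_rel S R \<Longrightarrow> (g, f) \<in> skein_rel S R"
| trans: "(f, g) \<in> skein_rel S R \<Longrightarrow> (g, h) \<in> skein_rel S R \<Longrightarrow> (f, h) \<in> skein_rel S R"
| comp_left: "(f, g) \<in> skein_rel S R \<Longrightarrow> h \<in> forests S \<Longrightarrow>
    forest_leaves h = length f \<Longrightarrow> forest_leaves h = length g \<Longrightarrow>
    (forest_comp h f, forest_comp h g) \<in> skein_rel S R"
| comp_right: "(f, g) \<in> skein_rel S R \<Longrightarrow> h \<in> forests S \<Longrightarrow>
    forest_leaves f = length h \<Longrightarrow> forest_leaves g = length h \<Longrightarrow>
    (forest_comp f h, forest_comp g h) \<in> skein_rel S R"
| tensor_left: "(f, g) \<in> skein_rel S R \<Longrightarrow> h \<in> forests S \<Longrightarrow> (h @ f, h @ g) \<in> skein_rel S R"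
| tensor_right: "(f, g) \<in> skein_rel S R \<Longrightarrow> h \<in> forests S \<Longrightarrow> (f @ h, g @ h) \<in> skein_rel S R"

text \<open>The morphisms of the presented category are classes of forests; the operations on classes
  are induced by those on representatives.\<close>

definition ForC :: "'c set \<Rightarrow> ('c tree \<times> 'c tree) set \<Rightarrow> 'c forest set set" where
  "ForC S R = forests S // skein_rel S R"

definition roots :: "'c forest set \<Rightarrow> nat" where
  "roots X = the_elem (length ` X)"

definition leaves :: "'c forest set \<Rightarrow> nat" where
  "leaves X = the_elem (forest_leaves ` X)"

definition ForC_comp :: "'c set \<Rightarrow> ('c tree \<times> 'c tree) set \<Rightarrow>
    'c forest set \<Rightarrow> 'c forest set \<Rightarrow> 'c forest set" where
  "ForC_comp S R X Y = (\<Union>f\<in>X. \<Union>g\<in>Y. skein_rel S R `` {forest_comp f g})"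

definition ForC_tensor :: "'c set \<Rightarrow> ('c tree \<times> 'c tree) set \<Rightarrow>
    'c forest set \<Rightarrow> 'c forest set \<Rightarrow> 'c forest set" where
  "ForC_tensor S R X Y = (\<Union>f\<in>X. \<Union>g\<in>Y. skein_rel S R `` {f @ g})"

definition tensor_list :: "'c set \<Rightarrow> ('c tree \<times> 'c tree) set \<Rightarrow>
    'c forest set list \<Rightarrow> 'c forest set" where
  "tensor_list S R Xs = foldr (ForC_tensor S R) Xs (skein_rel S R `` {[]})"

definition ForC_trees :: "'c set \<Rightarrow> ('c tree \<times> 'c tree) set \<Rightarrow> 'c forest set set" where
  "ForC_trees S R = {t \<in> ForC S R. roots t = 1}"

definition trivial_tree :: "'c set \<Rightarrow> ('c tree \<times> 'c tree) set \<Rightarrow> 'c forest set" where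
  "trivial_tree S R = skein_rel S R `` {[Leaf]}"

definition left_cancellative :: "'c set \<Rightarrow> ('c tree \<times> 'c tree) set \<Rightarrow> bool" where
  "left_cancellative S R \<longleftrightarrow>
     (\<forall>f\<in>ForC S R. \<forall>g\<in>ForC S R. \<forall>h\<in>ForC S R.
        leaves f = roots g \<longrightarrow> leaves f = roots h \<longrightarrow> ForC_comp S R f g = ForC_comp S R f h \<longrightarrow> g = h)"

definition Ore_property :: "'c set \<Rightarrow> ('c tree \<times> 'c tree) set \<Rightarrow> bool" where
  "Ore_property S R \<longleftrightarrow>
     (\<forall>f\<in>ForC S R. \<forall>g\<in>ForC S R. roots f = roots g \<longrightarrow>
        (\<exists>p\<in>ForC S R. \<exists>q\<in>ForC S R.
           leaves f = roots p \<and> leaves g = roots q \<and> ForC_comp S R f p = ForC_comp S R g q))"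

definition Ore_category :: "'c set \<Rightarrow> ('c tree \<times> 'c tree) set \<Rightarrow> bool" where
  "Ore_category S R \<longleftrightarrow> left_cancellative S R \<and> Ore_property S R"


section \<open>Groups of fractions\<close>

definition tree_pairs :: "'c set \<Rightarrow> ('c tree \<times> 'c tree) set \<Rightarrow> ('c forest set \<times> 'c forest set) set" where
  "tree_pairs S R = {(t, s). t \<in> ForC_trees S R \<and> s \<in> ForC_trees S R \<and> leaves t = leaves s}"

definition tree_pair_rel :: "'c set \<Rightarrow> ('c tree \<times> 'c tree) set \<Rightarrow>
    (('c forest set \<times> 'c forest set) \<times> ('c forest set \<times> 'c forest set)) set" where
  "tree_pair_rel S R = equiv_gen (tree_pairs S R)
     {((t, s), (ForC_comp S R t f, ForC_comp S R s f)) | t s f.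
        (t, s) \<in> tree_pairs S R \<and> f \<in> ForC S R \<and> leaves t = roots f}"

text \<open>The product of two classes collects the classes of all \<open>(t p, s' p')\<close> obtained from
  representatives \<open>(t, s)\<close>, \<open>(t', s')\<close> and completions \<open>s p = t' p'\<close>; in the Ore case these
  all coincide, so that the union is a single class.\<close>

definition Frac_tree :: "'c set \<Rightarrow> ('c tree \<times> 'c tree) set \<Rightarrow>
    ('c forest set \<times> 'c forest set) set monoid" where
  "Frac_tree S R =
     \<lparr>carrier = tree_pairs S R // tree_pair_rel S R,
      monoid.mult = (\<lambda>A B. \<Union>{tree_pair_rel S R `` {(ForC_comp S R t p, ForC_comp S R s' p')} | t s t' s' p p'.
         (t, s) \<in> A \<and> (t', s') \<in> B \<and> p \<in> ForC S R \<and> p' \<in> ForC S R \<and>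
         leaves s = roots p \<and> leaves t' = roots p' \<and> ForC_comp S R s p = ForC_comp S R t' p'}),
      one = tree_pair_rel S R `` {(trivial_tree S R, trivial_tree S R)}\<rparr>"

text \<open>Sequences are indexed from 0: the entry at \<open>n\<close> is the tree number \<open>n + 1\<close>. The leaves of
  \<^term>\<open>f n\<close> are those with numbers from \<^term>\<open>\<Sum>k<n. leaves (f k)\<close> on.\<close>

definition seq_comp :: "'c set \<Rightarrow> ('c tree \<times> 'c tree) set \<Rightarrow>
    (nat \<Rightarrow> 'c forest set) \<Rightarrow> (nat \<Rightarrow> 'c forest set) \<Rightarrow> (nat \<Rightarrow> 'c forest set)" where
  "seq_comp S R f g = (\<lambda>n. ForC_comp S R (f n)
     (tensor_list S R (map g [(\<Sum>k<n. leaves (f k))..<(\<Sum>k<Suc n. leaves (f k))])))"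

definition ForC_inf :: "'c set \<Rightarrow> ('c tree \<times> 'c tree) set \<Rightarrow> (nat \<Rightarrow> 'c forest set) monoid" where
  "ForC_inf S R =
     \<lparr>carrier = {f. (\<forall>n. f n \<in> ForC_trees S R) \<and> finite {n. f n \<noteq> trivial_tree S R}},
      monoid.mult = seq_comp S R,
      one = (\<lambda>_. trivial_tree S R)\<rparr>"

definition frac_rel :: "('m, 'z) monoid_scheme \<Rightarrow> (('m \<times> 'm) \<times> ('m \<times> 'm)) set" where
  "frac_rel M = equiv_gen (carrier M \<times> carrier M)
     {((f, g), (f \<otimes>\<^bsub>M\<^esub> h, g \<otimes>\<^bsub>M\<^esub> h)) | f g h.
        f \<in> carrier M \<and> g \<in> carrier M \<and> h \<in> carrier M}"

text \<open>The class of \<^term>\<open>(f, g)\<close> is the right fraction \<open>f g\<inverse>\<close>.\<close>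

definition Frac :: "('m, 'z) monoid_scheme \<Rightarrow> ('m \<times> 'm) set monoid" where
  "Frac M =
     \<lparr>carrier = (carrier M \<times> carrier M) // frac_rel M,
      monoid.mult = (\<lambda>A B. \<Union>{frac_rel M `` {(f \<otimes>\<^bsub>M\<^esub> p, g' \<otimes>\<^bsub>M\<^esub> p')} | f g f' g' p p'.
         (f, g) \<in> A \<and> (f', g') \<in> B \<and> p \<in> carrier M \<and> p' \<in> carrier M \<and>
         g \<otimes>\<^bsub>M\<^esub> p = f' \<otimes>\<^bsub>M\<^esub> p'}),
      one = frac_rel M `` {(\<one>\<^bsub>M\<^esub>, \<one>\<^bsub>M\<^esub>)}\<rparr>"


section \<open>The words attached to skein relations\<close>

text \<open>\<open>Gen b j\<close> is \<open>b\<^sub>j\<close> and \<open>Hat b j\<close> is \<open>b\<^sub>j\<close> with a hat; indices start at 1.\<close>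

datatype 'c gen = Gen 'c nat | Hat 'c nat

text \<open>A factorisation of a tree lists the pairs of the colour and the position of the successive
  elementary forests, the \<open>k\<close>th of which (list index \<open>k - 1\<close>) has \<open>k\<close> roots. It is not unique.\<close>

definition factorisation :: "'c tree \<Rightarrow> ('c \<times> nat) list \<Rightarrow> bool" where
  "factorisation u cs \<longleftrightarrow>
     (\<forall>k<length cs. 1 \<le> snd (cs ! k) \<and> snd (cs ! k) \<le> Suc k) \<and>
     [u] = foldl forest_comp [Leaf]
       (map (\<lambda>k. elementary (fst (cs ! k)) (snd (cs ! k)) (Suc k)) [0..<length cs])"

definition U_letters :: "('c \<times> nat) list \<Rightarrow> nat \<Rightarrow> 'c gen list" where
  "U_letters cs j = map (\<lambda>(c, i). Gen c (i + j - 1)) cs"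

definition U_hat_letters :: "('c \<times> nat) list \<Rightarrow> nat \<Rightarrow> 'c gen list" where
  "U_hat_letters cs j = map (\<lambda>k. case cs ! k of (c, i) \<Rightarrow>
      if i = Suc k then Hat c (i + j - 1) else Gen c (i + j - 1)) [0..<length cs]"

definition conj_a :: "'c \<Rightarrow> nat \<Rightarrow> 'c gen word \<Rightarrow> 'c gen word" where
  "conj_a a m w = replicate m (Gen a 1, False) @ w @ replicate m (Gen a 1, True)"

text \<open>With the generators of index at most 2, a letter of index \<open>k \<ge> 3\<close> stands for
  the corresponding letter of index 2 conjugated by \<open>a\<^sub>1\<close> to the power \<open>k - 2\<close>.\<close>

fun short :: "'c \<Rightarrow> 'c gen \<Rightarrow> 'c gen word" where
  "short a (Gen b k) = (if k \<ge> 3 then conj_a a (k - 2) (pos (Gen b 2)) else pos (Gen b k))"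
| "short a (Hat b k) = (if k \<ge> 3 then conj_a a (k - 2) (pos (Hat b 2)) else pos (Hat b k))"


section \<open>Generators and relations\<close>

definition gens :: "'c set \<Rightarrow> nat set \<Rightarrow> 'c gen set" where
  "gens S J = {Gen b j | b j. b \<in> S \<and> j \<in> J}"

definition hat_gens :: "'c set \<Rightarrow> nat set \<Rightarrow> 'c gen set" where
  "hat_gens S J = {Hat b j | b j. b \<in> S \<and> j \<in> J}"

text \<open>The commutation relations
  \<open>[a\<^sub>1\<inverse> x\<^sub>i, a\<^sub>1\<^sup>-\<^sup>j y\<^sub>i\<^sub>+\<^sub>1 a\<^sub>1\<^sup>j] = e\<close>,
  where \<open>y\<close> is hatted if \<open>X = Hat\<close> and \<open>y\<^sub>3\<close> is short for \<open>a\<^sub>1\<inverse> y\<^sub>2 a\<^sub>1\<close>.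
  They say that \<open>y\<^sub>q x\<^sub>i = x\<^sub>i y\<^sub>q\<^sub>+\<^sub>1\<close> for \<open>q = i + j\<close>.
  The index \<open>i + 1\<close> (and not 2) at \<open>y\<close> matters if \<open>i = 2\<close>: the lemma after the definition shows
  that index 2, with \<open>i = 2\<close>, \<open>j = 1\<close> and \<open>x = y = a\<close>, makes \<open>a\<^sub>1\<close> and \<open>a\<^sub>2\<close> commute. This
  is wrong already for one colour and no skein relation, the case of Thompson's group \<open>F\<close>.\<close>

definition comm_rels :: "('c \<Rightarrow> nat \<Rightarrow> 'c gen) \<Rightarrow> 'c set \<Rightarrow> 'c \<Rightarrow> ('c gen word \<times> 'c gen word) set" where
  "comm_rels X S a =
     {(word_comm ([(Gen a 1, False)] @ pos (Gen x i)) (conj_a a j (short a (X y (i + 1)))), [])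
      | x y i j. x \<in> S \<and> y \<in> S \<and> i \<in> {1, 2} \<and> j \<in> {1, 2} \<and> (x, i) \<noteq> (a, 1)}"

lemma (in group) index_2_collapse:
  assumes [simp]: "a1 \<in> carrier G" "a2 \<in> carrier G"
    and comm: "(inv a1 \<otimes> a2) \<otimes> (inv a1 \<otimes> a2 \<otimes> a1) = (inv a1 \<otimes> a2 \<otimes> a1) \<otimes> (inv a1 \<otimes> a2)"
  shows "a1 \<otimes> a2 = a2 \<otimes> a1"
proof -
  have cancel: "a1 \<otimes> (inv a1 \<otimes> y) = y" if "y \<in> carrier G" for y
    using that by (simp flip: m_assoc)
  have "(inv a1 \<otimes> a2) \<otimes> (inv a1 \<otimes> a2 \<otimes> a1) = (inv a1 \<otimes> a2) \<otimes> a2"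
    unfolding comm by (simp add: m_assoc cancel)
  then have "inv a1 \<otimes> (a2 \<otimes> a1) = a2"
    by (simp add: m_assoc)
  then show ?thesis
    using cancel[of "a2 \<otimes> a1"] by simp
qed

definition hat_a_rels :: "'c \<Rightarrow> nat set \<Rightarrow> ('c gen word \<times> 'c gen word) set" where
  "hat_a_rels a J = {(pos (Hat a n), []) | n. n \<in> J}"

text \<open>The relations \<open>x\<^sub>q y\<^sub>j = y\<^sub>j x\<^sub>q\<^sub>+\<^sub>1\<close>, where \<open>x\<close> is hatted if \<open>X = Hat\<close>.\<close>

definition shift_rels :: "('c \<Rightarrow> nat \<Rightarrow> 'c gen) \<Rightarrow> 'c set \<Rightarrow> ('c gen word \<times> 'c gen word) set" where
  "shift_rels X S =
     {(pos (X x q) @ pos (Gen y j), pos (Gen y j) @ pos (X x (q + 1)))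
      | x y q j. x \<in> S \<and> y \<in> S \<and> 1 \<le> j \<and> j < q}"

text \<open>The skein relations \<open>U\<^sub>i = U'\<^sub>i\<close> (for \<open>L = U_letters\<close>) and their hatted versions (for
  \<open>L = U_hat_letters\<close>); \<open>w\<close> and \<open>w'\<close> give the factorisations of the two members of a skein relation
  and \<open>\<sigma>\<close> turns a letter into a word.\<close>

definition skein_word_rels :: "(('c \<times> nat) list \<Rightarrow> nat \<Rightarrow> 'c gen list) \<Rightarrow> ('c gen \<Rightarrow> 'c gen word) \<Rightarrow>
    ('c tree \<times> 'c tree) set \<Rightarrow> ('c tree \<times> 'c tree \<Rightarrow> ('c \<times> nat) list) \<Rightarrow>
    ('c tree \<times> 'c tree \<Rightarrow> ('c \<times> nat) list) \<Rightarrow> ('c gen word \<times> 'c gen word) set" where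
  "skein_word_rels L \<sigma> R w w' =
     {(concat (map \<sigma> (L (w r) i)), concat (map \<sigma> (L (w' r) i))) | r i. r \<in> R \<and> i \<in> {1, 2}}"

end

theory Submission
  imports Defs "HOL-Algebra.Elementary_Groups"
begin

text \<open>Let \<open>\<rho>\<^sub>n\<close> be the right comb with \<open>n\<close> leaves, all of whose vertices have the colour \<open>a\<close>. A forest \<open>f\<close>
  with \<open>n\<close> roots and \<open>m\<close> leaves gives the element \<open>\<kappa> f = \<rho>\<^sub>n f \<rho>\<^sub>m\<inverse>\<close> of \<open>G\<close>. This is a functor, it
  is trivial on the combs, and the class of a pair of trees is \<open>[t, s] = \<kappa> t (\<kappa> s)\<inverse>\<close>. So
  homomorphisms from \<open>G\<close> to a group \<open>K\<close> are the same as functors from the category to \<open>K\<close> that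
  are trivial on the combs. A vertex of colour \<open>b\<close> attached to the \<open>j\<close>th leaf has the value \<open>b\<^sub>j\<close> if further
  leaves follow and the value \<open>b\<^sub>j\<close> with a hat if the leaf is the last one: the combs lengthen
  a forest at its end only, which makes the value independent of the number of leaves that follow.

  Hence the letters generate \<open>G\<close>. They satisfy the shift relations because vertices at different
  leaves may be attached in either order, the relation for hatted \<open>a\<close> because it lengthens a comb, and the skein
  relations because these hold in the category. Conversely let \<open>K\<close> be any group with elements that satisfy these relations. Reading
  the trees of a forest and the subtrees of a tree from right to left (\<open>forest_word\<close>) attaches an element of \<open>K\<close> to every
  forest. The shift relations make this a functor (\<open>fw_comp\<close>), and the skein relations make it
  invariant under the congruence (\<open>fw_skein_invariant\<close>), so there is a homomorphism from \<open>G\<close> to \<open>K\<close>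
  that respects the letters (\<open>GG_universal\<close>). Applied to the presented group this gives an inverse of the map
  from the presented group onto \<open>G\<close> (\<open>has_presentationI\<close>).

  The group \<open>H\<close> is treated in the same way with the monoid of infinite forests instead of the category. Every
  infinite forest is a finite one followed by trivial trees, so no leaf is the last and only the
  letters without hats occur. The universal property of \<open>H\<close> yields a homomorphism to \<open>G\<close>. It is one-to-one, because
  a finite forest followed by one more trivial tree is recovered from its position on a comb:
  the last tree of a common expansion has too many leaves unless the combs agree
  (\<open>vine_comp_cancel\<close>).

  For the finite presentations, conjugation by \<open>a\<^sub>1\<close> raises every index \<open>\<ge> 2\<close> by one. So
  the letters of index 1 and 2 suffice, and each shift relation needs to be required for two values of the difference of
  the indices only; the others follow by conjugation with \<open>a\<^sub>2\<close> and \<open>a\<^sub>3\<close> (\<open>commutation_step\<close>, \<open>shift_all\<close>).\<close>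

section \<open>Presented groups and their universal property\<close>

lemma equiv_equiv_gen: "equiv A (equiv_gen A r)"
proof (rule equivI)
  show "equiv_gen A r \<subseteq> A \<times> A"
    unfolding equiv_gen_def by blast
  show "refl_on A (equiv_gen A r)"
    unfolding refl_on_def equiv_gen_def by blast
  show "sym (equiv_gen A r)"
    unfolding equiv_gen_def
    by (intro sym_Int sym_rtrancl sym_Un_converse) (auto intro: symI)
  show "trans (equiv_gen A r)"
    unfolding equiv_gen_def by (rule trans_Restr) (rule trans_rtrancl)
qed

lemma equiv_gen_base: "(x, y) \<in> r \<Longrightarrow> x \<in> A \<Longrightarrow> y \<in> A \<Longrightarrow> (x, y) \<in> equiv_gen A r"
  unfolding equiv_gen_def by blast

text \<open>The generated relation is the smallest one: a relation that holds along generating pairs and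
  is an equivalence contains it. This form also covers functions that are constant along
  generating pairs, with \<^term>\<open>{(x, y). f x = f y}\<close> as the equivalence.\<close>

lemma equiv_gen_minimal:
  assumes "(x, y) \<in> equiv_gen A r" and r: "r \<subseteq> A \<times> A"
    and base: "\<And>x y. (x, y) \<in> r \<Longrightarrow> P x y"
    and refl: "\<And>x. x \<in> A \<Longrightarrow> P x x"
    and sym: "\<And>x y. P x y \<Longrightarrow> P y x"
    and trans: "\<And>x y z. P x y \<Longrightarrow> P y z \<Longrightarrow> P x z"
  shows "P x y"
proof -
  have "(x, y) \<in> (r \<union> r\<inverse>)\<^sup>*" and x: "x \<in> A"
    using assms(1) unfolding equiv_gen_def by auto
  from this(1) show ?thesis
  proof induction
    case base
    then show ?case by (rule refl[OF x])
  next
    case (step y z)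
    from step.hyps(2) have "P y z"
      using base sym by blast
    with step.IH show ?case by (rule trans)
  qed
qed

primrec eval_word :: "('g, 'm) monoid_scheme \<Rightarrow> ('x \<Rightarrow> 'g) \<Rightarrow> 'x word \<Rightarrow> 'g" where
  "eval_word K g [] = \<one>\<^bsub>K\<^esub>"
| "eval_word K g (l # w) =
     (if snd l then g (fst l) else inv\<^bsub>K\<^esub> (g (fst l))) \<otimes>\<^bsub>K\<^esub> eval_word K g w"

lemma words_simps [simp]:
  "[] \<in> words X"
  "l # w \<in> words X \<longleftrightarrow> fst l \<in> X \<and> w \<in> words X"
  "v @ w \<in> words X \<longleftrightarrow> v \<in> words X \<and> w \<in> words X"
  by (auto simp: words_def mem_Times_iff)

lemma words_word_inv [simp]: "word_inv w \<in> words X \<longleftrightarrow> w \<in> words X"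
  by (induction w) (auto simp: word_inv_def split: prod.splits)

lemma words_pos [simp]: "pos x \<in> words X \<longleftrightarrow> x \<in> X"
  by (simp add: pos_def)

lemma words_concat: "(\<And>w. w \<in> set ws \<Longrightarrow> w \<in> words X) \<Longrightarrow> concat ws \<in> words X"
  by (induction ws) auto

lemma word_inv_simps [simp]:
  "word_inv [] = []"
  "word_inv (l # w) = word_inv w @ [(fst l, \<not> snd l)]"
  by (auto simp: word_inv_def split: prod.splits)

context group
begin

lemma eval_word_closed [simp]:
  "g \<in> X \<rightarrow> carrier G \<Longrightarrow> w \<in> words X \<Longrightarrow> eval_word G g w \<in> carrier G"
  by (induction w) auto

lemma eval_word_append:
  "g \<in> X \<rightarrow> carrier G \<Longrightarrow> v \<in> words X \<Longrightarrow> w \<in> words X \<Longrightarrow>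
    eval_word G g (v @ w) = eval_word G g v \<otimes> eval_word G g w"
proof (induction v)
  case (Cons l v)
  then have "g (fst l) \<in> carrier G" "eval_word G g v \<in> carrier G" "eval_word G g w \<in> carrier G"
    by auto
  with Cons show ?case by (auto simp: m_assoc)
qed auto

lemma eval_word_inv:
  "g \<in> X \<rightarrow> carrier G \<Longrightarrow> w \<in> words X \<Longrightarrow> eval_word G g (word_inv w) = inv (eval_word G g w)"
proof (induction w)
  case (Cons l w)
  then have *: "g (fst l) \<in> carrier G" "eval_word G g w \<in> carrier G"
    by auto
  have "eval_word G g (word_inv (l # w)) = eval_word G g (word_inv w) \<otimes> eval_word G g [(fst l, \<not> snd l)]"
    unfolding word_inv_simps by (rule eval_word_append[OF Cons.prems(1)]) (use Cons.prems in auto)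
  with Cons * show ?case by (auto simp: inv_mult_group)
qed auto

lemma eval_word_pos [simp]: "g x \<in> carrier G \<Longrightarrow> eval_word G g (pos x) = g x"
  by (simp add: pos_def)

lemma eval_word_cong: "w \<in> words X \<Longrightarrow> (\<And>x. x \<in> X \<Longrightarrow> g x = h x) \<Longrightarrow> eval_word G g w = eval_word G h w"
  by (induction w) auto

end

lemma eval_word_hom:
  assumes "group K" "group L" "\<phi> \<in> hom K L" "g \<in> X \<rightarrow> carrier K" "w \<in> words X"
  shows "eval_word L (\<phi> \<circ> g) w = \<phi> (eval_word K g w)"
proof -
  interpret group_hom K L \<phi>
    using assms by (simp add: group_hom_def group_hom_axioms_def)
  from assms(5,4) show ?thesis
  proof (induction w)
    case (Cons l w)
    then have "g (fst l) \<in> carrier K" "eval_word K g w \<in> carrier K"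
      by auto
    with Cons show ?case by auto
  qed simp
qed

definition free_gen_pairs :: "'x set \<Rightarrow> ('x word \<times> 'x word) set" where
  "free_gen_pairs X = {(v @ [(x, b), (x, \<not> b)] @ w, v @ w) | v w x b. v \<in> words X \<and> w \<in> words X \<and> x \<in> X}"

lemma free_rel_eq: "free_rel X = equiv_gen (words X) (free_gen_pairs X)"
  unfolding free_rel_def free_gen_pairs_def ..

lemma free_gen_pairs_words: "free_gen_pairs X \<subseteq> words X \<times> words X"
  unfolding free_gen_pairs_def by auto

lemma equiv_free_rel: "equiv (words X) (free_rel X)"
  unfolding free_rel_eq by (rule equiv_equiv_gen)

lemma free_rel_refl: "w \<in> words X \<Longrightarrow> (w, w) \<in> free_rel X"
  using equiv_free_rel by (metis equiv_class_eq_iff)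

lemma free_rel_words: "(v, w) \<in> free_rel X \<Longrightarrow> v \<in> words X \<and> w \<in> words X"
  using equiv_free_rel[of X] by (auto simp: equiv_class_eq_iff)

lemma free_rel_sym: "(v, w) \<in> free_rel X \<Longrightarrow> (w, v) \<in> free_rel X"
  using equiv_free_rel[of X] by (auto dest: equivE symD)

lemma free_rel_trans: "(u, v) \<in> free_rel X \<Longrightarrow> (v, w) \<in> free_rel X \<Longrightarrow> (u, w) \<in> free_rel X"
  using equiv_free_rel[of X] by (auto dest: equivE transD)

lemma free_rel_context:
  assumes "(v, v') \<in> free_rel X" "p \<in> words X" "q \<in> words X"
  shows "(p @ v @ q, p @ v' @ q) \<in> free_rel X"
  using assms(1) unfolding free_rel_eq
proof (rule equiv_gen_minimal[OF _ free_gen_pairs_words])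
  fix x y assume "(x, y) \<in> free_gen_pairs X"
  then obtain v w z b where *: "x = v @ [(z, b), (z, \<not> b)] @ w" "y = v @ w" "v \<in> words X" "w \<in> words X" "z \<in> X"
    unfolding free_gen_pairs_def by auto
  then have "(p @ x @ q, p @ y @ q) \<in> free_gen_pairs X"
    unfolding free_gen_pairs_def using assms
    by (intro CollectI exI[of _ "p @ v"] exI[of _ "w @ q"] exI[of _ z] exI[of _ b]) auto
  then show "(p @ x @ q, p @ y @ q) \<in> equiv_gen (words X) (free_gen_pairs X)"
    by (rule equiv_gen_base) (use * assms in auto)
next
  fix x assume "x \<in> words X"
  with assms(2,3) have "p @ x @ q \<in> words X" by simp
  then show "(p @ x @ q, p @ x @ q) \<in> equiv_gen (words X) (free_gen_pairs X)"
    unfolding free_rel_eq[symmetric] by (rule free_rel_refl)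
qed (unfold free_rel_eq[symmetric], (blast intro: free_rel_sym free_rel_trans)+)

lemma free_rel_append:
  assumes "(v, v') \<in> free_rel X" "(w, w') \<in> free_rel X"
  shows "(v @ w, v' @ w') \<in> free_rel X"
proof -
  have "v' \<in> words X" "w \<in> words X"
    using free_rel_words[OF assms(1)] free_rel_words[OF assms(2)] by auto
  then have "(v @ w, v' @ w) \<in> free_rel X" "(v' @ w, v' @ w') \<in> free_rel X"
    using free_rel_context[OF assms(1), of "[]" w] free_rel_context[OF assms(2), of v' "[]"] by auto
  then show ?thesis by (rule free_rel_trans)
qed

lemma free_rel_cancel: "w \<in> words X \<Longrightarrow> (w @ word_inv w, []) \<in> free_rel X"
proof (induction w)
  case (Cons l w)
  have "([l] @ (w @ word_inv w) @ [(fst l, \<not> snd l)], [l] @ [] @ [(fst l, \<not> snd l)]) \<in> free_rel X"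
    using Cons by (intro free_rel_context) auto
  moreover have "([l, (fst l, \<not> snd l)], []) \<in> free_gen_pairs X"
    unfolding free_gen_pairs_def using Cons.prems
    by (intro CollectI exI[of _ "[]"] exI[of _ "fst l"] exI[of _ "snd l"]) auto
  then have "([l, (fst l, \<not> snd l)], []) \<in> free_rel X"
    unfolding free_rel_eq using Cons.prems by (intro equiv_gen_base) auto
  ultimately show ?case
    using free_rel_trans by fastforce
qed (simp add: free_rel_refl)

lemma word_inv_involution [simp]: "word_inv (word_inv w) = w"
  by (induction w) (auto simp: word_inv_def split: prod.splits)

definition word_class :: "'x set \<Rightarrow> 'x word \<Rightarrow> 'x word set" where
  "word_class X w = free_rel X `` {w}"

lemma word_class_eq_iff:
  "v \<in> words X \<Longrightarrow> w \<in> words X \<Longrightarrow> word_class X v = word_class X w \<longleftrightarrow> (v, w) \<in> free_rel X"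
  unfolding word_class_def using equiv_free_rel by (rule eq_equiv_class_iff)

lemma carrier_free_group: "carrier (free_group X) = word_class X ` words X"
  by (auto simp: free_group_def word_class_def quotient_def)

lemma one_free_group: "\<one>\<^bsub>free_group X\<^esub> = word_class X []"
  by (simp add: free_group_def word_class_def)

lemma mult_free_group:
  assumes "v \<in> words X" "w \<in> words X"
  shows "word_class X v \<otimes>\<^bsub>free_group X\<^esub> word_class X w = word_class X (v @ w)"
proof -
  have const: "word_class X (v' @ w') = word_class X (v @ w)"
    if "v' \<in> word_class X v" "w' \<in> word_class X w" for v' w'
    using that assms unfolding word_class_def
    by (intro equiv_class_eq[OF equiv_free_rel] free_rel_append) (auto intro: free_rel_sym)
  have "v \<in> word_class X v" "w \<in> word_class X w"
    using assms by (auto simp: word_class_def free_rel_refl)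
  moreover have "word_class X v \<otimes>\<^bsub>free_group X\<^esub> word_class X w
      = (\<Union>v'\<in>word_class X v. \<Union>w'\<in>word_class X w. word_class X (v' @ w'))"
    by (simp add: free_group_def word_class_def)
  ultimately show ?thesis
    using const by blast
qed

lemma free_group_elem:
  assumes "A \<in> carrier (free_group X)"
  obtains w where "w \<in> words X" "A = word_class X w"
  using assms by (auto simp: carrier_free_group)

lemma word_class_closed: "w \<in> words X \<Longrightarrow> word_class X w \<in> carrier (free_group X)"
  by (simp add: carrier_free_group)

lemma group_free_group: "group (free_group X)"
proof (rule groupI)
  fix A B assume "A \<in> carrier (free_group X)" "B \<in> carrier (free_group X)"
  then show "A \<otimes>\<^bsub>free_group X\<^esub> B \<in> carrier (free_group X)"
    by (elim free_group_elem) (simp add: mult_free_group word_class_closed)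
next
  show "\<one>\<^bsub>free_group X\<^esub> \<in> carrier (free_group X)"
    by (simp add: one_free_group word_class_closed)
next
  fix A B C
  assume "A \<in> carrier (free_group X)" "B \<in> carrier (free_group X)" "C \<in> carrier (free_group X)"
  then show "A \<otimes>\<^bsub>free_group X\<^esub> B \<otimes>\<^bsub>free_group X\<^esub> C = A \<otimes>\<^bsub>free_group X\<^esub> (B \<otimes>\<^bsub>free_group X\<^esub> C)"
    by (elim free_group_elem) (simp add: mult_free_group)
next
  fix A assume "A \<in> carrier (free_group X)"
  then show "\<one>\<^bsub>free_group X\<^esub> \<otimes>\<^bsub>free_group X\<^esub> A = A"
    by (elim free_group_elem) (simp add: mult_free_group one_free_group)
next
  fix A assume "A \<in> carrier (free_group X)"
  then obtain w where w: "w \<in> words X" "A = word_class X w"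
    by (auto simp: carrier_free_group)
  then have "word_class X (word_inv w) \<otimes>\<^bsub>free_group X\<^esub> A = \<one>\<^bsub>free_group X\<^esub>"
    using free_rel_cancel[of "word_inv w" X] by (simp add: mult_free_group one_free_group word_class_eq_iff)
  then show "\<exists>B\<in>carrier (free_group X). B \<otimes>\<^bsub>free_group X\<^esub> A = \<one>\<^bsub>free_group X\<^esub>"
    using word_class_closed[of "word_inv w" X] w(1) by auto
qed

lemma inv_free_group:
  assumes "w \<in> words X"
  shows "inv\<^bsub>free_group X\<^esub> (word_class X w) = word_class X (word_inv w)"
proof (rule group.inv_equality[OF group_free_group])
  show "word_class X (word_inv w) \<otimes>\<^bsub>free_group X\<^esub> word_class X w = \<one>\<^bsub>free_group X\<^esub>"
    using assms free_rel_cancel[of "word_inv w" X]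
    by (simp add: mult_free_group one_free_group word_class_eq_iff)
qed (simp_all add: assms word_class_closed)

text \<open>A word has the same value before and after cancelling a letter against its inverse, so the values of words
  give a homomorphism on classes.\<close>

lemma free_group_hom:
  assumes "group K" "g \<in> X \<rightarrow> carrier K"
  obtains \<phi> where "\<phi> \<in> hom (free_group X) K" "\<And>w. w \<in> words X \<Longrightarrow> \<phi> (word_class X w) = eval_word K g w"
proof -
  interpret group K by fact
  have const: "eval_word K g v = eval_word K g w" if "(v, w) \<in> free_rel X" for v w
    using that unfolding free_rel_eq
  proof (rule equiv_gen_minimal[OF _ free_gen_pairs_words])
    fix x y assume "(x, y) \<in> free_gen_pairs X"
    then obtain v w z b where *: "x = v @ [(z, b), (z, \<not> b)] @ w" "y = v @ w" "v \<in> words X" "w \<in> words X" "z \<in> X"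
      unfolding free_gen_pairs_def by auto
    have **: "g z \<in> carrier K" "eval_word K g v \<in> carrier K" "eval_word K g w \<in> carrier K"
      using assms * by auto
    then have cancel: "eval_word K g ([(z, b), (z, \<not> b)] @ w) = eval_word K g w"
      by (cases b) (simp_all flip: m_assoc)
    have "eval_word K g x = eval_word K g v \<otimes>\<^bsub>K\<^esub> eval_word K g ([(z, b), (z, \<not> b)] @ w)"
      unfolding *(1) by (rule eval_word_append[OF assms(2)]) (use * in auto)
    also have "\<dots> = eval_word K g y"
      unfolding cancel *(2) by (rule eval_word_append[OF assms(2), symmetric]) (use * in auto)
    finally show "eval_word K g x = eval_word K g y" .
  qed auto
  define \<phi> where "\<phi> A = the_elem (eval_word K g ` A)" for A
  have \<phi>: "\<phi> (word_class X w) = eval_word K g w" if "w \<in> words X" for w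
  proof -
    have "eval_word K g v = eval_word K g w" if "v \<in> word_class X w" for v
      using const[of w v] that by (simp add: word_class_def)
    moreover have "w \<in> word_class X w"
      using free_rel_refl[OF that] by (simp add: word_class_def)
    ultimately have "eval_word K g ` word_class X w = {eval_word K g w}"
      by blast
    then show ?thesis by (simp add: \<phi>_def)
  qed
  have "\<phi> \<in> hom (free_group X) K"
    using assms by (intro homI; elim free_group_elem)
      (simp_all add: mult_free_group \<phi> eval_word_append[of _ X])
  with \<phi> that show ?thesis by blast
qed

definition relators :: "'x set \<Rightarrow> ('x word \<times> 'x word) set \<Rightarrow> 'x word set set" where
  "relators X rels = {word_class X v \<otimes>\<^bsub>free_group X\<^esub> inv\<^bsub>free_group X\<^esub> word_class X w | v w. (v, w) \<in> rels}"

lemma relator_closure_eq: "relator_closure X rels = normal_closure (free_group X) (relators X rels)"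
  by (simp add: relator_closure_def relators_def word_class_def)

lemma (in group) conjugates_incl:
  "A \<subseteq> carrier G \<Longrightarrow> {g \<otimes> r \<otimes> inv g | g r. g \<in> carrier G \<and> r \<in> A} \<subseteq> carrier G"
  by auto

lemma (in group) normal_closure_normal:
  assumes "A \<subseteq> carrier G"
  shows "normal_closure G A \<lhd> G"
  unfolding normal_closure_def
proof (rule normal_generateI[OF conjugates_incl[OF assms]])
  fix h g assume "h \<in> {g \<otimes> r \<otimes> inv g |g r. g \<in> carrier G \<and> r \<in> A}" and g: "g \<in> carrier G"
  then obtain k r where "h = k \<otimes> r \<otimes> inv k" "k \<in> carrier G" "r \<in> A" "r \<in> carrier G"
    using assms by blast
  with g show "g \<otimes> h \<otimes> inv g \<in> {g \<otimes> r \<otimes> inv g |g r. g \<in> carrier G \<and> r \<in> A}"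
    by (intro CollectI exI[of _ "g \<otimes> k"] exI[of _ r]) (simp add: m_assoc inv_mult_group)
qed

lemma (in group) normal_closure_incl: "A \<subseteq> carrier G \<Longrightarrow> A \<subseteq> normal_closure G A"
proof
  fix r assume "A \<subseteq> carrier G" "r \<in> A"
  then show "r \<in> normal_closure G A"
    unfolding normal_closure_def
    by (intro generate.incl CollectI exI[of _ \<one>] exI[of _ r]) auto
qed

text \<open>Kernels are normal, so a homomorphism that is trivial on a set is trivial on its normal closure.\<close>

lemma (in group_hom) normal_closure_kernel:
  assumes "A \<subseteq> carrier G" "\<And>r. r \<in> A \<Longrightarrow> h r = \<one>\<^bsub>H\<^esub>" "x \<in> normal_closure G A"
  shows "h x = \<one>\<^bsub>H\<^esub>"
proof -
  have "normal_closure G A \<subseteq> kernel G H h"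
    unfolding normal_closure_def
  proof (rule G.generate_subgroup_incl[OF _ subgroup_kernel])
    show "{g \<otimes> r \<otimes> inv g |g r. g \<in> carrier G \<and> r \<in> A} \<subseteq> kernel G H h"
    proof clarify
      fix g r assume "g \<in> carrier G" "r \<in> A"
      moreover from this have "r \<in> carrier G" using assms(1) by blast
      ultimately show "g \<otimes> r \<otimes> inv g \<in> kernel G H h"
        by (simp add: kernel_def assms(2))
    qed
  qed
  with assms(3) show ?thesis by (auto simp: kernel_def)
qed

context
  fixes X :: "'x set" and rels :: "('x word \<times> 'x word) set"
  assumes rels: "rels \<subseteq> words X \<times> words X"
begin

lemma relators_carrier: "relators X rels \<subseteq> carrier (free_group X)"
proof -
  interpret F: group "free_group X" by (rule group_free_group)
  show ?thesis
    unfolding relators_def using rels by (auto intro!: F.m_closed F.inv_closed word_class_closed)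
qed

lemma normal_relator_closure: "relator_closure X rels \<lhd> free_group X"
  unfolding relator_closure_eq by (rule group.normal_closure_normal[OF group_free_group relators_carrier])

lemma group_presented_group: "group (presented_group X rels)"
  unfolding presented_group_def by (rule normal.factorgroup_is_group[OF normal_relator_closure])

lemma presented_group_hom:
  assumes "group K" "g \<in> X \<rightarrow> carrier K"
    and "\<And>v w. (v, w) \<in> rels \<Longrightarrow> eval_word K g v = eval_word K g w"
  obtains \<phi> where "\<phi> \<in> hom (presented_group X rels) K" "\<And>x. x \<in> X \<Longrightarrow> \<phi> (presented_gen X rels x) = g x"
proof -
  interpret K: group K by fact
  interpret F: group "free_group X" by (rule group_free_group)
  interpret N: normal "relator_closure X rels" "free_group X" by (rule normal_relator_closure)
  obtain \<phi> where \<phi>: "\<phi> \<in> hom (free_group X) K" "\<And>w. w \<in> words X \<Longrightarrow> \<phi> (word_class X w) = eval_word K g w"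
    using free_group_hom[OF assms(1,2)] by blast
  interpret \<phi>: group_hom "free_group X" K \<phi>
    using \<phi>(1) by unfold_locales
  have rel: "\<phi> r = \<one>\<^bsub>K\<^esub>" if r: "r \<in> relators X rels" for r
  proof -
    obtain v w where *: "(v, w) \<in> rels" "r = word_class X v \<otimes>\<^bsub>free_group X\<^esub> inv\<^bsub>free_group X\<^esub> word_class X w"
      using r by (auto simp: relators_def)
    then have "v \<in> words X" "w \<in> words X" using rels by auto
    then have "\<phi> (word_class X v) = eval_word K g w" "\<phi> (word_class X w) = eval_word K g w"
        "word_class X v \<in> carrier (free_group X)" "word_class X w \<in> carrier (free_group X)"
      using assms(3)[OF *(1)] by (simp_all add: \<phi>(2) word_class_closed)
    with \<open>w \<in> words X\<close> assms(2) show ?thesis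
      unfolding *(2) by simp
  qed
  have "\<phi> x = \<phi> y" if xy: "x \<in> carrier (free_group X)" "y \<in> carrier (free_group X)"
    "relator_closure X rels #>\<^bsub>free_group X\<^esub> x = relator_closure X rels #>\<^bsub>free_group X\<^esub> y" for x y
  proof -
    have "x \<in> relator_closure X rels #>\<^bsub>free_group X\<^esub> y"
      using xy F.rcos_self[OF xy(1) N.subgroup_axioms] by simp
    then obtain n where n: "n \<in> relator_closure X rels" "x = n \<otimes>\<^bsub>free_group X\<^esub> y"
      by (auto simp: r_coset_def)
    then have "\<phi> n = \<one>\<^bsub>K\<^esub>"
      unfolding relator_closure_eq using \<phi>.normal_closure_kernel[OF relators_carrier rel] by blast
    with n xy(2) show ?thesis by (simp add: N.mem_carrier)
  qed
  then obtain \<psi> where \<psi>: "\<psi> \<in> hom (presented_group X rels) K"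
      "\<And>x. x \<in> carrier (free_group X) \<Longrightarrow> \<psi> (relator_closure X rels #>\<^bsub>free_group X\<^esub> x) = \<phi> x"
    unfolding presented_group_def using FactGroup_universal[OF \<phi>(1) normal_relator_closure] by metis
  have "\<psi> (presented_gen X rels x) = g x" if "x \<in> X" for x
    unfolding presented_gen_def word_class_def[symmetric]
    using that assms(2) by (subst \<psi>(2)) (auto simp: carrier_free_group \<phi>(2) pos_def Pi_iff)
  with \<psi>(1) that show ?thesis by blast
qed

text \<open>With the next facts the presented group can be handled through its generators alone: its elements are the
  values of words at the generators, and the two sides of each relation have equal values.\<close>

lemma presented_gen_closed: "presented_gen X rels \<in> X \<rightarrow> carrier (presented_group X rels)"
  by (auto simp: presented_gen_def presented_group_def carrier_FactGroup carrier_free_group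
      simp flip: word_class_def)

lemma presented_group_eval:
  assumes "w \<in> words X"
  shows "relator_closure X rels #>\<^bsub>free_group X\<^esub> word_class X w
    = eval_word (presented_group X rels) (presented_gen X rels) w"
  using assms
proof (induction w)
  interpret F: group "free_group X" by (rule group_free_group)
  interpret N: normal "relator_closure X rels" "free_group X" by (rule normal_relator_closure)
  interpret P: group "presented_group X rels" by (rule group_presented_group)
  case Nil
  have "relator_closure X rels #>\<^bsub>free_group X\<^esub> \<one>\<^bsub>free_group X\<^esub> = relator_closure X rels"
    by (rule F.coset_mult_one[OF N.subset])
  then show ?case
    by (simp add: presented_group_def one_free_group)
next
  interpret F: group "free_group X" by (rule group_free_group)
  interpret N: normal "relator_closure X rels" "free_group X" by (rule normal_relator_closure)
  interpret P: group "presented_group X rels" by (rule group_presented_group)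
  case (Cons l w)
  let ?N = "\<lambda>w. relator_closure X rels #>\<^bsub>free_group X\<^esub> word_class X w"
  have mult: "?N v \<otimes>\<^bsub>presented_group X rels\<^esub> ?N w = ?N (v @ w)"
    if "v \<in> words X" "w \<in> words X" for v w
    using that by (simp add: presented_group_def N.rcos_sum carrier_free_group mult_free_group)
  have inv: "inv\<^bsub>presented_group X rels\<^esub> ?N (pos x) = ?N [(x, False)]" if "x \<in> X" for x
  proof -
    have "inv\<^bsub>presented_group X rels\<^esub> ?N (pos x) = ?N (word_inv (pos x))"
      unfolding presented_group_def using that
      by (subst N.inv_FactGroup)
         (auto simp: FactGroup_def RCOSETS_def carrier_free_group N.rcos_inv inv_free_group)
    then show ?thesis by (simp add: pos_def)
  qed
  have "?N [l] = (if snd l then presented_gen X rels (fst l)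
      else inv\<^bsub>presented_group X rels\<^esub> (presented_gen X rels (fst l)))"
    using Cons.prems inv[of "fst l"]
    by (cases l) (auto simp: presented_gen_def pos_def simp flip: word_class_def)
  then show ?case
    using Cons mult[of "[l]" w] by simp
qed

lemma presented_group_rel:
  assumes "(v, w) \<in> rels"
  shows "eval_word (presented_group X rels) (presented_gen X rels) v
    = eval_word (presented_group X rels) (presented_gen X rels) w"
proof -
  interpret F: group "free_group X" by (rule group_free_group)
  interpret N: normal "relator_closure X rels" "free_group X" by (rule normal_relator_closure)
  have vw: "v \<in> words X" "w \<in> words X" using assms rels by auto
  then have c: "word_class X v \<in> carrier (free_group X)" "word_class X w \<in> carrier (free_group X)"
    by (auto simp: carrier_free_group)
  have "word_class X v \<otimes>\<^bsub>free_group X\<^esub> inv\<^bsub>free_group X\<^esub> word_class X w \<in> relator_closure X rels"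
    unfolding relator_closure_eq using F.normal_closure_incl[OF relators_carrier] assms
    by (auto simp: relators_def)
  then have "word_class X v \<in> relator_closure X rels #>\<^bsub>free_group X\<^esub> word_class X w"
    using c by (intro N.rcos_module_rev[OF F.is_group])
  then have "relator_closure X rels #>\<^bsub>free_group X\<^esub> word_class X v
      = relator_closure X rels #>\<^bsub>free_group X\<^esub> word_class X w"
    using F.repr_independence[OF _ _ N.subgroup_axioms] c by metis
  then show ?thesis
    by (simp add: presented_group_eval vw)
qed

lemma presented_group_elem:
  assumes "A \<in> carrier (presented_group X rels)"
  obtains w where "w \<in> words X" "A = eval_word (presented_group X rels) (presented_gen X rels) w"
proof -
  obtain w where "w \<in> words X" "A = relator_closure X rels #>\<^bsub>free_group X\<^esub> word_class X w"
    using assms by (auto simp: presented_group_def carrier_FactGroup carrier_free_group)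
  then show ?thesis
    by (intro that) (simp_all add: presented_group_eval)
qed

text \<open>A group with a distinguished image of \<open>X\<close> that satisfies the relations receives a homomorphism
  from the presented group. It is onto if the image generates, and one-to-one as soon as some
  homomorphism leads back generator by generator. So presentations can be
  verified by constructing homomorphisms out of the group in question.\<close>

lemma has_presentationI:
  assumes G: "group G" and \<gamma>: "\<gamma> \<in> X \<rightarrow> carrier G"
    and hold: "\<And>v w. (v, w) \<in> rels \<Longrightarrow> eval_word G \<gamma> v = eval_word G \<gamma> w"
    and gen: "carrier G \<subseteq> generate G (\<gamma> ` X)"
    and \<psi>: "\<psi> \<in> hom G (presented_group X rels)" "\<And>x. x \<in> X \<Longrightarrow> \<psi> (\<gamma> x) = presented_gen X rels x"
  shows "has_presentation G X rels \<gamma>"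
proof -
  let ?P = "presented_group X rels"
  interpret G: group G by fact
  interpret P: group ?P by (rule group_presented_group)
  obtain \<phi> where \<phi>: "\<phi> \<in> hom ?P G" "\<And>x. x \<in> X \<Longrightarrow> \<phi> (presented_gen X rels x) = \<gamma> x"
    using presented_group_hom[OF G \<gamma> hold] by metis
  have retract: "\<psi> (\<phi> A) = A" if mem: "A \<in> carrier (presented_group X rels)" for A
  proof -
    obtain w where w: "w \<in> words X" "A = eval_word ?P (presented_gen X rels) w"
      using presented_group_elem[OF mem] by blast
    have "\<psi> (\<phi> A) = eval_word ?P ((\<psi> \<circ> \<phi>) \<circ> presented_gen X rels) w"
      using w eval_word_hom[OF P.is_group P.is_group hom_compose[OF \<phi>(1) \<psi>(1)] presented_gen_closed w(1)]
      by simp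
    also have "\<dots> = A"
      unfolding w(2) using w(1) by (intro P.eval_word_cong) (auto simp: \<phi>(2) \<psi>(2))
    finally show ?thesis .
  qed
  then have inj: "inj_on \<phi> (carrier ?P)"
    by (rule inj_on_inverseI)
  interpret \<phi>: group_hom ?P G \<phi>
    using \<phi>(1) by unfold_locales
  have "carrier G \<subseteq> \<phi> ` carrier ?P"
  proof -
    have "\<gamma> ` X \<subseteq> \<phi> ` carrier ?P"
    proof
      fix z assume "z \<in> \<gamma> ` X"
      then obtain x where "x \<in> X" "z = \<phi> (presented_gen X rels x)"
        using \<phi>(2) by auto
      then show "z \<in> \<phi> ` carrier ?P"
        using presented_gen_closed by blast
    qed
    then have "generate G (\<gamma> ` X) \<subseteq> \<phi> ` carrier ?P"
      by (rule G.generate_subgroup_incl[OF _ \<phi>.img_is_subgroup])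
    with gen show ?thesis by blast
  qed
  then have "\<phi> \<in> iso ?P G"
    using \<phi>(1) inj by (auto simp: iso_def bij_betw_def)
  with \<phi>(2) G rels show ?thesis
    unfolding has_presentation_def by blast
qed

end

lemma has_presentation_group: "has_presentation G X rels \<gamma> \<Longrightarrow> group G"
  and has_presentation_words: "has_presentation G X rels \<gamma> \<Longrightarrow> rels \<subseteq> words X \<times> words X"
  by (auto simp: has_presentation_def)

lemma has_presentation_closed:
  assumes "has_presentation G X rels \<gamma>"
  shows "\<gamma> \<in> X \<rightarrow> carrier G"
proof
  fix x assume x: "x \<in> X"
  obtain \<phi> where \<phi>: "\<phi> \<in> hom (presented_group X rels) G" "\<phi> (presented_gen X rels x) = \<gamma> x"
    using assms x by (auto simp: has_presentation_def iso_def)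
  have "presented_gen X rels x \<in> carrier (presented_group X rels)"
    using presented_gen_closed[OF has_presentation_words[OF assms]] x by blast
  then show "\<gamma> x \<in> carrier G"
    using hom_in_carrier[OF \<phi>(1)] \<phi>(2) by metis
qed

lemma has_presentation_hom:
  assumes pres: "has_presentation G X rels \<gamma>" and "group K" "g \<in> X \<rightarrow> carrier K"
    and "\<And>v w. (v, w) \<in> rels \<Longrightarrow> eval_word K g v = eval_word K g w"
  obtains \<psi> where "\<psi> \<in> hom G K" "\<And>x. x \<in> X \<Longrightarrow> \<psi> (\<gamma> x) = g x"
proof -
  note rels = has_presentation_words[OF pres]
  interpret P: group "presented_group X rels" by (rule group_presented_group[OF rels])
  obtain \<phi> where \<phi>: "\<phi> \<in> iso (presented_group X rels) G" "\<And>x. x \<in> X \<Longrightarrow> \<phi> (presented_gen X rels x) = \<gamma> x"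
    using pres by (auto simp: has_presentation_def)
  obtain \<chi> where \<chi>: "\<chi> \<in> hom (presented_group X rels) K" "\<And>x. x \<in> X \<Longrightarrow> \<chi> (presented_gen X rels x) = g x"
    using presented_group_hom[OF rels assms(2-4)] by metis
  let ?\<phi>' = "inv_into (carrier (presented_group X rels)) \<phi>"
  have "?\<phi>' \<in> hom G (presented_group X rels)"
    using P.iso_set_sym[OF \<phi>(1)] by (simp add: iso_def)
  moreover have "?\<phi>' (\<gamma> x) = presented_gen X rels x" if "x \<in> X" for x
  proof -
    have "inj_on \<phi> (carrier (presented_group X rels))"
      using \<phi>(1) by (simp add: iso_def bij_betw_def)
    moreover have "presented_gen X rels x \<in> carrier (presented_group X rels)"
      using presented_gen_closed[OF rels] that by blast
    ultimately show ?thesis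
      using \<phi>(2)[OF that] by (metis inv_into_f_f)
  qed
  ultimately show ?thesis
    using \<chi> by (intro that[of "\<chi> \<circ> ?\<phi>'"]) (auto intro: hom_compose)
qed

lemma has_presentation_rel:
  assumes "has_presentation G X rels \<gamma>" "(v, w) \<in> rels"
  shows "eval_word G \<gamma> v = eval_word G \<gamma> w"
proof -
  note rels = has_presentation_words[OF assms(1)]
  interpret G: group G by (rule has_presentation_group[OF assms(1)])
  interpret P: group "presented_group X rels" by (rule group_presented_group[OF rels])
  obtain \<phi> where \<phi>: "\<phi> \<in> iso (presented_group X rels) G" "\<And>x. x \<in> X \<Longrightarrow> \<phi> (presented_gen X rels x) = \<gamma> x"
    using assms(1) by (auto simp: has_presentation_def)
  have "eval_word G \<gamma> u = \<phi> (eval_word (presented_group X rels) (presented_gen X rels) u)"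
    if "u \<in> words X" for u
  proof -
    have "eval_word G \<gamma> u = eval_word G (\<phi> \<circ> presented_gen X rels) u"
      using that \<phi>(2) by (intro G.eval_word_cong) auto
    then show ?thesis
      using eval_word_hom[OF P.is_group G.is_group _ presented_gen_closed[OF rels] that] \<phi>(1)
      by (simp add: iso_def)
  qed
  then show ?thesis
    using presented_group_rel[OF rels assms(2)] rels assms(2) by auto
qed

lemma has_presentation_generate:
  assumes "has_presentation G X rels \<gamma>"
  shows "generate G (\<gamma> ` X) = carrier G"
proof -
  note rels = has_presentation_words[OF assms]
  interpret G: group G by (rule has_presentation_group[OF assms])
  interpret P: group "presented_group X rels" by (rule group_presented_group[OF rels])
  note closed = has_presentation_closed[OF assms]
  obtain \<phi> where \<phi>: "\<phi> \<in> iso (presented_group X rels) G" "\<And>x. x \<in> X \<Longrightarrow> \<phi> (presented_gen X rels x) = \<gamma> x"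
    using assms by (auto simp: has_presentation_def)
  have eval: "eval_word G \<gamma> w \<in> generate G (\<gamma> ` X)" if "w \<in> words X" for w
    using that by (induction w) (auto intro: generate.intros)
  have "carrier G \<subseteq> generate G (\<gamma> ` X)"
  proof
    fix z assume "z \<in> carrier G"
    then obtain A where A: "A \<in> carrier (presented_group X rels)" "z = \<phi> A"
      using \<phi>(1) by (auto simp: iso_def bij_betw_def)
    obtain w where w: "w \<in> words X" "A = eval_word (presented_group X rels) (presented_gen X rels) w"
      using presented_group_elem[OF rels A(1)] by blast
    have "z = eval_word G (\<phi> \<circ> presented_gen X rels) w"
      using eval_word_hom[OF P.is_group G.is_group _ presented_gen_closed[OF rels] w(1)] \<phi>(1) A(2) w(2)
      by (simp add: iso_def)
    also have "\<dots> = eval_word G \<gamma> w"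
      using w(1) \<phi>(2) by (intro G.eval_word_cong) auto
    finally show "z \<in> generate G (\<gamma> ` X)" using eval[OF w(1)] by simp
  qed
  moreover have "generate G (\<gamma> ` X) \<subseteq> carrier G"
    using closed by (intro G.generate_incl) auto
  ultimately show ?thesis by blast
qed

section \<open>Groups of fractions of Ore categories\<close>

lemma (in group) inv_cancel [simp]:
  "x \<in> carrier G \<Longrightarrow> y \<in> carrier G \<Longrightarrow> x \<otimes> (inv x \<otimes> y) = y"
  "x \<in> carrier G \<Longrightarrow> y \<in> carrier G \<Longrightarrow> inv x \<otimes> (x \<otimes> y) = y"
  by (simp_all flip: m_assoc)

text \<open>Both groups of the theorem are groups of fractions of small categories: the forest-skein category at the
  object 1, and the monoid of infinite forests as a category with a single object.\<close>

locale ore_category =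
  fixes Mor :: "'m set" and dom cod :: "'m \<Rightarrow> 'o"
    and comp :: "'m \<Rightarrow> 'm \<Rightarrow> 'm" (infixl \<open>\<cdot>\<close> 70) and idt :: "'o \<Rightarrow> 'm"
  assumes comp_closed [simp]: "f \<in> Mor \<Longrightarrow> g \<in> Mor \<Longrightarrow> cod f = dom g \<Longrightarrow> f \<cdot> g \<in> Mor"
    and dom_comp [simp]: "f \<in> Mor \<Longrightarrow> g \<in> Mor \<Longrightarrow> cod f = dom g \<Longrightarrow> dom (f \<cdot> g) = dom f"
    and cod_comp [simp]: "f \<in> Mor \<Longrightarrow> g \<in> Mor \<Longrightarrow> cod f = dom g \<Longrightarrow> cod (f \<cdot> g) = cod g"
    and comp_assoc: "f \<in> Mor \<Longrightarrow> g \<in> Mor \<Longrightarrow> h \<in> Mor \<Longrightarrow> cod f = dom g \<Longrightarrow> cod g = dom h \<Longrightarrow>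
      f \<cdot> g \<cdot> h = f \<cdot> (g \<cdot> h)"
    and idt [simp]: "idt x \<in> Mor" "dom (idt x) = x" "cod (idt x) = x"
    and comp_idt [simp]: "f \<in> Mor \<Longrightarrow> cod f = x \<Longrightarrow> f \<cdot> idt x = f"
    and idt_comp [simp]: "f \<in> Mor \<Longrightarrow> dom f = x \<Longrightarrow> idt x \<cdot> f = f"
    and left_cancel: "f \<in> Mor \<Longrightarrow> g \<in> Mor \<Longrightarrow> h \<in> Mor \<Longrightarrow> cod f = dom g \<Longrightarrow> cod f = dom h \<Longrightarrow>
      f \<cdot> g = f \<cdot> h \<Longrightarrow> g = h"
    and ore: "f \<in> Mor \<Longrightarrow> g \<in> Mor \<Longrightarrow> dom f = dom g \<Longrightarrow>
      \<exists>p\<in>Mor. \<exists>q\<in>Mor. cod f = dom p \<and> cod g = dom q \<and> f \<cdot> p = g \<cdot> q"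
begin

lemma comp_swap:
  assumes "t \<cdot> f = t' \<cdot> g" "t \<in> Mor" "f \<in> Mor" "t' \<in> Mor" "g \<in> Mor" "p \<in> Mor"
    and "cod t = dom f" "cod t' = dom g" "cod f = dom p" "cod g = dom p"
  shows "t \<cdot> (f \<cdot> p) = t' \<cdot> (g \<cdot> p)"
  using assms by (metis comp_assoc)

definition pairs :: "'o \<Rightarrow> ('m \<times> 'm) set" where
  "pairs b = {(t, s). t \<in> Mor \<and> s \<in> Mor \<and> dom t = b \<and> dom s = b \<and> cod t = cod s}"

definition expansions :: "'o \<Rightarrow> (('m \<times> 'm) \<times> ('m \<times> 'm)) set" where
  "expansions b = {((t, s), (t \<cdot> f, s \<cdot> f)) | t s f. (t, s) \<in> pairs b \<and> f \<in> Mor \<and> cod t = dom f}"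

definition frac_eq :: "'o \<Rightarrow> (('m \<times> 'm) \<times> ('m \<times> 'm)) set" where
  "frac_eq b = equiv_gen (pairs b) (expansions b)"

definition frac :: "'o \<Rightarrow> 'm \<Rightarrow> 'm \<Rightarrow> ('m \<times> 'm) set" where
  "frac b t s = frac_eq b `` {(t, s)}"

definition frac_group :: "'o \<Rightarrow> ('m \<times> 'm) set monoid" where
  "frac_group b =
     \<lparr>carrier = pairs b // frac_eq b,
      monoid.mult = (\<lambda>A B. \<Union>{frac b (t \<cdot> p) (s' \<cdot> p') | t s t' s' p p'.
         (t, s) \<in> A \<and> (t', s') \<in> B \<and> p \<in> Mor \<and> p' \<in> Mor \<and>
         cod s = dom p \<and> cod t' = dom p' \<and> s \<cdot> p = t' \<cdot> p'}),
      one = frac b (idt b) (idt b)\<rparr>"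

lemma pairs_iff [simp]:
  "(t, s) \<in> pairs b \<longleftrightarrow> t \<in> Mor \<and> s \<in> Mor \<and> dom t = b \<and> dom s = b \<and> cod t = cod s"
  by (simp add: pairs_def)

lemma expansions_pairs: "expansions b \<subseteq> pairs b \<times> pairs b"
  by (auto simp: expansions_def)

lemma equiv_frac_eq: "equiv (pairs b) (frac_eq b)"
  unfolding frac_eq_def by (rule equiv_equiv_gen)

lemma oreE:
  assumes "f \<in> Mor" "g \<in> Mor" "dom f = dom g"
  obtains p q where "p \<in> Mor" "q \<in> Mor" "dom p = cod f" "dom q = cod g" "cod p = cod q" "f \<cdot> p = g \<cdot> q"
proof -
  obtain p q where pq: "p \<in> Mor" "q \<in> Mor" "cod f = dom p" "cod g = dom q" "f \<cdot> p = g \<cdot> q"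
    using ore[OF assms] by blast
  moreover have "cod p = cod q"
    using pq assms by (metis cod_comp)
  ultimately show ?thesis using that by metis
qed

definition common_expansion :: "'m \<times> 'm \<Rightarrow> 'm \<times> 'm \<Rightarrow> bool" where
  "common_expansion x y \<longleftrightarrow> (\<exists>f\<in>Mor. \<exists>g\<in>Mor. cod (fst x) = dom f \<and> cod (fst y) = dom g \<and>
     fst x \<cdot> f = fst y \<cdot> g \<and> snd x \<cdot> f = snd y \<cdot> g)"

lemma common_expansion_trans:
  assumes "x \<in> pairs b" "y \<in> pairs b" "z \<in> pairs b" "common_expansion x y" "common_expansion y z"
  shows "common_expansion x z"
proof -
  obtain t s t' s' t'' s'' where xyz: "x = (t, s)" "y = (t', s')" "z = (t'', s'')"
    by (metis surj_pair)
  note mem = assms(1-3)[unfolded xyz pairs_iff]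
  obtain f g where fg: "f \<in> Mor" "g \<in> Mor" "cod t = dom f" "cod t' = dom g" "t \<cdot> f = t' \<cdot> g" "s \<cdot> f = s' \<cdot> g"
    using assms(4) by (auto simp: common_expansion_def xyz)
  obtain h k where hk: "h \<in> Mor" "k \<in> Mor" "cod t' = dom h" "cod t'' = dom k" "t' \<cdot> h = t'' \<cdot> k" "s' \<cdot> h = s'' \<cdot> k"
    using assms(5) by (auto simp: common_expansion_def xyz)
  obtain p q where pq: "p \<in> Mor" "q \<in> Mor" "dom p = cod g" "dom q = cod h" "g \<cdot> p = h \<cdot> q"
    using oreE[of g h] fg hk by metis
  have cods: "cod f = cod g" "cod h = cod k"
    using fg hk mem by (metis cod_comp)+
  have "t \<cdot> (f \<cdot> p) = t'' \<cdot> (k \<cdot> q)"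
  proof -
    have "t \<cdot> (f \<cdot> p) = t' \<cdot> (g \<cdot> p)" using fg(5) by (rule comp_swap) (use mem fg pq cods in auto)
    also have "g \<cdot> p = h \<cdot> q" by fact
    also have "t' \<cdot> (h \<cdot> q) = t'' \<cdot> (k \<cdot> q)" using hk(5) by (rule comp_swap) (use mem hk pq cods in auto)
    finally show ?thesis .
  qed
  moreover have "s \<cdot> (f \<cdot> p) = s'' \<cdot> (k \<cdot> q)"
  proof -
    have "s \<cdot> (f \<cdot> p) = s' \<cdot> (g \<cdot> p)" using fg(6) by (rule comp_swap) (use mem fg pq cods in auto)
    also have "g \<cdot> p = h \<cdot> q" by fact
    also have "s' \<cdot> (h \<cdot> q) = s'' \<cdot> (k \<cdot> q)" using hk(6) by (rule comp_swap) (use mem hk pq cods in auto)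
    finally show ?thesis .
  qed
  moreover have "f \<cdot> p \<in> Mor" "k \<cdot> q \<in> Mor" "cod t = dom (f \<cdot> p)" "cod t'' = dom (k \<cdot> q)"
    using fg hk pq cods by simp_all
  ultimately show ?thesis
    unfolding common_expansion_def xyz fst_conv snd_conv by blast
qed

text \<open>Having a common expansion is transitive by Ore's property, so it already is the
  equivalence relation generated by expansions.\<close>

lemma frac_eq_iff:
  "(x, y) \<in> frac_eq b \<longleftrightarrow> x \<in> pairs b \<and> y \<in> pairs b \<and> common_expansion x y"
proof
  assume xy: "(x, y) \<in> frac_eq b"
  have "x \<in> pairs b \<and> y \<in> pairs b \<and> common_expansion x y"
    using xy[unfolded frac_eq_def] expansions_pairs
  proof (rule equiv_gen_minimal)
    fix x y assume "(x, y) \<in> expansions b"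
    then obtain t s f where f: "x = (t, s)" "y = (t \<cdot> f, s \<cdot> f)" "(t, s) \<in> pairs b" "f \<in> Mor" "cod t = dom f"
      by (auto simp: expansions_def)
    then have "common_expansion x y"
      unfolding common_expansion_def
      by (intro bexI[of _ f] bexI[of _ "idt (cod f)"]) simp_all
    with f show "x \<in> pairs b \<and> y \<in> pairs b \<and> common_expansion x y"
      by simp
  next
    fix x assume "x \<in> pairs b"
    then show "x \<in> pairs b \<and> x \<in> pairs b \<and> common_expansion x x"
      unfolding common_expansion_def
      by (intro conjI bexI[of _ "idt (cod (fst x))"]) simp_all
  next
    fix x y assume "x \<in> pairs b \<and> y \<in> pairs b \<and> common_expansion x y"
    then show "y \<in> pairs b \<and> x \<in> pairs b \<and> common_expansion y x"
      unfolding common_expansion_def by metis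
  next
    fix x y z
    assume "x \<in> pairs b \<and> y \<in> pairs b \<and> common_expansion x y"
      and "y \<in> pairs b \<and> z \<in> pairs b \<and> common_expansion y z"
    then show "x \<in> pairs b \<and> z \<in> pairs b \<and> common_expansion x z"
      using common_expansion_trans by blast
  qed
  then show "x \<in> pairs b \<and> y \<in> pairs b \<and> common_expansion x y" .
next
  assume *: "x \<in> pairs b \<and> y \<in> pairs b \<and> common_expansion x y"
  obtain t s t' s' where xy: "x = (t, s)" "y = (t', s')"
    by (metis surj_pair)
  note mem = *[unfolded xy pairs_iff]
  obtain f g where fg: "f \<in> Mor" "g \<in> Mor" "cod t = dom f" "cod t' = dom g" "t \<cdot> f = t' \<cdot> g" "s \<cdot> f = s' \<cdot> g"
    using * by (auto simp: common_expansion_def xy)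
  have "(x, (t \<cdot> f, s \<cdot> f)) \<in> expansions b" "(y, (t' \<cdot> g, s' \<cdot> g)) \<in> expansions b"
    using mem fg(1-4) unfolding expansions_def xy pairs_iff by blast+
  then have "(x, (t \<cdot> f, s \<cdot> f)) \<in> frac_eq b" "(y, (t \<cdot> f, s \<cdot> f)) \<in> frac_eq b"
    using expansions_pairs fg(5,6) unfolding frac_eq_def by (auto intro!: equiv_gen_base)
  then show "(x, y) \<in> frac_eq b"
    using equiv_frac_eq[of b] by (meson equivE symD transD)
qed

lemma frac_eq_frac_iff:
  assumes "(t, s) \<in> pairs b" "(t', s') \<in> pairs b"
  shows "frac b t s = frac b t' s' \<longleftrightarrow>
    (\<exists>f\<in>Mor. \<exists>g\<in>Mor. cod t = dom f \<and> cod t' = dom g \<and> t \<cdot> f = t' \<cdot> g \<and> s \<cdot> f = s' \<cdot> g)"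
  unfolding frac_def eq_equiv_class_iff[OF equiv_frac_eq assms] frac_eq_iff
  using assms by (simp add: common_expansion_def)

lemma frac_expand:
  assumes "(t, s) \<in> pairs b" "f \<in> Mor" "cod t = dom f"
  shows "frac b (t \<cdot> f) (s \<cdot> f) = frac b t s"
proof -
  have mem: "(t \<cdot> f, s \<cdot> f) \<in> pairs b" using assms by simp
  show ?thesis
    unfolding frac_eq_frac_iff[OF mem assms(1)]
    by (rule bexI[of _ "idt (cod f)"], rule bexI[of _ f]) (use assms in simp_all)
qed

lemma mem_frac_iff:
  assumes "(t, s) \<in> pairs b"
  shows "x \<in> frac b t s \<longleftrightarrow> x \<in> pairs b \<and> common_expansion (t, s) x"
  using assms by (simp only: frac_def Image_singleton_iff frac_eq_iff) simp

text \<open>The product does not depend on the completion: two completions of the same pair have a common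
  expansion by Ore's property and left cancellation.\<close>

lemma frac_mult_unique:
  assumes mem: "(t, s) \<in> pairs b" "(t', s') \<in> pairs b"
    and p: "p \<in> Mor" "p' \<in> Mor" "cod s = dom p" "cod t' = dom p'" "s \<cdot> p = t' \<cdot> p'"
    and q: "q \<in> Mor" "q' \<in> Mor" "cod s = dom q" "cod t' = dom q'" "s \<cdot> q = t' \<cdot> q'"
  shows "frac b (t \<cdot> p) (s' \<cdot> p') = frac b (t \<cdot> q) (s' \<cdot> q')"
proof -
  note mem' = mem[unfolded pairs_iff]
  obtain x y where xy: "x \<in> Mor" "y \<in> Mor" "dom x = cod p" "dom y = cod q" "p \<cdot> x = q \<cdot> y"
    using oreE[of p q] p q by metis
  have cods: "cod p = cod p'" "cod q = cod q'"
    using p q mem' by (metis cod_comp)+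
  have "t' \<cdot> (p' \<cdot> x) = t' \<cdot> (q' \<cdot> y)"
  proof -
    have "t' \<cdot> (p' \<cdot> x) = s \<cdot> (p \<cdot> x)" using p(5)[symmetric] by (rule comp_swap) (use mem' p xy cods in auto)
    also have "p \<cdot> x = q \<cdot> y" by fact
    also have "s \<cdot> (q \<cdot> y) = t' \<cdot> (q' \<cdot> y)" using q(5) by (rule comp_swap) (use mem' q xy cods in auto)
    finally show ?thesis .
  qed
  then have p'x: "p' \<cdot> x = q' \<cdot> y"
    by (rule left_cancel[rotated -1]) (use mem' p q xy cods in auto)
  have mem2: "(t \<cdot> p, s' \<cdot> p') \<in> pairs b" "(t \<cdot> q, s' \<cdot> q') \<in> pairs b"
    using mem' p(1-4) q(1-4) cods by simp_all
  have "cod (t \<cdot> p) = dom x" "cod (t \<cdot> q) = dom y"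
    using mem' p(1-4) q(1-4) xy cods by simp_all
  moreover have "t \<cdot> p \<cdot> x = t \<cdot> q \<cdot> y"
    using mem' p q xy cods by (metis comp_assoc)
  moreover have "s' \<cdot> p' \<cdot> x = s' \<cdot> q' \<cdot> y"
    using mem' p q xy cods p'x by (metis comp_assoc)
  ultimately show ?thesis
    unfolding frac_eq_frac_iff[OF mem2] using xy by blast
qed

text \<open>For other representatives of the two factors, a completion of common expansions of the old and the
  new representatives is a completion for both of them.\<close>

lemma mult_frac:
  assumes mem: "(t, s) \<in> pairs b" "(t', s') \<in> pairs b"
    and p: "p \<in> Mor" "p' \<in> Mor" "cod s = dom p" "cod t' = dom p'" "s \<cdot> p = t' \<cdot> p'"
  shows "frac b t s \<otimes>\<^bsub>frac_group b\<^esub> frac b t' s' = frac b (t \<cdot> p) (s' \<cdot> p')"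
proof -
  note mem' = mem[unfolded pairs_iff]
  have unique: "frac b (u \<cdot> q) (v' \<cdot> q') = frac b (t \<cdot> p) (s' \<cdot> p')"
    if uv: "(u, v) \<in> frac b t s" "(u', v') \<in> frac b t' s'"
      and q: "q \<in> Mor" "q' \<in> Mor" "cod v = dom q" "cod u' = dom q'" "v \<cdot> q = u' \<cdot> q'"
    for u v u' v' q q'
  proof -
    have mem_uv: "u \<in> Mor" "v \<in> Mor" "dom u = b" "dom v = b" "cod u = cod v"
        "u' \<in> Mor" "v' \<in> Mor" "dom u' = b" "dom v' = b" "cod u' = cod v'"
      using uv mem by (simp_all add: mem_frac_iff)
    obtain f g where fg: "f \<in> Mor" "g \<in> Mor" "cod t = dom f" "cod u = dom g" "t \<cdot> f = u \<cdot> g" "s \<cdot> f = v \<cdot> g"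
      using uv(1) mem by (auto simp: mem_frac_iff common_expansion_def)
    obtain h k where hk: "h \<in> Mor" "k \<in> Mor" "cod t' = dom h" "cod u' = dom k" "t' \<cdot> h = u' \<cdot> k" "s' \<cdot> h = v' \<cdot> k"
      using uv(2) mem by (auto simp: mem_frac_iff common_expansion_def)
    have cods: "cod f = cod g" "cod h = cod k"
      using fg hk mem' mem_uv by (metis cod_comp)+
    \<comment> \<open>A completion of the common expansions \<open>(t f, s f)\<close> and \<open>(t' h, s' h)\<close> completes both pairs of pairs.\<close>
    have sf: "s \<cdot> f \<in> Mor" "dom (s \<cdot> f) = b" "cod (s \<cdot> f) = cod f"
      and th: "t' \<cdot> h \<in> Mor" "dom (t' \<cdot> h) = b" "cod (t' \<cdot> h) = cod h"
      using mem' fg(1,3) hk(1,3) by auto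
    obtain x y where xy: "x \<in> Mor" "y \<in> Mor" "dom x = cod f" "dom y = cod h" "cod x = cod y" "s \<cdot> f \<cdot> x = t' \<cdot> h \<cdot> y"
      using oreE[of "s \<cdot> f" "t' \<cdot> h"] sf th by metis
    have sq: "s \<cdot> (f \<cdot> x) = t' \<cdot> (h \<cdot> y)"
      using mem' fg hk xy by (metis comp_assoc)
    have u: "t \<cdot> (f \<cdot> x) = u \<cdot> (g \<cdot> x)" and v: "s \<cdot> (f \<cdot> x) = v \<cdot> (g \<cdot> x)"
      using fg(5,6) by - (rule comp_swap; use mem' mem_uv fg xy cods in auto)+
    have u': "t' \<cdot> (h \<cdot> y) = u' \<cdot> (k \<cdot> y)" and v': "s' \<cdot> (h \<cdot> y) = v' \<cdot> (k \<cdot> y)"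
      using hk(5,6) by - (rule comp_swap; use mem' mem_uv hk xy cods in auto)+
    have "frac b (t \<cdot> p) (s' \<cdot> p') = frac b (t \<cdot> (f \<cdot> x)) (s' \<cdot> (h \<cdot> y))"
      by (rule frac_mult_unique[OF mem p _ _ _ _ sq]) (use mem' fg hk xy in auto)
    also have "\<dots> = frac b (u \<cdot> (g \<cdot> x)) (v' \<cdot> (k \<cdot> y))"
      unfolding u v' ..
    also have "\<dots> = frac b (u \<cdot> q) (v' \<cdot> q')"
    proof (rule frac_mult_unique[OF _ _ _ _ _ _ _ q])
      show "v \<cdot> (g \<cdot> x) = u' \<cdot> (k \<cdot> y)"
        using sq u' v by simp
    qed (use mem_uv fg hk xy cods in auto)
    finally show ?thesis ..
  qed
  have self: "(t, s) \<in> frac b t s" "(t', s') \<in> frac b t' s'"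
    using mem equiv_class_self[OF equiv_frac_eq] by (simp_all only: frac_def)
  show ?thesis
  proof (rule equalityI)
    show "frac b t s \<otimes>\<^bsub>frac_group b\<^esub> frac b t' s' \<subseteq> frac b (t \<cdot> p) (s' \<cdot> p')"
      unfolding frac_group_def by (simp, clarify) (simp add: unique)
    show "frac b (t \<cdot> p) (s' \<cdot> p') \<subseteq> frac b t s \<otimes>\<^bsub>frac_group b\<^esub> frac b t' s'"
      unfolding frac_group_def monoid.simps using self p by (intro Union_upper) blast
  qed
qed

lemma carrier_frac_group: "carrier (frac_group b) = {frac b t s | t s. (t, s) \<in> pairs b}"
  by (auto simp: frac_group_def quotient_def frac_def simp del: pairs_iff)

lemma frac_closed: "(t, s) \<in> pairs b \<Longrightarrow> frac b t s \<in> carrier (frac_group b)"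
  unfolding carrier_frac_group by blast

lemma one_frac_group: "\<one>\<^bsub>frac_group b\<^esub> = frac b (idt b) (idt b)"
  by (simp add: frac_group_def)

lemma frac_groupE:
  assumes "A \<in> carrier (frac_group b)"
  obtains t s where "t \<in> Mor" "s \<in> Mor" "dom t = b" "dom s = b" "cod t = cod s" "A = frac b t s"
  using assms by (auto simp: carrier_frac_group)

lemma frac_self: "t \<in> Mor \<Longrightarrow> dom t = b \<Longrightarrow> frac b t t = \<one>\<^bsub>frac_group b\<^esub>"
  using frac_expand[of "idt b" "idt b" b t] by (simp add: one_frac_group)

lemma frac_eq_one:
  assumes "(t, s) \<in> pairs b" "h \<in> Mor" "cod t = dom h" "t \<cdot> h = s \<cdot> h"
  shows "frac b t s = \<one>\<^bsub>frac_group b\<^esub>"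
  using frac_expand[OF assms(1-3)] frac_self[of "s \<cdot> h" b] assms by simp

lemma group_frac_group: "group (frac_group b)"
proof (rule groupI)
  fix A B assume "A \<in> carrier (frac_group b)" "B \<in> carrier (frac_group b)"
  then obtain t s t' s' where mem: "(t, s) \<in> pairs b" "(t', s') \<in> pairs b" and AB: "A = frac b t s" "B = frac b t' s'"
    unfolding carrier_frac_group by blast
  obtain p q where pq: "p \<in> Mor" "q \<in> Mor" "dom p = cod s" "dom q = cod t'" "cod p = cod q" "s \<cdot> p = t' \<cdot> q"
    using oreE[of s t'] mem by auto
  then have "A \<otimes>\<^bsub>frac_group b\<^esub> B = frac b (t \<cdot> p) (s' \<cdot> q)"
    unfolding AB by (intro mult_frac[OF mem]) simp_all
  then show "A \<otimes>\<^bsub>frac_group b\<^esub> B \<in> carrier (frac_group b)"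
    using mem pq by (simp add: frac_closed)
next
  show "\<one>\<^bsub>frac_group b\<^esub> \<in> carrier (frac_group b)"
    by (simp add: one_frac_group frac_closed)
next
  fix A B C
  assume "A \<in> carrier (frac_group b)" "B \<in> carrier (frac_group b)" "C \<in> carrier (frac_group b)"
  then obtain t s t' s' t'' s'' where mem: "(t, s) \<in> pairs b" "(t', s') \<in> pairs b" "(t'', s'') \<in> pairs b"
      and ABC: "A = frac b t s" "B = frac b t' s'" "C = frac b t'' s''"
    unfolding carrier_frac_group by blast
  note mem' = mem[unfolded pairs_iff]
  obtain p q where pq: "p \<in> Mor" "q \<in> Mor" "dom p = cod s" "dom q = cod t'" "cod p = cod q" "s \<cdot> p = t' \<cdot> q"
    using oreE[of s t'] mem by auto
  obtain u v where uv: "u \<in> Mor" "v \<in> Mor" "dom u = cod q" "dom v = cod t''" "cod u = cod v" "s' \<cdot> q \<cdot> u = t'' \<cdot> v"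
    using oreE[of "s' \<cdot> q" t''] mem' pq by auto
  have "A \<otimes>\<^bsub>frac_group b\<^esub> B = frac b (t \<cdot> p) (s' \<cdot> q)"
    unfolding ABC using mem' pq by (intro mult_frac) simp_all
  moreover have "frac b (t \<cdot> p) (s' \<cdot> q) \<otimes>\<^bsub>frac_group b\<^esub> C = frac b (t \<cdot> p \<cdot> u) (s'' \<cdot> v)"
    unfolding ABC using mem' pq uv by (intro mult_frac) simp_all
  moreover have "B \<otimes>\<^bsub>frac_group b\<^esub> C = frac b (t' \<cdot> (q \<cdot> u)) (s'' \<cdot> v)"
    unfolding ABC using mem' pq uv by (intro mult_frac) (simp_all add: comp_assoc)
  moreover have "A \<otimes>\<^bsub>frac_group b\<^esub> frac b (t' \<cdot> (q \<cdot> u)) (s'' \<cdot> v)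
      = frac b (t \<cdot> (p \<cdot> u)) (s'' \<cdot> v \<cdot> idt (cod v))"
    unfolding ABC using mem' pq uv by (intro mult_frac) (simp_all flip: comp_assoc)
  ultimately show "A \<otimes>\<^bsub>frac_group b\<^esub> B \<otimes>\<^bsub>frac_group b\<^esub> C = A \<otimes>\<^bsub>frac_group b\<^esub> (B \<otimes>\<^bsub>frac_group b\<^esub> C)"
    using mem' pq uv by (simp add: comp_assoc)
next
  fix A assume "A \<in> carrier (frac_group b)"
  then obtain t s where mem: "(t, s) \<in> pairs b" and A: "A = frac b t s"
    unfolding carrier_frac_group by blast
  have "\<one>\<^bsub>frac_group b\<^esub> \<otimes>\<^bsub>frac_group b\<^esub> A = frac b (idt b \<cdot> t) (s \<cdot> idt (cod s))"
    unfolding A one_frac_group using mem by (intro mult_frac) simp_all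
  then show "\<one>\<^bsub>frac_group b\<^esub> \<otimes>\<^bsub>frac_group b\<^esub> A = A"
    using mem by (simp add: A)
next
  fix A assume "A \<in> carrier (frac_group b)"
  then obtain t s where mem: "(t, s) \<in> pairs b" and A: "A = frac b t s"
    unfolding carrier_frac_group by blast
  have "frac b s t \<otimes>\<^bsub>frac_group b\<^esub> A = frac b (s \<cdot> idt (cod t)) (s \<cdot> idt (cod t))"
    unfolding A using mem by (intro mult_frac) simp_all
  also have "\<dots> = \<one>\<^bsub>frac_group b\<^esub>"
    using mem by (simp add: frac_self)
  finally show "\<exists>B\<in>carrier (frac_group b). B \<otimes>\<^bsub>frac_group b\<^esub> A = \<one>\<^bsub>frac_group b\<^esub>"
    using mem by (intro bexI[of _ "frac b s t"]) (simp_all add: frac_closed)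
qed

lemma inv_frac:
  assumes "(t, s) \<in> pairs b"
  shows "inv\<^bsub>frac_group b\<^esub> (frac b t s) = frac b s t"
proof (rule group.inv_equality[OF group_frac_group])
  have "frac b s t \<otimes>\<^bsub>frac_group b\<^esub> frac b t s = frac b (s \<cdot> idt (cod t)) (s \<cdot> idt (cod t))"
    using assms by (intro mult_frac) simp_all
  then show "frac b s t \<otimes>\<^bsub>frac_group b\<^esub> frac b t s = \<one>\<^bsub>frac_group b\<^esub>"
    using assms by (simp add: frac_self)
qed (use assms in \<open>simp_all add: frac_closed\<close>)

text \<open>A functor to a group, with values \<^term>\<open>\<Phi> f\<close>, sends the formal fraction \<open>t s\<inverse>\<close> to the
  actual fraction. An expansion multiplies numerator and denominator by the same factor, which cancels in the group.\<close>

lemma frac_group_hom: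
  assumes "group K" and closed: "\<And>f. f \<in> Mor \<Longrightarrow> \<Phi> f \<in> carrier K"
    and functorial: "\<And>f g. f \<in> Mor \<Longrightarrow> g \<in> Mor \<Longrightarrow> cod f = dom g \<Longrightarrow> \<Phi> (f \<cdot> g) = \<Phi> f \<otimes>\<^bsub>K\<^esub> \<Phi> g"
  obtains \<psi> where "\<psi> \<in> hom (frac_group b) K"
    "\<And>t s. (t, s) \<in> pairs b \<Longrightarrow> \<psi> (frac b t s) = \<Phi> t \<otimes>\<^bsub>K\<^esub> inv\<^bsub>K\<^esub> (\<Phi> s)"
proof -
  interpret K: group K by fact
  define \<delta> where "\<delta> x = \<Phi> (fst x) \<otimes>\<^bsub>K\<^esub> inv\<^bsub>K\<^esub> (\<Phi> (snd x))" for x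
  have expand: "\<delta> (t \<cdot> f, s \<cdot> f) = \<delta> (t, s)" if "(t, s) \<in> pairs b" "f \<in> Mor" "cod t = dom f" for t s f
  proof -
    have "\<Phi> t \<in> carrier K" "\<Phi> s \<in> carrier K" "\<Phi> f \<in> carrier K"
      using that closed by simp_all
    then have "\<Phi> t \<otimes>\<^bsub>K\<^esub> \<Phi> f \<otimes>\<^bsub>K\<^esub> inv\<^bsub>K\<^esub> (\<Phi> s \<otimes>\<^bsub>K\<^esub> \<Phi> f) = \<Phi> t \<otimes>\<^bsub>K\<^esub> inv\<^bsub>K\<^esub> \<Phi> s"
      by (simp add: K.inv_mult_group K.m_assoc)
    then show ?thesis
      using that by (simp add: \<delta>_def functorial)
  qed
  have const: "\<delta> x = \<delta> y" if xy: "(x, y) \<in> frac_eq b" for x y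
  proof -
    obtain t s t' s' where *: "x = (t, s)" "y = (t', s')" by (metis surj_pair)
    obtain f g where fg: "f \<in> Mor" "g \<in> Mor" "cod t = dom f" "cod t' = dom g" "t \<cdot> f = t' \<cdot> g" "s \<cdot> f = s' \<cdot> g"
      using xy by (auto simp: frac_eq_iff common_expansion_def *)
    have "(t, s) \<in> pairs b" "(t', s') \<in> pairs b"
      using xy by (simp_all add: frac_eq_iff * del: pairs_iff)
    then show ?thesis
      using expand[of t s f] expand[of t' s' g] fg by (simp add: *)
  qed
  define \<psi> where "\<psi> A = the_elem (\<delta> ` A)" for A
  have \<psi>: "\<psi> (frac b t s) = \<Phi> t \<otimes>\<^bsub>K\<^esub> inv\<^bsub>K\<^esub> (\<Phi> s)" if ts: "(t, s) \<in> pairs b" for t s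
  proof -
    have "\<delta> x = \<delta> (t, s)" if "x \<in> frac b t s" for x
      using const[of "(t, s)" x] that by (simp add: frac_def)
    moreover have "(t, s) \<in> frac b t s"
      using equiv_class_self[OF equiv_frac_eq ts] by (simp add: frac_def)
    ultimately have "\<delta> ` frac b t s = {\<delta> (t, s)}"
      by blast
    then show ?thesis by (simp add: \<psi>_def \<delta>_def)
  qed
  have "\<psi> \<in> hom (frac_group b) K"
  proof (rule homI)
    fix A assume "A \<in> carrier (frac_group b)"
    then show "\<psi> A \<in> carrier K"
      by (elim frac_groupE) (simp add: \<psi> closed)
  next
    fix A B assume "A \<in> carrier (frac_group b)" "B \<in> carrier (frac_group b)"
    then obtain t s t' s' where mem: "(t, s) \<in> pairs b" "(t', s') \<in> pairs b" and AB: "A = frac b t s" "B = frac b t' s'"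
      unfolding carrier_frac_group by blast
    obtain p q where pq: "p \<in> Mor" "q \<in> Mor" "dom p = cod s" "dom q = cod t'" "cod p = cod q" "s \<cdot> p = t' \<cdot> q"
      using oreE[of s t'] mem by auto
    then have prod: "A \<otimes>\<^bsub>frac_group b\<^esub> B = frac b (t \<cdot> p) (s' \<cdot> q)"
      unfolding AB by (intro mult_frac[OF mem]) simp_all
    have c: "\<Phi> t \<in> carrier K" "\<Phi> s \<in> carrier K" "\<Phi> t' \<in> carrier K" "\<Phi> s' \<in> carrier K"
        "\<Phi> p \<in> carrier K" "\<Phi> q \<in> carrier K"
      using mem pq closed by simp_all
    have "\<Phi> s \<otimes>\<^bsub>K\<^esub> \<Phi> p = \<Phi> t' \<otimes>\<^bsub>K\<^esub> \<Phi> q"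
      using functorial[of s p] functorial[of t' q] mem pq by simp
    then have "\<Phi> t' = \<Phi> s \<otimes>\<^bsub>K\<^esub> \<Phi> p \<otimes>\<^bsub>K\<^esub> inv\<^bsub>K\<^esub> \<Phi> q"
      using c K.inv_solve_right[of "\<Phi> t'" "\<Phi> s \<otimes>\<^bsub>K\<^esub> \<Phi> p" "\<Phi> q"] by simp
    then have "\<Phi> t \<otimes>\<^bsub>K\<^esub> \<Phi> p \<otimes>\<^bsub>K\<^esub> inv\<^bsub>K\<^esub> (\<Phi> s' \<otimes>\<^bsub>K\<^esub> \<Phi> q)
        = \<Phi> t \<otimes>\<^bsub>K\<^esub> inv\<^bsub>K\<^esub> \<Phi> s \<otimes>\<^bsub>K\<^esub> (\<Phi> t' \<otimes>\<^bsub>K\<^esub> inv\<^bsub>K\<^esub> \<Phi> s')"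
      using c(1,2,4-6) by (simp add: K.inv_mult_group K.m_assoc)
    then show "\<psi> (A \<otimes>\<^bsub>frac_group b\<^esub> B) = \<psi> A \<otimes>\<^bsub>K\<^esub> \<psi> B"
      unfolding prod unfolding AB using mem pq by (simp add: \<psi> functorial)
  qed
  with \<psi> that show ?thesis by blast
qed

end

text \<open>A choice of morphisms \<^term>\<open>\<rho> x\<close> from the base point \<open>b\<close> to all objects \<open>x\<close> of \<open>Ob\<close> moves
  the morphisms between these objects into the group at \<open>b\<close>.\<close>

locale pointed_ore_category = ore_category +
  fixes b :: 'b and Ob :: "'b set" and \<rho> :: "'b \<Rightarrow> 'a"
  assumes b_Ob [simp]: "b \<in> Ob"
    and \<rho> [simp]: "x \<in> Ob \<Longrightarrow> \<rho> x \<in> Mor" "x \<in> Ob \<Longrightarrow> dom (\<rho> x) = b" "x \<in> Ob \<Longrightarrow> cod (\<rho> x) = x"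
    and \<rho>_b [simp]: "\<rho> b = idt b"
begin

definition \<kappa> :: "'a \<Rightarrow> ('a \<times> 'a) set" where
  "\<kappa> f = frac b (\<rho> (dom f) \<cdot> f) (\<rho> (cod f))"

lemma \<kappa>_closed [simp]: "f \<in> Mor \<Longrightarrow> dom f \<in> Ob \<Longrightarrow> cod f \<in> Ob \<Longrightarrow> \<kappa> f \<in> carrier (frac_group b)"
  by (simp add: \<kappa>_def frac_closed)

lemma \<kappa>_comp:
  assumes "f \<in> Mor" "g \<in> Mor" "cod f = dom g" "dom f \<in> Ob" "dom g \<in> Ob" "cod g \<in> Ob"
  shows "\<kappa> (f \<cdot> g) = \<kappa> f \<otimes>\<^bsub>frac_group b\<^esub> \<kappa> g"
proof -
  have "\<kappa> f \<otimes>\<^bsub>frac_group b\<^esub> \<kappa> g = frac b (\<rho> (dom f) \<cdot> f \<cdot> g) (\<rho> (cod g) \<cdot> idt (cod g))"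
    unfolding \<kappa>_def using assms by (intro mult_frac) simp_all
  then show ?thesis
    using assms by (simp add: \<kappa>_def comp_assoc)
qed

lemma \<kappa>_\<rho>: "x \<in> Ob \<Longrightarrow> \<kappa> (\<rho> x) = \<one>\<^bsub>frac_group b\<^esub>"
  by (simp add: \<kappa>_def frac_self)

lemma \<kappa>_fraction:
  assumes "(t, s) \<in> pairs b" "cod t \<in> Ob"
  shows "frac b t s = \<kappa> t \<otimes>\<^bsub>frac_group b\<^esub> inv\<^bsub>frac_group b\<^esub> (\<kappa> s)"
proof -
  have "\<kappa> t \<otimes>\<^bsub>frac_group b\<^esub> inv\<^bsub>frac_group b\<^esub> (\<kappa> s)
      = frac b t (\<rho> (cod s)) \<otimes>\<^bsub>frac_group b\<^esub> frac b (\<rho> (cod s)) s"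
    using assms by (simp add: \<kappa>_def inv_frac)
  also have "\<dots> = frac b (t \<cdot> idt (cod s)) (s \<cdot> idt (cod s))"
    using assms by (intro mult_frac) simp_all
  finally show ?thesis
    using assms by simp
qed

text \<open>Left cancellation of \<^term>\<open>\<rho> (cod f)\<close> in the denominators makes the two factors of a common
  expansion equal.\<close>

lemma \<kappa>_eqD:
  assumes "f \<in> Mor" "g \<in> Mor" "dom f \<in> Ob" "dom g \<in> Ob" "cod f \<in> Ob" "cod f = cod g" "\<kappa> f = \<kappa> g"
  obtains h where "h \<in> Mor" "dom h = cod f" "\<rho> (dom f) \<cdot> f \<cdot> h = \<rho> (dom g) \<cdot> g \<cdot> h"
proof -
  have "(\<rho> (dom f) \<cdot> f, \<rho> (cod f)) \<in> pairs b" "(\<rho> (dom g) \<cdot> g, \<rho> (cod g)) \<in> pairs b"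
    using assms by simp_all
  from frac_eq_frac_iff[OF this] assms obtain h k
    where hk: "h \<in> Mor" "k \<in> Mor" "cod f = dom h" "cod f = dom k"
      "\<rho> (dom f) \<cdot> f \<cdot> h = \<rho> (dom g) \<cdot> g \<cdot> k" "\<rho> (cod f) \<cdot> h = \<rho> (cod f) \<cdot> k"
    by (auto simp: \<kappa>_def comp_assoc)
  have "h = k"
    using hk(6) by (rule left_cancel[rotated -1]) (use assms hk(1-4) in auto)
  with hk that show ?thesis by metis
qed

end

section \<open>Composition of forests\<close>

lemma forest_leaves_simps [simp]:
  "forest_leaves [] = 0"
  "forest_leaves (t # f) = size1 t + forest_leaves f"
  "forest_leaves (f @ g) = forest_leaves f + forest_leaves g"
  "forest_leaves (replicate n Leaf) = n"
  by (simp_all add: forest_leaves_def sum_list_replicate)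

lemma forests_simps [simp]:
  "[] \<in> forests S"
  "t # f \<in> forests S \<longleftrightarrow> set_tree t \<subseteq> S \<and> f \<in> forests S"
  "f @ g \<in> forests S \<longleftrightarrow> f \<in> forests S \<and> g \<in> forests S"
  "replicate n Leaf \<in> forests S"
  by (auto simp: forests_def)

lemma forests_take_drop: "f \<in> forests S \<Longrightarrow> take n f \<in> forests S \<and> drop n f \<in> forests S"
  using set_take_subset[of n f] set_drop_subset[of n f] by (auto simp: forests_def)

lemma length_le_forest_leaves: "length f \<le> forest_leaves f"
proof (induction f)
  case (Cons t f)
  then show ?case by (simp add: size1_size)
qed simp

lemma length_forest_comp [simp]: "length (forest_comp f g) = length f"
  by (induction f g rule: forest_comp.induct) auto

lemma forest_comp_append:
  "length g = forest_leaves f \<Longrightarrow> forest_comp (f @ f') (g @ g') = forest_comp f g @ forest_comp f' g'"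
  by (induction f g rule: forest_comp.induct) auto

lemma split_forest:
  assumes "length g = m + n"
  obtains g1 g2 where "g = g1 @ g2" "length g1 = m" "length g2 = n"
  using assms that[of "take m g" "drop m g"] by simp

lemma size1_graft: "length g = size1 t \<Longrightarrow> size1 (graft t g) = forest_leaves g"
proof (induction t arbitrary: g)
  case Leaf
  then obtain s where "g = [s]" by (auto simp: length_Suc_conv)
  then show ?case by simp
next
  case (Node l c r)
  then obtain g1 g2 where "g = g1 @ g2" "length g1 = size1 l" "length g2 = size1 r"
    by (auto elim: split_forest)
  with Node.IH show ?case by simp
qed

lemma forest_leaves_comp [simp]:
  "length g = forest_leaves f \<Longrightarrow> forest_leaves (forest_comp f g) = forest_leaves g"
proof (induction f arbitrary: g)
  case (Cons t f)
  then obtain g1 g2 where "g = g1 @ g2" "length g1 = size1 t" "length g2 = forest_leaves f"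
    by (auto elim: split_forest)
  with Cons.IH show ?case by (simp add: size1_graft)
qed simp

lemma set_graft: "length g = size1 t \<Longrightarrow> set_tree t \<subseteq> S \<Longrightarrow> g \<in> forests S \<Longrightarrow> set_tree (graft t g) \<subseteq> S"
proof (induction t arbitrary: g)
  case Leaf
  then obtain s where "g = [s]" by (auto simp: length_Suc_conv)
  with Leaf show ?case by simp
next
  case (Node l c r)
  then obtain g1 g2 where "g = g1 @ g2" "length g1 = size1 l" "length g2 = size1 r"
    by (auto elim: split_forest)
  with Node show ?case by simp
qed

lemma forest_comp_forests:
  "length g = forest_leaves f \<Longrightarrow> f \<in> forests S \<Longrightarrow> g \<in> forests S \<Longrightarrow> forest_comp f g \<in> forests S"
proof (induction f arbitrary: g)
  case (Cons t f)
  then obtain g1 g2 where "g = g1 @ g2" "length g1 = size1 t" "length g2 = forest_leaves f"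
    by (auto elim: split_forest)
  with Cons show ?case by (simp add: set_graft)
qed simp

lemma graft_assoc:
  "length g = size1 t \<Longrightarrow> length h = forest_leaves g \<Longrightarrow> graft (graft t g) h = graft t (forest_comp g h)"
proof (induction t arbitrary: g h)
  case Leaf
  then obtain s where "g = [s]" by (auto simp: length_Suc_conv)
  with Leaf show ?case by simp
next
  case (Node l c r)
  then obtain g1 g2 where g: "g = g1 @ g2" "length g1 = size1 l" "length g2 = size1 r"
    by (auto elim: split_forest)
  with Node.prems obtain h1 h2 where h: "h = h1 @ h2" "length h1 = forest_leaves g1" "length h2 = forest_leaves g2"
    by (auto elim: split_forest)
  show ?case
    using g h Node.IH by (simp add: forest_comp_append size1_graft)
qed

lemma forest_comp_assoc:
  "length g = forest_leaves f \<Longrightarrow> length h = forest_leaves g \<Longrightarrow>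
    forest_comp (forest_comp f g) h = forest_comp f (forest_comp g h)"
proof (induction f arbitrary: g h)
  case (Cons t f)
  then obtain g1 g2 where g: "g = g1 @ g2" "length g1 = size1 t" "length g2 = forest_leaves f"
    by (auto elim: split_forest)
  with Cons.prems obtain h1 h2 where h: "h = h1 @ h2" "length h1 = forest_leaves g1" "length h2 = forest_leaves g2"
    by (auto elim: split_forest)
  show ?case
    using g h Cons.IH by (simp add: forest_comp_append size1_graft graft_assoc)
qed simp

lemma graft_leaves: "graft t (replicate (size1 t) Leaf) = t"
  by (induction t) (simp_all add: replicate_add)

lemma forest_comp_id_right: "forest_comp f (replicate (forest_leaves f) Leaf) = f"
  by (induction f) (simp_all add: replicate_add graft_leaves)

lemma forest_comp_id_left: "forest_comp (replicate (length g) Leaf) g = g"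
  by (induction g) simp_all

lemma forest_comp_nth:
  "length g = forest_leaves f \<Longrightarrow> n < length f \<Longrightarrow>
    forest_comp f g ! n = graft (f ! n) (take (size1 (f ! n)) (drop (forest_leaves (take n f)) g))"
proof (induction f arbitrary: g n)
  case (Cons t f)
  then obtain g1 g2 where g: "g = g1 @ g2" "length g1 = size1 t" "length g2 = forest_leaves f"
    by (auto elim: split_forest)
  show ?case
    using g Cons by (cases n) simp_all
qed simp

section \<open>The presented category\<close>

locale skein_category =
  fixes S :: "'c set" and R :: "('c tree \<times> 'c tree) set"
  assumes presentation: "skein_presentation S R"
begin

abbreviation "rel \<equiv> skein_rel S R"

lemma skein_relation:
  assumes "(u, u') \<in> R"
  shows "set_tree u \<subseteq> S" "set_tree u' \<subseteq> S" "size1 u = size1 u'"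
  using presentation assms by (auto simp: skein_presentation_def)

lemma skein_rel_invariants:
  "(f, g) \<in> rel \<Longrightarrow> f \<in> forests S \<and> g \<in> forests S \<and> length f = length g \<and> forest_leaves f = forest_leaves g"
  by (induction rule: skein_rel.induct) (simp_all add: skein_relation forest_comp_forests)

lemma equiv_rel: "equiv (forests S) rel"
  using skein_rel_invariants
  by (intro equivI refl_onI symI transI) (auto intro: skein_rel.refl skein_rel.sym skein_rel.trans)

lemma rel_append:
  assumes "(f, f') \<in> rel" "(g, g') \<in> rel"
  shows "(f @ g, f' @ g') \<in> rel"
proof -
  have "(f @ g, f' @ g) \<in> rel" "(f' @ g, f' @ g') \<in> rel"
    using assms skein_rel_invariants by (auto intro: skein_rel.tensor_left skein_rel.tensor_right)
  then show ?thesis by (rule skein_rel.trans)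
qed

lemma rel_comp:
  assumes "(f, f') \<in> rel" "(g, g') \<in> rel" "forest_leaves f = length g"
  shows "(forest_comp f g, forest_comp f' g') \<in> rel"
proof -
  note inv = skein_rel_invariants[OF assms(1)] skein_rel_invariants[OF assms(2)]
  have "(forest_comp f g, forest_comp f' g) \<in> rel"
    using inv assms by (intro skein_rel.comp_right) auto
  moreover have "(forest_comp f' g, forest_comp f' g') \<in> rel"
    using inv assms by (intro skein_rel.comp_left) auto
  ultimately show ?thesis by (rule skein_rel.trans)
qed

abbreviation "tree_rel \<equiv> \<lambda>t s. ([t], [s]) \<in> rel"

lemma tree_rel_refl: "f \<in> forests S \<Longrightarrow> list_all2 tree_rel f f"
  by (induction f) (auto intro: skein_rel.refl)

lemma tree_rel_leaves: "tree_rel t s \<Longrightarrow> size1 t = size1 s"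
  using skein_rel_invariants by fastforce

lemma tree_rel_imp_rel: "list_all2 tree_rel f g \<Longrightarrow> (f, g) \<in> rel"
proof (induction rule: list_all2_induct)
  case (Cons t f s g)
  then show ?case using rel_append[of "[t]" "[s]" f g] by simp
qed (simp add: skein_rel.refl)

lemma forest_leaves_tree_rel: "list_all2 tree_rel f g \<Longrightarrow> forest_leaves f = forest_leaves g"
  using skein_rel_invariants tree_rel_imp_rel by blast

lemma tree_rel_graft:
  assumes "tree_rel t s" "list_all2 tree_rel f g" "length f = size1 t"
  shows "tree_rel (graft t f) (graft s g)"
  using rel_comp[OF assms(1) tree_rel_imp_rel[OF assms(2)]] assms tree_rel_leaves[OF assms(1)]
    list_all2_lengthD[OF assms(2)] by simp

lemma tree_rel_comp:
  "list_all2 tree_rel h k \<Longrightarrow> list_all2 tree_rel f g \<Longrightarrow> length f = forest_leaves h \<Longrightarrow>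
    list_all2 tree_rel (forest_comp h f) (forest_comp k g)"
proof (induction arbitrary: f g rule: list_all2_induct)
  case (Cons t h s k)
  then obtain f1 f2 where f: "f = f1 @ f2" "length f1 = size1 t" "length f2 = forest_leaves h"
    by (auto elim: split_forest)
  with Cons.prems obtain g1 g2 where g: "g = g1 @ g2" "list_all2 tree_rel f1 g1" "list_all2 tree_rel f2 g2"
    by (auto simp: list_all2_append1)
  have "length g1 = size1 s"
    using f g Cons.hyps tree_rel_leaves list_all2_lengthD by metis
  then show ?case
    using f g Cons by (simp add: tree_rel_graft)
qed simp

text \<open>The smallest congruence for composition and tensor product relates forests tree by tree:
  relating tree by tree is a congruence already. So the tensor product can be cancelled.\<close>

lemma rel_iff_tree_rel: "(f, g) \<in> rel \<longleftrightarrow> list_all2 tree_rel f g"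
proof
  assume "(f, g) \<in> rel"
  then show "list_all2 tree_rel f g"
  proof induction
    case (base u u')
    then show ?case by (simp add: skein_rel.base)
  next
    case (sym f g)
    then show ?case
      by (auto simp: list_all2_conv_all_nth intro: skein_rel.sym)
  next
    case (trans f g h)
    show ?case
      by (rule list_all2_trans[OF _ trans.IH]) (rule skein_rel.trans)
  qed (auto simp: tree_rel_refl intro!: tree_rel_comp list_all2_appendI forest_leaves_tree_rel)
qed (rule tree_rel_imp_rel)

lemma rel_appendD:
  assumes "(f @ g, f' @ g') \<in> rel" "length f = length f'"
  shows "(f, f') \<in> rel" "(g, g') \<in> rel"
proof -
  have "list_all2 tree_rel f f' \<and> list_all2 tree_rel g g'"
    using assms(1)[THEN iffD1[OF rel_iff_tree_rel]] list_all2_append[OF assms(2)] by blast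
  then show "(f, f') \<in> rel" "(g, g') \<in> rel"
    by (blast intro: tree_rel_imp_rel)+
qed

definition cl :: "'c forest \<Rightarrow> 'c forest set" where
  "cl f = rel `` {f}"

lemma cl_eq_iff: "f \<in> forests S \<Longrightarrow> g \<in> forests S \<Longrightarrow> cl f = cl g \<longleftrightarrow> (f, g) \<in> rel"
  unfolding cl_def using equiv_rel by (rule eq_equiv_class_iff)

lemma cl_eqI: "(f, g) \<in> rel \<Longrightarrow> cl f = cl g"
  unfolding cl_def by (rule equiv_class_eq[OF equiv_rel])

lemma ForC_eq: "ForC S R = cl ` forests S"
  by (auto simp: ForC_def cl_def quotient_def)

lemma cl_mem [simp]: "f \<in> forests S \<Longrightarrow> cl f \<in> ForC S R"
  by (simp add: ForC_eq)

lemma ForCE: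
  assumes "X \<in> ForC S R"
  obtains f where "f \<in> forests S" "X = cl f"
  using assms by (auto simp: ForC_eq)

lemma roots_cl [simp]: "f \<in> forests S \<Longrightarrow> roots (cl f) = length f"
proof -
  assume "f \<in> forests S"
  then have "f \<in> cl f" by (simp add: cl_def skein_rel.refl)
  moreover have "length g = length f" if "g \<in> cl f" for g
    using that skein_rel_invariants[of f g] by (simp add: cl_def)
  ultimately have "length ` cl f = {length f}" by blast
  then show ?thesis by (simp add: roots_def)
qed

lemma leaves_cl [simp]: "f \<in> forests S \<Longrightarrow> leaves (cl f) = forest_leaves f"
proof -
  assume "f \<in> forests S"
  then have "f \<in> cl f" by (simp add: cl_def skein_rel.refl)
  moreover have "forest_leaves g = forest_leaves f" if "g \<in> cl f" for g
    using that skein_rel_invariants[of f g] by (simp add: cl_def)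
  ultimately have "forest_leaves ` cl f = {forest_leaves f}" by blast
  then show ?thesis by (simp add: leaves_def)
qed

lemma cl_Union2:
  assumes "f \<in> forests S" "g \<in> forests S"
    and "\<And>f' g'. (f, f') \<in> rel \<Longrightarrow> (g, g') \<in> rel \<Longrightarrow> (op f g, op f' g') \<in> rel"
  shows "(\<Union>f'\<in>cl f. \<Union>g'\<in>cl g. cl (op f' g')) = cl (op f g)"
proof -
  have "f \<in> cl f" "g \<in> cl g"
    using assms by (simp_all add: cl_def skein_rel.refl)
  moreover have "cl (op f' g') = cl (op f g)" if "f' \<in> cl f" "g' \<in> cl g" for f' g'
    using cl_eqI[OF assms(3)] that by (simp add: cl_def)
  ultimately show ?thesis by blast
qed

lemma comp_cl [simp]:
  "f \<in> forests S \<Longrightarrow> g \<in> forests S \<Longrightarrow> forest_leaves f = length g \<Longrightarrow>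
    ForC_comp S R (cl f) (cl g) = cl (forest_comp f g)"
  unfolding ForC_comp_def cl_def[symmetric] by (rule cl_Union2) (auto intro: rel_comp)

lemma tensor_cl [simp]:
  "f \<in> forests S \<Longrightarrow> g \<in> forests S \<Longrightarrow> ForC_tensor S R (cl f) (cl g) = cl (f @ g)"
  unfolding ForC_tensor_def cl_def[symmetric] by (rule cl_Union2) (auto intro: rel_append)

lemma tensor_list_cl: "f \<in> forests S \<Longrightarrow> tensor_list S R (map (\<lambda>t. cl [t]) f) = cl f"
  unfolding tensor_list_def by (induction f) (simp_all flip: cl_def)

lemma trivial_tree_eq: "trivial_tree S R = cl [Leaf]"
  by (simp add: trivial_tree_def cl_def)

lemma ForC_treesE:
  assumes "X \<in> ForC_trees S R"
  obtains t where "set_tree t \<subseteq> S" "X = cl [t]"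
proof -
  obtain f where f: "f \<in> forests S" "X = cl f" "length f = 1"
    using assms by (auto simp: ForC_trees_def ForC_eq)
  then obtain t where "f = [t]" by (auto simp: length_Suc_conv)
  with f that show ?thesis by simp
qed

end

section \<open>Infinite forests as stable classes of finite ones\<close>

context skein_category
begin

definition emb :: "'c forest \<Rightarrow> nat \<Rightarrow> 'c forest set" where
  "emb F n = (if n < length F then cl [F ! n] else cl [Leaf])"

lemma nth_forests: "F \<in> forests S \<Longrightarrow> n < length F \<Longrightarrow> set_tree (F ! n) \<subseteq> S"
  by (auto simp: forests_def)

lemma emb_pad: "emb (F @ replicate k Leaf) = emb F"
  by (rule ext) (auto simp: emb_def nth_append)

lemma emb_eq_iff:
  assumes "F \<in> forests S" "G \<in> forests S" "length F = length G"
  shows "emb F = emb G \<longleftrightarrow> (F, G) \<in> rel"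
proof -
  have "emb F = emb G \<longleftrightarrow> (\<forall>n<length F. cl [F ! n] = cl [G ! n])"
    using assms(3) by (auto simp: emb_def fun_eq_iff)
  also have "\<dots> \<longleftrightarrow> (F, G) \<in> rel"
    using assms by (simp add: rel_iff_tree_rel[of F G] list_all2_conv_all_nth cl_eq_iff nth_forests)
  finally show ?thesis .
qed

lemma emb_closed: 
  assumes "F \<in> forests S"
  shows "emb F \<in> carrier (ForC_inf S R)"
proof -
  have "{n. emb F n \<noteq> cl [Leaf]} \<subseteq> {..<length F}"
    by (auto simp: emb_def)
  then have "finite {n. emb F n \<noteq> cl [Leaf]}"
    by (rule finite_subset) simp
  then show ?thesis
    using assms nth_forests by (auto simp: ForC_inf_def ForC_trees_def trivial_tree_eq emb_def)
qed

lemma carrier_ForC_inf: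
  assumes "f \<in> carrier (ForC_inf S R)"
  obtains F where "F \<in> forests S" "f = emb F"
proof -
  have f: "f n \<in> ForC_trees S R" "finite {n. f n \<noteq> cl [Leaf]}" for n
    using assms by (auto simp: ForC_inf_def trivial_tree_eq)
  obtain N where N: "f n = cl [Leaf]" if "n \<ge> N" for n
    using f(2) finite_nat_set_iff_bounded[of "{n. f n \<noteq> cl [Leaf]}"] by (metis linorder_not_le mem_Collect_eq)
  have "\<forall>n. \<exists>t. set_tree t \<subseteq> S \<and> f n = cl [t]"
    using f(1) ForC_treesE by metis
  then obtain t where t: "\<And>n. set_tree (t n) \<subseteq> S" "\<And>n. f n = cl [t n]"
    by metis
  have "f = emb (map t [0..<N])"
    using N t(2) by (auto simp: emb_def fun_eq_iff)
  moreover have "map t [0..<N] \<in> forests S"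
    using t(1) by (auto simp: forests_def)
  ultimately show ?thesis using that by blast
qed

lemma leaves_emb: "F \<in> forests S \<Longrightarrow> leaves (emb F n) = (if n < length F then size1 (F ! n) else 1)"
  using nth_forests by (auto simp: emb_def)

lemma sum_leaves_emb:
  "F \<in> forests S \<Longrightarrow> (\<Sum>k<n. leaves (emb F k)) = forest_leaves (take n F) + (n - length F)"
  by (induction n) (auto simp: leaves_emb take_Suc_conv_app_nth Suc_diff_le)

text \<open>The trees of the second factor that go to the leaves of the \<open>n\<close>th tree start after all leaves of the earlier
  trees. For finite forests of matching size this is the same block of trees as in the
  composite of finite forests, and beyond their ends both factors are trivial.\<close>

lemma seq_comp_emb:
  assumes F: "F \<in> forests S" and G: "G \<in> forests S" and len: "length G = forest_leaves F"
  shows "seq_comp S R (emb F) (emb G) = emb (forest_comp F G)"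
proof
  fix n
  define k where "k = forest_leaves (take n F) + (n - length F)"
  have comp: "seq_comp S R (emb F) (emb G) n
      = ForC_comp S R (emb F n) (tensor_list S R (map (emb G) [k..<k + leaves (emb F n)]))"
    using sum_leaves_emb[OF F, of n] by (simp add: seq_comp_def flip: k_def)
  show "seq_comp S R (emb F) (emb G) n = emb (forest_comp F G) n"
  proof (cases "n < length F")
    case True
    let ?g = "take (size1 (F ! n)) (drop (forest_leaves (take n F)) G)"
    have "F = take n F @ F ! n # drop (Suc n) F"
      using True by (rule id_take_nth_drop)
    then have "forest_leaves F = forest_leaves (take n F) + size1 (F ! n) + forest_leaves (drop (Suc n) F)"
      by (metis forest_leaves_simps(2,3) add.assoc)
    then have bound: "k + size1 (F ! n) \<le> length G" and k: "k = forest_leaves (take n F)"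
      using True len by (simp_all add: k_def)
    have "map (emb G) [k..<k + size1 (F ! n)] = map (\<lambda>t. cl [t]) ?g"
      using bound by (intro nth_equalityI) (auto simp: emb_def k)
    moreover have "length ?g = size1 (F ! n)"
      using bound by (simp add: k)
    moreover have "?g \<in> forests S"
      using forests_take_drop G by blast
    ultimately show ?thesis
      unfolding comp using True F nth_forests[OF F True] len
      by (simp add: leaves_emb tensor_list_cl) (simp add: emb_def forest_comp_nth)
  next
    case False
    then have "k \<ge> length G" by (simp add: k_def len)
    then have "map (emb G) [k..<k + 1] = map (\<lambda>t. cl [t]) [Leaf]"
      by (simp add: emb_def)
    moreover have "tensor_list S R (map (\<lambda>t. cl [t]) [Leaf]) = cl [Leaf]"
      by (rule tensor_list_cl) simp
    ultimately show ?thesis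
      unfolding comp using False by (simp add: leaves_emb[OF F]) (simp add: emb_def)
  qed
qed

end

section \<open>The fraction groups of an Ore forest-skein category\<close>

text \<open>The right combs. All their vertices lie at the last leaf.\<close>

primrec vine :: "'c \<Rightarrow> nat \<Rightarrow> 'c tree" where
  "vine a 0 = Leaf"
| "vine a (Suc n) = Node Leaf a (vine a n)"

lemma size1_vine [simp]: "size1 (vine a n) = Suc n"
  by (induction n) auto

lemma set_vine: "a \<in> S \<Longrightarrow> set_tree (vine a n) \<subseteq> S"
  by (induction n) auto

locale ore_skein_category = skein_category +
  fixes a :: 'a
  assumes Ore: "Ore_category S R" and a_S [simp]: "a \<in> S"
begin

\<comment> \<open>A comb with \<open>n\<close> leaves has \<open>n - 1\<close> vertices.\<close>
definition \<rho> :: "nat \<Rightarrow> 'a forest set" where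
  "\<rho> n = cl [vine a (n - 1)]"

lemma vine_forests [simp]: "[vine a n] \<in> forests S"
  by (simp add: set_vine)

sublocale C: pointed_ore_category "ForC S R" roots leaves "ForC_comp S R" "\<lambda>n. cl (replicate n Leaf)"
  1 "{1..}" \<rho>
proof
  fix f g assume "f \<in> ForC S R" "g \<in> ForC S R" "leaves f = roots g"
  then show "ForC_comp S R f g \<in> ForC S R" "roots (ForC_comp S R f g) = roots f"
      "leaves (ForC_comp S R f g) = leaves g"
    by (auto elim!: ForCE simp: forest_comp_forests)
next
  fix f g h assume "f \<in> ForC S R" "g \<in> ForC S R" "h \<in> ForC S R" "leaves f = roots g" "leaves g = roots h"
  then show "ForC_comp S R (ForC_comp S R f g) h = ForC_comp S R f (ForC_comp S R g h)"
    by (auto elim!: ForCE simp: forest_comp_forests forest_comp_assoc)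
next
  fix f x assume "f \<in> ForC S R" "leaves f = x"
  then show "ForC_comp S R f (cl (replicate x Leaf)) = f"
    by (auto elim!: ForCE simp: forest_comp_id_right)
next
  fix f x assume "f \<in> ForC S R" "roots f = x"
  then show "ForC_comp S R (cl (replicate x Leaf)) f = f"
    by (auto elim!: ForCE simp: forest_comp_id_left)
next
  fix f g h assume "f \<in> ForC S R" "g \<in> ForC S R" "h \<in> ForC S R"
    "leaves f = roots g" "leaves f = roots h" "ForC_comp S R f g = ForC_comp S R f h"
  then show "g = h"
    using Ore unfolding Ore_category_def left_cancellative_def by blast
next
  fix f g assume "f \<in> ForC S R" "g \<in> ForC S R" "roots f = roots g"
  then show "\<exists>p\<in>ForC S R. \<exists>q\<in>ForC S R.
      leaves f = roots p \<and> leaves g = roots q \<and> ForC_comp S R f p = ForC_comp S R g q"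
    using Ore unfolding Ore_category_def Ore_property_def by blast
qed (auto simp: \<rho>_def set_vine)

lemma Frac_tree_eq: "Frac_tree S R = C.frac_group 1"
proof -
  have "tree_pairs S R = C.pairs 1"
    by (auto simp: tree_pairs_def C.pairs_def ForC_trees_def)
  moreover from this have "tree_pair_rel S R = C.frac_eq 1"
    by (simp add: tree_pair_rel_def C.frac_eq_def C.expansions_def)
  ultimately show ?thesis
    by (simp add: Frac_tree_def C.frac_group_def C.frac_def trivial_tree_eq)
qed

text \<open>Infinite forests are represented by finite ones, and padding with trivial trees at the end lets
  the numbers of roots and leaves match.\<close>

lemma emb_chain:
  assumes "f \<in> carrier (ForC_inf S R)" "g \<in> carrier (ForC_inf S R)" "h \<in> carrier (ForC_inf S R)"
  obtains F G H where "F \<in> forests S" "G \<in> forests S" "H \<in> forests S" "f = emb F" "g = emb G" "h = emb H"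
    "length G = forest_leaves F" "length H = forest_leaves G"
proof -
  obtain F G H where FGH: "F \<in> forests S" "G \<in> forests S" "H \<in> forests S" "f = emb F" "g = emb G" "h = emb H"
    using assms by (meson carrier_ForC_inf)
  show ?thesis
  proof (rule that)
    show "length (G @ replicate (forest_leaves F + length H) Leaf)
        = forest_leaves (F @ replicate (length G + length H) Leaf)"
      "length (H @ replicate (forest_leaves G + forest_leaves F) Leaf)
        = forest_leaves (G @ replicate (forest_leaves F + length H) Leaf)"
      by simp_all
  qed (use FGH in \<open>simp_all add: emb_pad\<close>)
qed

lemma emb_parallel:
  assumes "f \<in> carrier (ForC_inf S R)" "g \<in> carrier (ForC_inf S R)" "h \<in> carrier (ForC_inf S R)"
  obtains F G H where "F \<in> forests S" "G \<in> forests S" "H \<in> forests S" "f = emb F" "g = emb G" "h = emb H"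
    "length G = forest_leaves F" "length H = forest_leaves F"
proof -
  obtain F G H where FGH: "F \<in> forests S" "G \<in> forests S" "H \<in> forests S" "f = emb F" "g = emb G" "h = emb H"
    using assms by (meson carrier_ForC_inf)
  show ?thesis
  proof (rule that)
    show "length (G @ replicate (forest_leaves F + length H) Leaf)
        = forest_leaves (F @ replicate (length G + length H) Leaf)"
      "length (H @ replicate (forest_leaves F + length G) Leaf)
        = forest_leaves (F @ replicate (length G + length H) Leaf)"
      by simp_all
  qed (use FGH in \<open>simp_all add: emb_pad\<close>)
qed

lemma emb_same_roots:
  assumes "f \<in> carrier (ForC_inf S R)" "g \<in> carrier (ForC_inf S R)"
  obtains F G where "F \<in> forests S" "G \<in> forests S" "f = emb F" "g = emb G" "length F = length G"
proof -
  obtain F G where FG: "F \<in> forests S" "G \<in> forests S" "f = emb F" "g = emb G"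
    using assms by (meson carrier_ForC_inf)
  then show ?thesis
    by (intro that[of "F @ replicate (length G) Leaf" "G @ replicate (length F) Leaf"]) (simp_all add: emb_pad)
qed

lemma emb_same_leaves:
  assumes "f \<in> carrier (ForC_inf S R)" "g \<in> carrier (ForC_inf S R)"
  obtains F G where "F \<in> forests S" "G \<in> forests S" "f = emb F" "g = emb G" "forest_leaves F = forest_leaves G"
proof -
  obtain F G where FG: "F \<in> forests S" "G \<in> forests S" "f = emb F" "g = emb G"
    using assms by (meson carrier_ForC_inf)
  then show ?thesis
    by (intro that[of "F @ replicate (forest_leaves G) Leaf" "G @ replicate (forest_leaves F) Leaf"])
      (simp_all add: emb_pad)
qed

text \<open>Left cancellation and Ore's property concern finitely many infinite forests, and carry over
  from the category through finite representatives.\<close>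

sublocale I: pointed_ore_category "carrier (ForC_inf S R)" "\<lambda>_. ()" "\<lambda>_. ()" "seq_comp S R" "\<lambda>_. emb []"
  "()" UNIV "\<lambda>_. emb []"
proof
  fix f g assume "f \<in> carrier (ForC_inf S R)" "g \<in> carrier (ForC_inf S R)"
  then obtain F G where FG: "F \<in> forests S" "G \<in> forests S" "f = emb F" "g = emb G"
      "length G = forest_leaves F"
    using emb_chain by metis
  then show "seq_comp S R f g \<in> carrier (ForC_inf S R)"
    by (simp add: seq_comp_emb emb_closed forest_comp_forests)
next
  fix f g h assume "f \<in> carrier (ForC_inf S R)" "g \<in> carrier (ForC_inf S R)" "h \<in> carrier (ForC_inf S R)"
  then obtain F G H where "F \<in> forests S" "G \<in> forests S" "H \<in> forests S" "f = emb F" "g = emb G" "h = emb H"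
    "length G = forest_leaves F" "length H = forest_leaves G"
    by (rule emb_chain)
  then show "seq_comp S R (seq_comp S R f g) h = seq_comp S R f (seq_comp S R g h)"
    by (simp add: seq_comp_emb forest_comp_forests forest_comp_assoc)
next
  fix f assume "f \<in> carrier (ForC_inf S R)"
  then obtain F where F: "F \<in> forests S" "f = emb F"
    by (rule carrier_ForC_inf)
  have id: "emb [] = emb (replicate k Leaf)" for k
    using emb_pad[of "[]" k] by simp
  show "seq_comp S R f (emb []) = f"
    using F id[of "forest_leaves F"] by (simp add: seq_comp_emb forest_comp_id_right)
  show "seq_comp S R (emb []) f = f"
    using F id[of "length F"] by (simp add: seq_comp_emb forest_comp_id_left)
next
  fix f g h assume mem: "f \<in> carrier (ForC_inf S R)" "g \<in> carrier (ForC_inf S R)" "h \<in> carrier (ForC_inf S R)"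
    and eq: "seq_comp S R f g = seq_comp S R f h"
  from mem obtain F G H where FGH: "F \<in> forests S" "G \<in> forests S" "H \<in> forests S" "f = emb F" "g = emb G" "h = emb H"
    "length G = forest_leaves F" "length H = forest_leaves F"
    by (rule emb_parallel)
  then have "(forest_comp F G, forest_comp F H) \<in> rel"
    using eq by (simp add: seq_comp_emb emb_eq_iff forest_comp_forests)
  then have "ForC_comp S R (cl F) (cl G) = ForC_comp S R (cl F) (cl H)"
    using FGH by (simp add: cl_eqI)
  then have "cl G = cl H"
    by (rule C.left_cancel[rotated -1]) (use FGH in simp_all)
  then show "g = h"
    using FGH by (simp add: cl_eq_iff emb_eq_iff)
next
  fix f g assume "f \<in> carrier (ForC_inf S R)" "g \<in> carrier (ForC_inf S R)"
  then obtain F G where FG: "F \<in> forests S" "G \<in> forests S" "f = emb F" "g = emb G" "length F = length G"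
    by (rule emb_same_roots)
  then obtain X Y where XY: "X \<in> ForC S R" "Y \<in> ForC S R" "roots X = leaves (cl F)" "roots Y = leaves (cl G)"
      "ForC_comp S R (cl F) X = ForC_comp S R (cl G) Y"
    using C.oreE[of "cl F" "cl G"] by simp metis
  then obtain P Q where PQ: "P \<in> forests S" "Q \<in> forests S" "X = cl P" "Y = cl Q"
    by (metis ForCE)
  then have "length P = forest_leaves F" "length Q = forest_leaves G"
    using XY FG by simp_all
  moreover from this have "(forest_comp F P, forest_comp G Q) \<in> rel"
    using XY FG PQ by (simp add: cl_eq_iff forest_comp_forests)
  ultimately have "seq_comp S R f (emb P) = seq_comp S R g (emb Q)"
    using FG PQ by (simp add: seq_comp_emb emb_eq_iff forest_comp_forests)
  then show "\<exists>p\<in>carrier (ForC_inf S R). \<exists>q\<in>carrier (ForC_inf S R).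
      () = () \<and> () = () \<and> seq_comp S R f p = seq_comp S R g q"
    using PQ emb_closed by blast
qed (simp_all add: emb_closed)

\<comment> \<open>With a single object the equations between objects are trivial, and as rewrite rules they do not terminate.\<close>
lemmas [simp del] = I.comp_closed I.dom_comp I.cod_comp I.idt I.comp_idt I.idt_comp I.b_Ob I.\<rho> I.\<rho>_b

lemma Frac_ForC_inf_eq: "Frac (ForC_inf S R) = I.frac_group ()"
proof -
  have mult: "x \<otimes>\<^bsub>ForC_inf S R\<^esub> y = seq_comp S R x y" for x y
    by (simp add: ForC_inf_def)
  have one: "\<one>\<^bsub>ForC_inf S R\<^esub> = emb []"
    by (auto simp: ForC_inf_def trivial_tree_eq emb_def)
  have pairs: "carrier (ForC_inf S R) \<times> carrier (ForC_inf S R) = I.pairs ()"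
    by (auto simp: I.pairs_def)
  have "frac_rel (ForC_inf S R) = I.frac_eq ()"
    unfolding frac_rel_def I.frac_eq_def pairs I.expansions_def mult by simp
  then show ?thesis
    unfolding Frac_def I.frac_group_def I.frac_def pairs mult one by simp
qed

end

section \<open>Values of trees and forests in a group\<close>

text \<open>The value of a tree at the root number \<open>j\<close>. The vertices on the rightmost branch get the letters \<open>h\<close>
  and all others the letters \<open>g\<close>: for the last tree of a forest the rightmost branch consists of the vertices attached to a
  last leaf. With \<open>h = g\<close> the last tree is treated like the others. The right
  subtree is read before the left one because attaching the left one would move the right one to another leaf.\<close>

fun tree_word :: "('g, 'm) monoid_scheme \<Rightarrow> ('c \<Rightarrow> nat \<Rightarrow> 'g) \<Rightarrow> ('c \<Rightarrow> nat \<Rightarrow> 'g) \<Rightarrow> 'c tree \<Rightarrow> nat \<Rightarrow> 'g" where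
  "tree_word K g h Leaf j = \<one>\<^bsub>K\<^esub>"
| "tree_word K g h (Node l c r) j = h c j \<otimes>\<^bsub>K\<^esub> tree_word K g h r (j + 1) \<otimes>\<^bsub>K\<^esub> tree_word K g g l j"

fun forest_word :: "('g, 'm) monoid_scheme \<Rightarrow> ('c \<Rightarrow> nat \<Rightarrow> 'g) \<Rightarrow> ('c \<Rightarrow> nat \<Rightarrow> 'g) \<Rightarrow> 'c forest \<Rightarrow> nat \<Rightarrow> 'g" where
  "forest_word K g h [] j = \<one>\<^bsub>K\<^esub>"
| "forest_word K g h (t # f) j =
     forest_word K g h f (j + 1) \<otimes>\<^bsub>K\<^esub> tree_word K g (if f = [] then h else g) t j"

definition letter_prod :: "('g, 'm) monoid_scheme \<Rightarrow> ('l \<Rightarrow> 'g) \<Rightarrow> 'l list \<Rightarrow> 'g" where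
  "letter_prod K v ls = foldr (\<lambda>l x. v l \<otimes>\<^bsub>K\<^esub> x) ls \<one>\<^bsub>K\<^esub>"

lemma letter_prod_simps [simp]:
  "letter_prod K v [] = \<one>\<^bsub>K\<^esub>"
  "letter_prod K v (l # ls) = v l \<otimes>\<^bsub>K\<^esub> letter_prod K v ls"
  by (simp_all add: letter_prod_def)

lemma (in group) letter_prod_closed: "(\<And>l. l \<in> set ls \<Longrightarrow> v l \<in> carrier G) \<Longrightarrow> letter_prod G v ls \<in> carrier G"
  by (induction ls) auto

lemma (in group) letter_prod_snoc:
  "(\<And>l. l \<in> set ls \<Longrightarrow> v l \<in> carrier G) \<Longrightarrow> v l' \<in> carrier G \<Longrightarrow>
    letter_prod G v (ls @ [l']) = letter_prod G v ls \<otimes> v l'"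
  by (induction ls) (auto simp: m_assoc letter_prod_closed)

lemma (in group) eval_word_concat:
  assumes "e \<in> X \<rightarrow> carrier G" "\<And>l. l \<in> set ls \<Longrightarrow> \<sigma> l \<in> words X"
  shows "eval_word G e (concat (map \<sigma> ls)) = letter_prod G (\<lambda>l. eval_word G e (\<sigma> l)) ls"
  using assms(2)
proof (induction ls)
  case (Cons l ls)
  have "concat (map \<sigma> ls) \<in> words X"
    using Cons.prems by (intro words_concat) auto
  with Cons assms(1) show ?case
    by (simp add: eval_word_append[of e X])
qed simp

lemma letter_prod_cong: "(\<And>l. l \<in> set ls \<Longrightarrow> v l = w l) \<Longrightarrow> letter_prod K v ls = letter_prod K w ls"
  by (induction ls) auto

text \<open>In the infinite presentations both the plain and the hatted letters are \<open>shifted\<close> by the plain letters. The facts about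
  \<open>h\<close> below serve both cases \<open>h = g\<close> and \<open>h\<close> hatted.\<close>

locale shift_letters = group K for K :: "('g, 'm) monoid_scheme" (structure) +
  fixes S :: "'c set" and g :: "'c \<Rightarrow> nat \<Rightarrow> 'g"
  assumes g_closed: "c \<in> S \<Longrightarrow> 1 \<le> j \<Longrightarrow> g c j \<in> carrier K"
    and g_shift: "x \<in> S \<Longrightarrow> y \<in> S \<Longrightarrow> 1 \<le> j \<Longrightarrow> j < q \<Longrightarrow> g x q \<otimes> g y j = g y j \<otimes> g x (q + 1)"
begin

definition shifted :: "('c \<Rightarrow> nat \<Rightarrow> 'g) \<Rightarrow> bool" where
  "shifted h \<longleftrightarrow> (\<forall>c\<in>S. \<forall>j\<ge>1. h c j \<in> carrier K) \<and>
     (\<forall>x\<in>S. \<forall>y\<in>S. \<forall>j\<ge>1. \<forall>q>j. h x q \<otimes> g y j = g y j \<otimes> h x (q + 1))"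

lemma shifted_closed: "shifted h \<Longrightarrow> c \<in> S \<Longrightarrow> 1 \<le> j \<Longrightarrow> h c j \<in> carrier K"
  and shifted_shift: "shifted h \<Longrightarrow> x \<in> S \<Longrightarrow> y \<in> S \<Longrightarrow> 1 \<le> j \<Longrightarrow> j < q \<Longrightarrow>
    h x q \<otimes> g y j = g y j \<otimes> h x (q + 1)"
  by (auto simp: shifted_def)

lemma shifted_g: "shifted g"
  using g_closed g_shift by (auto simp: shifted_def)

abbreviation "tw \<equiv> tree_word K g"
abbreviation "fw \<equiv> forest_word K g"

lemma tw_closed [simp]: "shifted h \<Longrightarrow> set_tree t \<subseteq> S \<Longrightarrow> 1 \<le> j \<Longrightarrow> tw h t j \<in> carrier K"
proof (induction t arbitrary: h j)
  case (Node l c r)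
  then show ?case using shifted_g by (simp add: shifted_closed)
qed simp

lemma fw_closed [simp]: "shifted h \<Longrightarrow> f \<in> forests S \<Longrightarrow> 1 \<le> j \<Longrightarrow> fw h f j \<in> carrier K"
  by (induction f arbitrary: j) (auto simp: shifted_g)

text \<open>A tree with \<open>n\<close> interior vertices adds \<open>n\<close> leaves to the left of everything that sits at a
  larger root, so moving past it shifts the index by \<open>n\<close>.\<close>

lemma letter_tw_shift:
  "shifted h \<Longrightarrow> x \<in> S \<Longrightarrow> set_tree t \<subseteq> S \<Longrightarrow> 1 \<le> j \<Longrightarrow> j < q \<Longrightarrow>
    h x q \<otimes> tw g t j = tw g t j \<otimes> h x (q + size t)"
proof (induction t arbitrary: j q)
  case Leaf
  then show ?case by (simp add: shifted_closed)
next
  case (Node l c r)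
  then have mem: "c \<in> S" "set_tree l \<subseteq> S" "set_tree r \<subseteq> S" by auto
  note c = shifted_closed[OF Node.prems(1,2)]
  have "h x q \<otimes> tw g (Node l c r) j = (h x q \<otimes> g c j) \<otimes> tw g r (j + 1) \<otimes> tw g l j"
    using Node.prems mem by (simp add: c g_closed shifted_g m_assoc)
  also have "h x q \<otimes> g c j = g c j \<otimes> h x (q + 1)"
    using Node.prems mem by (simp add: shifted_shift)
  also have "g c j \<otimes> h x (q + 1) \<otimes> tw g r (j + 1) \<otimes> tw g l j
      = g c j \<otimes> (h x (q + 1) \<otimes> tw g r (j + 1)) \<otimes> tw g l j"
    using Node.prems mem by (simp add: c g_closed shifted_g m_assoc)
  also have "h x (q + 1) \<otimes> tw g r (j + 1) = tw g r (j + 1) \<otimes> h x (q + 1 + size r)"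
    using Node.prems mem by (intro Node.IH(2)) auto
  also have "g c j \<otimes> (tw g r (j + 1) \<otimes> h x (q + 1 + size r)) \<otimes> tw g l j
      = g c j \<otimes> tw g r (j + 1) \<otimes> (h x (q + 1 + size r) \<otimes> tw g l j)"
    using Node.prems mem by (simp add: c g_closed shifted_g m_assoc)
  also have "h x (q + 1 + size r) \<otimes> tw g l j = tw g l j \<otimes> h x (q + 1 + size r + size l)"
    using Node.prems mem by (intro Node.IH(1)) auto
  also have "g c j \<otimes> tw g r (j + 1) \<otimes> (tw g l j \<otimes> h x (q + 1 + size r + size l))
      = tw g (Node l c r) j \<otimes> h x (q + 1 + size r + size l)"
    using Node.prems mem by (simp add: c g_closed shifted_g m_assoc)
  finally show ?case by (simp add: ac_simps)
qed

lemma tw_tw_shift: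
  "shifted h \<Longrightarrow> set_tree s \<subseteq> S \<Longrightarrow> set_tree t \<subseteq> S \<Longrightarrow> 1 \<le> j \<Longrightarrow> j < q \<Longrightarrow>
    tw h s q \<otimes> tw g t j = tw g t j \<otimes> tw h s (q + size t)"
proof (induction s arbitrary: h q)
  case (Node l c r)
  then have mem: "c \<in> S" "set_tree l \<subseteq> S" "set_tree r \<subseteq> S" by auto
  note cl = shifted_closed[OF Node.prems(1)] shifted_g
  have "tw h (Node l c r) q \<otimes> tw g t j = h c q \<otimes> tw h r (q + 1) \<otimes> (tw g l q \<otimes> tw g t j)"
    using Node.prems mem by (simp add: cl m_assoc)
  also have "tw g l q \<otimes> tw g t j = tw g t j \<otimes> tw g l (q + size t)"
    using Node.prems mem by (intro Node.IH(1)) (auto simp: cl)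
  also have "h c q \<otimes> tw h r (q + 1) \<otimes> (tw g t j \<otimes> tw g l (q + size t))
      = h c q \<otimes> (tw h r (q + 1) \<otimes> tw g t j) \<otimes> tw g l (q + size t)"
    using Node.prems mem by (simp add: cl m_assoc)
  also have "tw h r (q + 1) \<otimes> tw g t j = tw g t j \<otimes> tw h r (q + 1 + size t)"
    using Node.prems mem by (intro Node.IH(2)) auto
  also have "h c q \<otimes> (tw g t j \<otimes> tw h r (q + 1 + size t)) \<otimes> tw g l (q + size t)
      = (h c q \<otimes> tw g t j) \<otimes> tw h r (q + 1 + size t) \<otimes> tw g l (q + size t)"
    using Node.prems mem by (simp add: cl m_assoc)
  also have "h c q \<otimes> tw g t j = tw g t j \<otimes> h c (q + size t)"
    using Node.prems mem by (intro letter_tw_shift)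
  also have "tw g t j \<otimes> h c (q + size t) \<otimes> tw h r (q + 1 + size t) \<otimes> tw g l (q + size t)
      = tw g t j \<otimes> tw h (Node l c r) (q + size t)"
    using Node.prems mem by (simp add: cl m_assoc)
  finally show ?case .
qed (simp add: shifted_g)

lemma fw_tw_shift:
  "shifted h \<Longrightarrow> f \<in> forests S \<Longrightarrow> set_tree t \<subseteq> S \<Longrightarrow> 1 \<le> j \<Longrightarrow> j < q \<Longrightarrow>
    fw h f q \<otimes> tw g t j = tw g t j \<otimes> fw h f (q + size t)"
proof (induction f arbitrary: q)
  case (Cons s f)
  let ?h = "if f = [] then h else g"
  have h: "shifted ?h" using Cons.prems shifted_g by simp
  have "fw h (s # f) q \<otimes> tw g t j = fw h f (q + 1) \<otimes> (tw ?h s q \<otimes> tw g t j)"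
    using Cons.prems h shifted_g by (simp add: m_assoc del: if_split)
  also have "tw ?h s q \<otimes> tw g t j = tw g t j \<otimes> tw ?h s (q + size t)"
    using Cons.prems h by (intro tw_tw_shift) auto
  also have "fw h f (q + 1) \<otimes> (tw g t j \<otimes> tw ?h s (q + size t))
      = (fw h f (q + 1) \<otimes> tw g t j) \<otimes> tw ?h s (q + size t)"
    using Cons.prems h shifted_g by (simp add: m_assoc del: if_split)
  also have "fw h f (q + 1) \<otimes> tw g t j = tw g t j \<otimes> fw h f (q + 1 + size t)"
    using Cons.prems by (intro Cons.IH) auto
  also have "tw g t j \<otimes> fw h f (q + 1 + size t) \<otimes> tw ?h s (q + size t) = tw g t j \<otimes> fw h (s # f) (q + size t)"
    using Cons.prems h shifted_g by (simp add: m_assoc del: if_split)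
  finally show ?case .
qed (simp add: shifted_g)

lemma fw_append:
  "shifted h \<Longrightarrow> f \<in> forests S \<Longrightarrow> k \<in> forests S \<Longrightarrow> k \<noteq> [] \<Longrightarrow> 1 \<le> j \<Longrightarrow>
    fw h (f @ k) j = fw h k (j + length f) \<otimes> fw g f j"
proof (induction f arbitrary: j)
  case (Cons t f)
  then have "fw h (f @ k) (j + 1) = fw h k (j + 1 + length f) \<otimes> fw g f (j + 1)"
    by (intro Cons.IH) auto
  with Cons.prems show ?case
    by (simp add: shifted_g m_assoc)
qed simp

lemma fw_replicate_Leaf [simp]: "fw h (replicate n Leaf) j = \<one>"
  by (induction n arbitrary: j) auto

text \<open>Grafting puts the forest on top of the right subtree before the left subtree is attached. To read the whole tree first and
  the forest afterwards, the former part of the forest has to move past the left subtree, which changes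
  its index from the number of its root to the number of the leaf that it is glued to.\<close>

lemma tw_graft:
  "shifted h \<Longrightarrow> set_tree t \<subseteq> S \<Longrightarrow> f \<in> forests S \<Longrightarrow> length f = size1 t \<Longrightarrow> 1 \<le> j \<Longrightarrow>
    tw h (graft t f) j = tw h t j \<otimes> fw h f j"
proof (induction t arbitrary: h f j)
  case Leaf
  then obtain s where "f = [s]" by (auto simp: length_Suc_conv)
  with Leaf show ?case by simp
next
  case (Node l c r)
  then obtain f1 f2 where f: "f = f1 @ f2" "length f1 = size1 l" "length f2 = size1 r"
    by (auto elim: split_forest)
  with Node.prems have mem: "c \<in> S" "set_tree l \<subseteq> S" "set_tree r \<subseteq> S" "f1 \<in> forests S" "f2 \<in> forests S" "f2 \<noteq> []"
    by (auto simp: size1_size)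
  have cl: "shifted h" "shifted g" "h c j \<in> carrier K"
    using Node.prems mem shifted_g by (auto intro: shifted_closed)
  have "tw h (graft (Node l c r) f) j = h c j \<otimes> tw h (graft r f2) (j + 1) \<otimes> tw g (graft l f1) j"
    using f by simp
  also have "tw h (graft r f2) (j + 1) = tw h r (j + 1) \<otimes> fw h f2 (j + 1)"
    using Node.prems mem f by (intro Node.IH(2)) auto
  also have "tw g (graft l f1) j = tw g l j \<otimes> fw g f1 j"
    using Node.prems mem f cl by (intro Node.IH(1)) auto
  also have "h c j \<otimes> (tw h r (j + 1) \<otimes> fw h f2 (j + 1)) \<otimes> (tw g l j \<otimes> fw g f1 j)
      = h c j \<otimes> tw h r (j + 1) \<otimes> (fw h f2 (j + 1) \<otimes> tw g l j) \<otimes> fw g f1 j"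
    using Node.prems mem cl by (simp add: m_assoc)
  also have "fw h f2 (j + 1) \<otimes> tw g l j = tw g l j \<otimes> fw h f2 (j + 1 + size l)"
    using Node.prems mem cl by (intro fw_tw_shift) auto
  also have "h c j \<otimes> tw h r (j + 1) \<otimes> (tw g l j \<otimes> fw h f2 (j + 1 + size l)) \<otimes> fw g f1 j
      = tw h (Node l c r) j \<otimes> (fw h f2 (j + length f1) \<otimes> fw g f1 j)"
    using Node.prems mem cl f by (simp add: m_assoc size1_size)
  also have "fw h f2 (j + length f1) \<otimes> fw g f1 j = fw h f j"
    using Node.prems mem cl f by (simp add: fw_append)
  finally show ?case .
qed

lemma fw_comp:
  "shifted h \<Longrightarrow> f \<in> forests S \<Longrightarrow> k \<in> forests S \<Longrightarrow> length k = forest_leaves f \<Longrightarrow> 1 \<le> j \<Longrightarrow>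
    fw h (forest_comp f k) j = fw h f j \<otimes> fw h k j"
proof (induction f arbitrary: k j)
  case (Cons t f)
  then obtain k1 k2 where k: "k = k1 @ k2" "length k1 = size1 t" "length k2 = forest_leaves f"
    by (auto elim: split_forest)
  with Cons.prems have mem: "set_tree t \<subseteq> S" "f \<in> forests S" "k1 \<in> forests S" "k2 \<in> forests S"
    by auto
  have cl: "shifted h" "shifted g" "1 \<le> j"
    using Cons.prems shifted_g by auto
  show ?case
  proof (cases "f = []")
    case True
    then show ?thesis using k Cons.prems by (simp add: tw_graft)
  next
    case False
    then have ne: "forest_comp f k2 \<noteq> []" "k2 \<noteq> []"
      using k length_forest_comp[of f k2] length_le_forest_leaves[of f]
      by (auto simp del: length_forest_comp simp flip: length_greater_0_conv)
    have "fw h (forest_comp (t # f) k) j = fw h (forest_comp f k2) (j + 1) \<otimes> tw g (graft t k1) j"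
      using k ne by simp
    also have "fw h (forest_comp f k2) (j + 1) = fw h f (j + 1) \<otimes> fw h k2 (j + 1)"
      using mem k cl by (intro Cons.IH) auto
    also have "tw g (graft t k1) j = tw g t j \<otimes> fw g k1 j"
      using mem k cl by (intro tw_graft) auto
    also have "fw h f (j + 1) \<otimes> fw h k2 (j + 1) \<otimes> (tw g t j \<otimes> fw g k1 j)
        = fw h f (j + 1) \<otimes> (fw h k2 (j + 1) \<otimes> tw g t j) \<otimes> fw g k1 j"
      using mem cl by (simp add: m_assoc)
    also have "fw h k2 (j + 1) \<otimes> tw g t j = tw g t j \<otimes> fw h k2 (j + 1 + size t)"
      using mem cl by (intro fw_tw_shift) auto
    also have "fw h f (j + 1) \<otimes> (tw g t j \<otimes> fw h k2 (j + 1 + size t)) \<otimes> fw g k1 j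
        = fw h (t # f) j \<otimes> (fw h k2 (j + length k1) \<otimes> fw g k1 j)"
      using mem cl k False by (simp add: m_assoc size1_size)
    also have "fw h k2 (j + length k1) \<otimes> fw g k1 j = fw h k j"
      using mem cl k ne by (simp add: fw_append)
    finally show ?thesis .
  qed
qed simp

text \<open>The pairs of forests with equal values form a congruence by functoriality, and it contains the skein relations. The induction
  carries the values for \<open>g\<close> along because the tensor product with a forest on the right turns a last tree into one that is
  not last.\<close>

lemma fw_skein_invariant:
  assumes pres: "skein_presentation S R" and h: "shifted h"
    and inv: "\<And>u u' j. (u, u') \<in> R \<Longrightarrow> 1 \<le> j \<Longrightarrow> tw h u j = tw h u' j"
      "\<And>u u' j. (u, u') \<in> R \<Longrightarrow> 1 \<le> j \<Longrightarrow> tw g u j = tw g u' j"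
  shows "(f, f') \<in> skein_rel S R \<Longrightarrow> 1 \<le> j \<Longrightarrow> fw h f j = fw h f' j \<and> fw g f j = fw g f' j"
proof (induction arbitrary: j rule: skein_rel.induct)
  interpret skein_category S R by standard (rule pres)
  case (base u u')
  then show ?case using inv h shifted_g skein_relation[OF base.hyps] by simp
next
  interpret skein_category S R by standard (rule pres)
  case (comp_left f k l)
  note props = skein_rel_invariants[OF comp_left.hyps(1)]
  show ?case
    using comp_left.IH comp_left.hyps comp_left.prems props h shifted_g by (simp add: fw_comp)
next
  interpret skein_category S R by standard (rule pres)
  case (comp_right f k l)
  note props = skein_rel_invariants[OF comp_right.hyps(1)]
  show ?case
    using comp_right.IH comp_right.hyps comp_right.prems props h shifted_g by (simp add: fw_comp)
next
  interpret skein_category S R by standard (rule pres)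
  case (tensor_left f k l)
  note props = skein_rel_invariants[OF tensor_left.hyps(1)]
  show ?case
  proof (cases "f = []")
    case True
    then show ?thesis using props by simp
  next
    case False
    then have "k \<noteq> []" using props by auto
    with False show ?thesis
      using tensor_left.IH[of "j + length l"] tensor_left.hyps tensor_left.prems props h shifted_g
      by (simp add: fw_append)
  qed
next
  interpret skein_category S R by standard (rule pres)
  case (tensor_right f k l)
  note props = skein_rel_invariants[OF tensor_right.hyps(1)]
  show ?case
  proof (cases "l = []")
    case True
    then show ?thesis using tensor_right by simp
  next
    case False
    then show ?thesis
      using tensor_right.IH[of j] tensor_right.hyps tensor_right.prems props h shifted_g
      by (simp add: fw_append)
  qed
qed auto

end

section \<open>Words of factorised trees\<close>

definition chain :: "('c \<times> nat) list \<Rightarrow> 'c forest" where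
  "chain cs = foldl forest_comp [Leaf]
     (map (\<lambda>k. elementary (fst (cs ! k)) (snd (cs ! k)) (Suc k)) [0..<length cs])"

definition positions_ok :: "('c \<times> nat) list \<Rightarrow> bool" where
  "positions_ok cs \<longleftrightarrow> (\<forall>k<length cs. 1 \<le> snd (cs ! k) \<and> snd (cs ! k) \<le> Suc k)"

lemma factorisation_iff: "factorisation u cs \<longleftrightarrow> positions_ok cs \<and> [u] = chain cs"
  by (simp add: factorisation_def positions_ok_def chain_def)

lemma positions_ok_snoc:
  "positions_ok (cs @ [(c, i)]) \<longleftrightarrow> positions_ok cs \<and> 1 \<le> i \<and> i \<le> Suc (length cs)"
  unfolding positions_ok_def by (auto simp: nth_append less_Suc_eq)

lemma chain_snoc: "chain (cs @ [(c, i)]) = forest_comp (chain cs) (elementary c i (Suc (length cs)))"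
proof -
  have "map (\<lambda>k. elementary (fst ((cs @ [(c, i)]) ! k)) (snd ((cs @ [(c, i)]) ! k)) (Suc k)) [0..<length cs]
      = map (\<lambda>k. elementary (fst (cs ! k)) (snd (cs ! k)) (Suc k)) [0..<length cs]"
    by (rule map_cong) (auto simp: nth_append)
  then show ?thesis by (simp add: chain_def del: map_eq_conv)
qed

lemma U_letters_snoc: "U_letters (cs @ [(c, i)]) j = U_letters cs j @ [Gen c (i + j - 1)]"
  by (simp add: U_letters_def)

lemma U_hat_letters_snoc:
  "U_hat_letters (cs @ [(c, i)]) j = U_hat_letters cs j
    @ [if i = Suc (length cs) then Hat c (i + j - 1) else Gen c (i + j - 1)]"
  by (auto simp: U_hat_letters_def nth_append)

lemma elementary_leaves [simp]: "1 \<le> i \<Longrightarrow> i \<le> n \<Longrightarrow> forest_leaves (elementary c i n) = Suc n"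
  and length_elementary [simp]: "1 \<le> i \<Longrightarrow> i \<le> n \<Longrightarrow> length (elementary c i n) = n"
  and elementary_forests [simp]: "elementary c i n \<in> forests S \<longleftrightarrow> c \<in> S"
  by (auto simp: elementary_def)

lemma chain_shape: "positions_ok cs \<Longrightarrow> length (chain cs) = 1 \<and> forest_leaves (chain cs) = Suc (length cs)"
proof (induction cs rule: rev_induct)
  case Nil
  then show ?case by (simp add: chain_def)
next
  case (snoc x cs)
  then show ?case by (cases x) (simp add: positions_ok_snoc chain_snoc)
qed

lemma set_graft_eq:
  "length f = size1 t \<Longrightarrow> set_tree (graft t f) = set_tree t \<union> (\<Union>s\<in>set f. set_tree s)"
proof (induction t arbitrary: f)
  case Leaf
  then obtain s where "f = [s]" by (auto simp: length_Suc_conv)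
  then show ?case by simp
next
  case (Node l c r)
  then obtain g1 g2 where "f = g1 @ g2" "length g1 = size1 l" "length g2 = size1 r"
    by (auto elim: split_forest)
  with Node.IH show ?case by auto
qed

lemma chain_colours: "positions_ok cs \<Longrightarrow> chain cs \<in> forests S \<Longrightarrow> fst ` set cs \<subseteq> S"
proof (induction cs rule: rev_induct)
  case (snoc x cs)
  obtain c i where x: "x = (c, i)" by (cases x)
  from snoc.prems x have ok: "positions_ok cs" "1 \<le> i" "i \<le> Suc (length cs)"
    by (simp_all add: positions_ok_snoc)
  obtain t where t: "chain cs = [t]" "size1 t = Suc (length cs)"
    using chain_shape[OF ok(1)] by (auto simp: length_Suc_conv)
  have "set_tree (graft t (elementary c i (Suc (length cs)))) \<subseteq> S"
    using snoc.prems ok t by (simp add: x chain_snoc)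
  then have "set_tree t \<subseteq> S" "c \<in> S"
    using ok t by (simp_all add: set_graft_eq) (simp add: elementary_def)
  then show ?case
    using snoc.IH ok t by (simp add: x)
qed simp

lemma factorisation_colours:
  assumes "factorisation u cs" "set_tree u \<subseteq> S" "(c, i) \<in> set cs"
  shows "c \<in> S \<and> 1 \<le> i"
proof -
  have ok: "positions_ok cs" "chain cs = [u]"
    using assms(1) by (simp_all add: factorisation_iff)
  then have "fst ` set cs \<subseteq> S"
    using assms(2) by (intro chain_colours) simp_all
  moreover obtain k where "k < length cs" "cs ! k = (c, i)"
    using assms(3) by (auto simp: in_set_conv_nth)
  ultimately show ?thesis
    using assms(3) ok(1) by (force simp: positions_ok_def)
qed

context shift_letters
begin

lemma fw_elementary:
  assumes "shifted h" "c \<in> S" "1 \<le> i" "i \<le> n" "1 \<le> j"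
  shows "fw h (elementary c i n) j = (if i = n then h c (i + j - 1) else g c (i + j - 1))"
proof -
  have cl: "h c (i + j - 1) \<in> carrier K" "g c (i + j - 1) \<in> carrier K"
    using assms shifted_closed shifted_g by auto
  have idx: "j + (i - 1) = i + j - 1" using assms by simp
  let ?t = "Node Leaf c Leaf # replicate (n - i) Leaf"
  have "fw h (replicate (i - 1) Leaf @ ?t) j = fw h ?t (j + (i - 1)) \<otimes> fw g (replicate (i - 1) Leaf) j"
    using assms by (subst fw_append) simp_all
  then show ?thesis
    unfolding idx using assms cl by (simp add: elementary_def)
qed

context
  fixes h :: "'c \<Rightarrow> nat \<Rightarrow> 'g" and v :: "'c gen \<Rightarrow> 'g"
  assumes h: "shifted h"
    and v: "\<And>c j. c \<in> S \<Longrightarrow> 1 \<le> j \<Longrightarrow> v (Gen c j) = g c j"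
      "\<And>c j. c \<in> S \<Longrightarrow> 1 \<le> j \<Longrightarrow> v (Hat c j) = h c j"
begin

lemma U_letters_closed:
  assumes "\<And>c i. (c, i) \<in> set cs \<Longrightarrow> c \<in> S \<and> 1 \<le> i" "1 \<le> j"
  shows "l \<in> set (U_letters cs j) \<Longrightarrow> v l \<in> carrier K"
    and "l \<in> set (U_hat_letters cs j) \<Longrightarrow> v l \<in> carrier K"
proof -
  have gh: "v (Gen c (i + j - 1)) \<in> carrier K" "v (Hat c (i + j - 1)) \<in> carrier K" if "(c, i) \<in> set cs" for c i
    using assms(1)[OF that] assms(2) h shifted_closed shifted_g by (auto simp: v)
  show "l \<in> set (U_letters cs j) \<Longrightarrow> v l \<in> carrier K"
    using gh by (auto simp: U_letters_def)
  assume "l \<in> set (U_hat_letters cs j)"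
  then obtain k where k: "k < length cs"
      "l = (case cs ! k of (c, i) \<Rightarrow> if i = Suc k then Hat c (i + j - 1) else Gen c (i + j - 1))"
    by (auto simp: U_hat_letters_def)
  obtain c i where "cs ! k = (c, i)" by (cases "cs ! k")
  with k gh[of c i] nth_mem[OF k(1)] show "v l \<in> carrier K" by auto
qed

text \<open>The \<open>k\<close>th elementary forest of a factorisation has \<open>k\<close> roots, so its vertex is at the last leaf
  if and only if its position is \<open>k\<close>. This is the case in which the word has a hatted letter.\<close>

lemma letter_prod_chain:
  assumes "positions_ok cs" "chain cs \<in> forests S" "1 \<le> j"
  shows "letter_prod K v (U_letters cs j) = fw g (chain cs) j"
    and "letter_prod K v (U_hat_letters cs j) = fw h (chain cs) j"
proof -
  have col: "c \<in> S \<and> 1 \<le> i" if ok: "positions_ok ds" "fst ` set ds \<subseteq> S" and mem: "(c, i) \<in> set ds" for ds c i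
  proof -
    obtain k where "k < length ds" "ds ! k = (c, i)"
      using mem by (auto simp: in_set_conv_nth)
    with ok mem show ?thesis
      by (force simp: positions_ok_def)
  qed
  have "positions_ok cs \<Longrightarrow> fst ` set cs \<subseteq> S \<Longrightarrow>
    chain cs \<in> forests S \<and> letter_prod K v (U_letters cs j) = fw g (chain cs) j
    \<and> letter_prod K v (U_hat_letters cs j) = fw h (chain cs) j"
  proof (induction cs rule: rev_induct)
    case Nil
    then show ?case by (simp add: chain_def U_letters_def U_hat_letters_def)
  next
    case (snoc x cs)
    obtain c i where x: "x = (c, i)" by (cases x)
    from snoc.prems x have ok: "positions_ok cs" "1 \<le> i" "i \<le> Suc (length cs)" "c \<in> S" "fst ` set cs \<subseteq> S"
      by (simp_all add: positions_ok_snoc)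
    note IH = snoc.IH[OF ok(1,5)] and shape = chain_shape[OF ok(1)]
    define d where "d = i + j - 1"
    have "1 \<le> d" using ok assms(3) by (simp add: d_def)
    then have cl: "v (Gen c d) = g c d" "v (Hat c d) = h c d" "g c d \<in> carrier K" "h c d \<in> carrier K"
      using ok h shifted_g shifted_closed by (auto simp: v)
    have fwe: "fw g (elementary c i (Suc (length cs))) j = g c d"
        "fw h (elementary c i (Suc (length cs))) j = (if i = Suc (length cs) then h c d else g c d)"
      using fw_elementary[OF shifted_g ok(4,2,3) assms(3)] fw_elementary[OF h ok(4,2,3) assms(3)]
      by (simp_all only: d_def if_cancel)
    have closed: "l \<in> set (U_letters cs j) \<Longrightarrow> v l \<in> carrier K"
        "l \<in> set (U_hat_letters cs j) \<Longrightarrow> v l \<in> carrier K" for l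
      using U_letters_closed[of cs j l] col[OF ok(1,5)] assms(3) by blast+
    show ?case
      unfolding x U_letters_snoc U_hat_letters_snoc chain_snoc d_def[symmetric]
      using IH shape ok cl h shifted_g assms(3) closed
      by (simp add: letter_prod_snoc fw_comp fwe forest_comp_forests)
  qed
  then show "letter_prod K v (U_letters cs j) = fw g (chain cs) j"
      "letter_prod K v (U_hat_letters cs j) = fw h (chain cs) j"
    using chain_colours assms by blast+
qed

lemma letter_prod_factorisation:
  assumes "factorisation u cs" "set_tree u \<subseteq> S" "1 \<le> j"
  shows "letter_prod K v (U_letters cs j) = tw g u j"
    and "letter_prod K v (U_hat_letters cs j) = tw h u j"
proof -
  have "positions_ok cs" "chain cs = [u]"
    using assms(1) by (simp_all add: factorisation_iff)
  then show "letter_prod K v (U_letters cs j) = tw g u j" "letter_prod K v (U_hat_letters cs j) = tw h u j"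
    using letter_prod_chain[of cs j] assms h shifted_g by simp_all
qed

end

text \<open>Conjugation by the letter of colour \<open>a\<close> at 1 raises the indices \<open>\<ge> 2\<close>, so that an identity
  between values of trees propagates from the indices 1 and 2 to all others.\<close>

lemma tw_eq_from_12:
  assumes h: "shifted h" and a: "a \<in> S" and u: "set_tree u \<subseteq> S" "set_tree u' \<subseteq> S"
    and eq: "\<And>i. i \<in> {1, 2} \<Longrightarrow> tw h u i = tw h u' i" and "1 \<le> j"
  shows "tw h u j = tw h u' j"
  using \<open>1 \<le> j\<close>
proof (induction j rule: dec_induct)
  case base
  then show ?case using eq by simp
next
  case (step n)
  show ?case
  proof (cases "n = 1")
    case True
    then show ?thesis using eq[of 2] by (simp add: numeral_2_eq_2)
  next
    case False
    with step have n: "1 < n" by simp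
    have shift: "tw h t n \<otimes> g a 1 = g a 1 \<otimes> tw h t (n + 1)" if "set_tree t \<subseteq> S" for t
      using tw_tw_shift[OF h that, of "Node Leaf a Leaf" 1 n] a n g_closed[of a 1] by simp
    have "g a 1 \<otimes> tw h u (n + 1) = g a 1 \<otimes> tw h u' (n + 1)"
      using shift[OF u(1)] shift[OF u(2)] step.IH by simp
    then show ?thesis
      using h u a g_closed[of a 1] by simp
  qed
qed

end

section \<open>Functors from forests to groups\<close>

text \<open>Vertices at different leaves can be attached in either order. The vertex at \<open>j\<close>, if it comes first, moves
  the leaf number \<open>q > j\<close> to \<open>q + 1\<close>.\<close>

lemma elementary_comm:
  assumes "1 \<le> j" "j < q" "q \<le> n"
  shows "forest_comp (elementary x q n) (elementary y j (Suc n))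
    = forest_comp (elementary y j n) (elementary x (Suc q) (Suc n))"
proof -
  define p b d where "p = j - 1" and "b = q - 1 - j" and "d = n - q"
  with assms have jqn: "j = p + 1" "q = p + b + 2" "n = p + b + 2 + d"
    by simp_all
  define A B D where "A = replicate p (Leaf :: 'a tree)"
    and "B = replicate b (Leaf :: 'a tree)" and "D = replicate d (Leaf :: 'a tree)"
  have *: "elementary x q n = A @ [Leaf] @ B @ [Node Leaf x Leaf] @ D"
    "elementary y j (Suc n) = A @ [Node Leaf y Leaf] @ B @ [Leaf, Leaf] @ D"
    "elementary y j n = A @ [Node Leaf y Leaf] @ B @ [Leaf] @ D"
    "elementary x (Suc q) (Suc n) = A @ [Leaf, Leaf] @ B @ [Node Leaf x Leaf] @ D"
    unfolding jqn by (simp_all add: elementary_def A_def B_def D_def replicate_add replicate_app_Cons_same)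
  have comp: "forest_comp (A @ F) (A @ G) = A @ forest_comp F G"
      "forest_comp (B @ F) (B @ G) = B @ forest_comp F G" "forest_comp D D = D" for F G
    using forest_comp_append[of A A F G] forest_comp_append[of B B F G]
      forest_comp_id_left[of A] forest_comp_id_left[of B] forest_comp_id_left[of D]
    by (simp_all add: A_def B_def D_def)
  show ?thesis
    unfolding * by (simp add: comp)
qed

text \<open>The decomposition of a forest that the values of trees follow: the root vertex of the \<open>j\<close>th tree first,
  then its right and its left subtree.\<close>

lemma placed_node:
  "replicate (j - 1) Leaf @ [Node l c r] @ replicate k Leaf
    = forest_comp (forest_comp (replicate (j - 1) Leaf @ [Node Leaf c Leaf] @ replicate k Leaf)
        (replicate (j - 1) Leaf @ [Leaf, r] @ replicate k Leaf))
        (replicate (j - 1) Leaf @ [l] @ replicate (size1 r) Leaf @ replicate k Leaf)"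
proof -
  have id: "forest_comp (replicate m Leaf) (replicate m Leaf) = replicate m Leaf" for m
    using forest_comp_id_left[of "replicate m Leaf"] by simp
  show ?thesis
    using graft_leaves[of r] by (simp add: forest_comp_append id)
qed

text \<open>The values of a functor on elementary forests satisfy the shift relations, and its values on all
  forests are the words in these letters. Letters with a single index are enough because the value of an elementary forest depends
  on \<open>n\<close> only through whether \<open>i = n\<close>.\<close>

locale forest_functor = group K for K :: "('g, 'm) monoid_scheme" (structure) +
  fixes S :: "'c set" and g h :: "'c \<Rightarrow> nat \<Rightarrow> 'g" and F :: "'c forest \<Rightarrow> 'g"
  assumes F_closed: "f \<in> forests S \<Longrightarrow> f \<noteq> [] \<Longrightarrow> F f \<in> carrier K"
    and F_comp: "f \<in> forests S \<Longrightarrow> k \<in> forests S \<Longrightarrow> f \<noteq> [] \<Longrightarrow> length k = forest_leaves f \<Longrightarrow>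
      F (forest_comp f k) = F f \<otimes> F k"
    and F_id: "F (replicate (Suc n) Leaf) = \<one>"
    and F_elementary: "c \<in> S \<Longrightarrow> 1 \<le> i \<Longrightarrow> i \<le> n \<Longrightarrow> F (elementary c i n) = (if i = n then h c i else g c i)"
begin

lemma g_eq: "c \<in> S \<Longrightarrow> 1 \<le> i \<Longrightarrow> i < n \<Longrightarrow> g c i = F (elementary c i n)"
  and h_eq: "c \<in> S \<Longrightarrow> 1 \<le> i \<Longrightarrow> h c i = F (elementary c i i)"
  by (simp_all add: F_elementary)

lemma elementary_ne: "1 \<le> i \<Longrightarrow> i \<le> n \<Longrightarrow> elementary c i n \<noteq> []"
  using length_elementary[of i n c] by force

lemma gh_closed: "c \<in> S \<Longrightarrow> 1 \<le> i \<Longrightarrow> g c i \<in> carrier K" "c \<in> S \<Longrightarrow> 1 \<le> i \<Longrightarrow> h c i \<in> carrier K"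
  using g_eq[of c i "Suc i"] h_eq[of c i] by (simp_all add: F_closed elementary_ne)

lemma F_shift:
  assumes "x \<in> S" "y \<in> S" "1 \<le> j" "j < q" "q \<le> n"
  shows "F (elementary x q n) \<otimes> F (elementary y j (Suc n)) = F (elementary y j n) \<otimes> F (elementary x (Suc q) (Suc n))"
  using assms elementary_comm[of j q n x y] by (simp add: elementary_ne flip: F_comp)

sublocale shift_letters K S g
proof
  fix x y j q assume *: "x \<in> S" "y \<in> S" "1 \<le> j" "j < (q :: nat)"
  then show "g x q \<otimes> g y j = g y j \<otimes> g x (q + 1)"
    using F_shift[of x y j q "Suc q"] by (simp add: F_elementary)
qed (rule gh_closed)

lemma shifted_h: "shifted h"
  unfolding shifted_def
proof (intro conjI ballI allI impI)
  fix x y j q assume *: "x \<in> S" "y \<in> S" "1 \<le> j" "j < (q :: nat)"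
  then show "h x q \<otimes> g y j = g y j \<otimes> h x (q + 1)"
    using F_shift[of x y j q q] by (simp add: F_elementary)
qed (rule gh_closed)

lemma F_placed_tree:
  "set_tree t \<subseteq> S \<Longrightarrow> 1 \<le> j \<Longrightarrow>
    F (replicate (j - 1) Leaf @ [t] @ replicate k Leaf) = tree_word K g (if k = 0 then h else g) t j"
proof (induction t arbitrary: j k)
  case Leaf
  have "replicate (j - 1) Leaf @ [Leaf] @ replicate k Leaf = replicate (Suc (j - 1 + k)) (Leaf :: 'c tree)"
    by (simp add: replicate_add replicate_app_Cons_same)
  then show ?case
    using F_id[of "j - 1 + k"] by (simp del: replicate_Suc)
next
  case (Node l c r)
  then have mem: "c \<in> S" "set_tree l \<subseteq> S" "set_tree r \<subseteq> S" by auto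
  let ?h = "if k = 0 then h else g"
  have cl: "?h c j \<in> carrier K" "tw ?h r (j + 1) \<in> carrier K" "tw g l j \<in> carrier K"
    using mem Node.prems gh_closed shifted_h shifted_g by auto
  define A B D where "A = replicate (j - 1) Leaf @ [Node Leaf c Leaf] @ replicate k Leaf"
    and "B = replicate (j - 1) Leaf @ [Leaf, r] @ replicate k Leaf"
    and "D = replicate (j - 1) Leaf @ [l] @ replicate (size1 r) Leaf @ replicate k Leaf"
  have shape: "A \<in> forests S" "B \<in> forests S" "D \<in> forests S" "A \<noteq> []"
      "length B = forest_leaves A" "length D = forest_leaves B"
    using mem by (simp_all add: A_def B_def D_def)
  have "F A = ?h c j"
    unfolding A_def using F_elementary[of c j "j + k"] mem Node.prems by (simp add: elementary_def)
  moreover have "F B = tw ?h r (j + 1)"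
    unfolding B_def using Node.IH(2)[of "j + 1" k] mem Node.prems by (cases j) (simp_all add: replicate_app_Cons_same)
  moreover have "F D = tw g l j"
    unfolding D_def using Node.IH(1)[of j "size1 r + k"] mem Node.prems by (simp add: replicate_add size1_size)
  moreover have "F (forest_comp (forest_comp A B) D) = F A \<otimes> F B \<otimes> F D"
    using shape forest_comp_forests[of B A S] length_forest_comp[of A B]
    by (subst F_comp) (auto simp: F_comp simp flip: length_greater_0_conv)
  moreover have "replicate (j - 1) Leaf @ [Node l c r] @ replicate k Leaf = forest_comp (forest_comp A B) D"
    unfolding A_def B_def D_def by (rule placed_node)
  ultimately show ?case by (simp only: tree_word.simps)
qed

lemma F_forest: "f \<in> forests S \<Longrightarrow> f \<noteq> [] \<Longrightarrow> 1 \<le> j \<Longrightarrow> F (replicate (j - 1) Leaf @ f) = fw h f j"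
proof (induction f arbitrary: j)
  case (Cons t f)
  show ?case
  proof (cases "f = []")
    case True
    then show ?thesis
      using F_placed_tree[of t j 0] Cons.prems shifted_h by simp
  next
    case False
    have id: "forest_comp (replicate m Leaf) (replicate m Leaf) = replicate m Leaf" for m
      using forest_comp_id_left[of "replicate m Leaf"] by simp
    have eq: "replicate (j - 1) Leaf @ t # f = forest_comp (replicate (j - 1) Leaf @ Leaf # f)
        (replicate (j - 1) Leaf @ [t] @ replicate (forest_leaves f) Leaf)"
      by (simp add: forest_comp_append id forest_comp_id_right)
    have "F (replicate (j - 1) Leaf @ Leaf # f) = fw h f (j + 1)"
      using Cons.IH[of "j + 1"] False Cons.prems by (cases j) (simp_all add: replicate_app_Cons_same)
    moreover have "F (replicate (j - 1) Leaf @ [t] @ replicate (forest_leaves f) Leaf) = tw g t j"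
      using F_placed_tree[of t j "forest_leaves f"] Cons.prems False length_le_forest_leaves[of f]
      by (auto simp: le_less)
    ultimately show ?thesis
      unfolding eq using Cons.prems False by (simp add: F_comp)
  qed
qed simp

lemma tw_generate:
  assumes X: "\<And>c j. c \<in> S \<Longrightarrow> 1 \<le> j \<Longrightarrow> g c j \<in> generate K X" "\<And>c j. c \<in> S \<Longrightarrow> 1 \<le> j \<Longrightarrow> h' c j \<in> generate K X"
  shows "set_tree t \<subseteq> S \<Longrightarrow> 1 \<le> j \<Longrightarrow> tw h' t j \<in> generate K X"
  using X(2)
proof (induction t arbitrary: h' j)
  case (Node l c r)
  then have "tw g l j \<in> generate K X" "tw h' r (j + 1) \<in> generate K X" "h' c j \<in> generate K X"
    using X(1) by auto
  then show ?case by (auto intro: generate.eng)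
qed (auto intro: generate.one)

lemma fw_generate:
  assumes X: "\<And>c j. c \<in> S \<Longrightarrow> 1 \<le> j \<Longrightarrow> g c j \<in> generate K X" "\<And>c j. c \<in> S \<Longrightarrow> 1 \<le> j \<Longrightarrow> h' c j \<in> generate K X"
  shows "f \<in> forests S \<Longrightarrow> 1 \<le> j \<Longrightarrow> fw h' f j \<in> generate K X"
proof (induction f arbitrary: j)
  case (Cons t f)
  then have "tw (if f = [] then h' else g) t j \<in> generate K X" "fw h' f (j + 1) \<in> generate K X"
    using X by (auto intro!: tw_generate)
  then show ?case by (auto intro: generate.eng)
qed (auto intro: generate.one)

end

section \<open>Commutation relations of small indices\<close>

context group
begin

text \<open>The three letters are conjugated by \<open>A\<close> simultaneously.\<close>

lemma transport_commutation:
  assumes "A \<in> carrier G" "u \<in> carrier G" "v \<in> carrier G" "w \<in> carrier G"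
    "u' \<in> carrier G" "v' \<in> carrier G" "w' \<in> carrier G"
    and eq: "u \<otimes> A = A \<otimes> u'" "v \<otimes> A = A \<otimes> v'" "w \<otimes> A = A \<otimes> w'" "u \<otimes> v = v \<otimes> w"
  shows "u' \<otimes> v' = v' \<otimes> w'"
proof -
  have "A \<otimes> (u' \<otimes> v') = u \<otimes> A \<otimes> v'" using assms(1-7) eq(1) by (simp flip: m_assoc)
  also have "\<dots> = u \<otimes> v \<otimes> A" using assms(1-7) eq(2) by (simp add: m_assoc)
  also have "\<dots> = v \<otimes> (w \<otimes> A)" using assms(1-7) eq(4) by (simp add: m_assoc)
  also have "\<dots> = v \<otimes> A \<otimes> w'" using assms(1-7) eq(3) by (simp add: m_assoc)
  also have "\<dots> = A \<otimes> (v' \<otimes> w')" using assms(1-7) eq(2) by (simp add: m_assoc)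
  finally show ?thesis using assms(1-7) by simp
qed

text \<open>Here \<open>z = B\<inverse> y B\<close> and \<open>z' = B'\<inverse> y' B'\<close> are the next letters after \<open>y\<close> and \<open>y'\<close>. Moving past \<open>x\<close>
  turns \<open>B\<close> into \<open>B'\<close> and \<open>y\<close> into \<open>y'\<close>, hence \<open>z\<close> into \<open>z'\<close>.\<close>

lemma commutation_step:
  assumes "B \<in> carrier G" "B' \<in> carrier G" "x \<in> carrier G" "y \<in> carrier G" "y' \<in> carrier G"
    "z \<in> carrier G" "z' \<in> carrier G"
    and eq: "B \<otimes> x = x \<otimes> B'" "y \<otimes> x = x \<otimes> y'" "y \<otimes> B = B \<otimes> z" "y' \<otimes> B' = B' \<otimes> z'"
  shows "z \<otimes> x = x \<otimes> z'"
proof -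
  have "B \<otimes> (z \<otimes> x) = y \<otimes> B \<otimes> x" using assms(1-7) eq(3) by (simp flip: m_assoc)
  also have "\<dots> = y \<otimes> x \<otimes> B'" using assms(1-7) eq(1) by (simp add: m_assoc)
  also have "\<dots> = x \<otimes> (y' \<otimes> B')" using assms(1-7) eq(2) by (simp add: m_assoc)
  also have "\<dots> = x \<otimes> B' \<otimes> z'" using assms(1-7) eq(4) by (simp add: m_assoc)
  also have "\<dots> = B \<otimes> (x \<otimes> z')" using assms(1-7) eq(1)[symmetric] by (simp add: m_assoc)
  finally show ?thesis using assms(1-7) by simp
qed

context
  fixes S :: "'c set" and g z :: "'c \<Rightarrow> nat \<Rightarrow> 'a" and a :: 'c
  assumes a: "a \<in> S"
    and g: "\<And>c k. c \<in> S \<Longrightarrow> 1 \<le> k \<Longrightarrow> g c k \<in> carrier G"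
    and z: "\<And>c k. c \<in> S \<Longrightarrow> 1 \<le> k \<Longrightarrow> z c k \<in> carrier G"
    and g_conj: "\<And>c k. c \<in> S \<Longrightarrow> 2 \<le> k \<Longrightarrow> g c k \<otimes> g a 1 = g a 1 \<otimes> g c (k + 1)"
    and z_conj: "\<And>c k. c \<in> S \<Longrightarrow> 2 \<le> k \<Longrightarrow> z c k \<otimes> g a 1 = g a 1 \<otimes> z c (k + 1)"
    and g_base: "\<And>x y i j. x \<in> S \<Longrightarrow> y \<in> S \<Longrightarrow> i \<in> {1, 2} \<Longrightarrow> j \<in> {1, 2} \<Longrightarrow> (x, i) \<noteq> (a, 1) \<Longrightarrow>
      g y (i + j) \<otimes> g x i = g x i \<otimes> g y (i + j + 1)"
    and z_base: "\<And>x y i j. x \<in> S \<Longrightarrow> y \<in> S \<Longrightarrow> i \<in> {1, 2} \<Longrightarrow> j \<in> {1, 2} \<Longrightarrow> (x, i) \<noteq> (a, 1) \<Longrightarrow>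
      z y (i + j) \<otimes> g x i = g x i \<otimes> z y (i + j + 1)"
begin

text \<open>The letters \<open>a\<^sub>2\<close> and \<open>a\<^sub>3\<close> serve as \<open>B\<close> in the step lemma. So the relations with \<open>a\<^sub>2\<close> come
  first; conjugation by \<open>a\<^sub>1\<close> gives those with \<open>a\<^sub>3\<close> and \<open>a\<^sub>4\<close>, and with these the relations with \<open>x\<^sub>2\<close> and
  \<open>x\<^sub>1\<close> extend to all indices. Conjugation by \<open>a\<^sub>1\<close> then reaches all larger indices of \<open>x\<close>.\<close>

lemma shift_conj:
  assumes "x \<in> S" "y \<in> S" "2 \<le> i" "i < q" "z y q \<otimes> g x i = g x i \<otimes> z y (q + 1)"
  shows "z y (q + 1) \<otimes> g x (i + 1) = g x (i + 1) \<otimes> z y (q + 2)"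
  by (rule transport_commutation[of "g a 1" "z y q" "g x i" "z y (q + 1)"])
     (use assms g_conj[of x i] z_conj[of y q] z_conj[of y "q + 1"] in \<open>auto simp: a g z\<close>)

lemma shift_a2:
  assumes "y \<in> S" "3 \<le> q"
  shows "z y q \<otimes> g a 2 = g a 2 \<otimes> z y (q + 1)"
  using assms(2)
proof (induction q rule: less_induct)
  case (less q)
  consider "q = 3" | "q = 4" | "5 \<le> q" using less.prems by linarith
  then show ?case
  proof cases
    case 1
    then show ?thesis using z_base[of a y 2 1] a assms by simp
  next
    case 2
    then show ?thesis using z_base[of a y 2 2] a assms by simp
  next
    case 3
    define p where "p = q - 2"
    with 3 have p: "q = p + 2" "3 \<le> p" by simp_all
    have IH: "z y p \<otimes> g a 2 = g a 2 \<otimes> z y (p + 1)" "z y (p + 1) \<otimes> g a 2 = g a 2 \<otimes> z y (p + 2)"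
      using less.IH[of p] less.IH[of "p + 1"] p by simp_all
    have a3: "z y (p + 1) \<otimes> g a 3 = g a 3 \<otimes> z y (p + 2)"
      using shift_conj[of a y 2 p] IH(1) p a assms by simp
    have a4: "z y (p + 2) \<otimes> g a 4 = g a 4 \<otimes> z y (p + 2 + 1)"
      using shift_conj[of a y 3 "p + 1"] a3 p a assms by simp
    have B: "g a 3 \<otimes> g a 2 = g a 2 \<otimes> g a 4"
      using g_base[of a a 2 1] a by simp
    show ?thesis
      unfolding p(1)
      by (rule commutation_step[OF _ _ _ _ _ _ _ B IH(2)])
         (use a3 a4 assms a in \<open>auto simp: g z\<close>)
  qed
qed

lemma shift_a3: "y \<in> S \<Longrightarrow> 4 \<le> q \<Longrightarrow> z y q \<otimes> g a 3 = g a 3 \<otimes> z y (q + 1)"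
  using shift_conj[of a y 2 "q - 1"] shift_a2[of y "q - 1"] a by simp

lemma shift_a4: "y \<in> S \<Longrightarrow> 5 \<le> q \<Longrightarrow> z y q \<otimes> g a 4 = g a 4 \<otimes> z y (q + 1)"
  using shift_conj[of a y 3 "q - 1"] shift_a3[of y "q - 1"] a by simp

lemma shift_2:
  assumes "x \<in> S" "y \<in> S" "3 \<le> q"
  shows "z y q \<otimes> g x 2 = g x 2 \<otimes> z y (q + 1)"
  using assms(3)
proof (induction q rule: dec_induct)
  case base
  then show ?case using z_base[of x y 2 1] assms by simp
next
  case (step q)
  show ?case
  proof (cases "q = 3")
    case True
    then show ?thesis using z_base[of x y 2 2] assms by simp
  next
    case False
    have B: "g a 3 \<otimes> g x 2 = g x 2 \<otimes> g a 4"
      using g_base[of x a 2 1] a assms by simp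
    show ?thesis
      by (rule commutation_step[OF _ _ _ _ _ _ _ B step.IH])
         (use shift_a3[of y q] shift_a4[of y "q + 1"] step False assms a in \<open>auto simp: g z\<close>)
  qed
qed

lemma shift_1:
  assumes "x \<in> S" "y \<in> S" "2 \<le> q"
  shows "z y q \<otimes> g x 1 = g x 1 \<otimes> z y (q + 1)"
proof (cases "x = a")
  case True
  then show ?thesis using z_conj assms by simp
next
  case False
  show ?thesis
    using assms(3)
  proof (induction q rule: dec_induct)
    case base
    then show ?case using z_base[of x y 1 1] assms False by (simp add: numeral_2_eq_2)
  next
    case (step q)
    show ?case
    proof (cases "q = 2")
      case True
      then show ?thesis using z_base[of x y 1 2] assms False by (simp add: eval_nat_numeral)
    next
      case q: False
      have B: "g a 2 \<otimes> g x 1 = g x 1 \<otimes> g a 3"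
        using g_base[of x a 1 1] a assms False by (simp add: numeral_2_eq_2 numeral_3_eq_3)
      show ?thesis
        by (rule commutation_step[OF _ _ _ _ _ _ _ B step.IH])
           (use shift_a2[of y q] shift_a3[of y "q + 1"] step q assms a in \<open>auto simp: g z\<close>)
    qed
  qed
qed

lemma shift_all:
  assumes "x \<in> S" "y \<in> S" "1 \<le> j" "j < q"
  shows "z y q \<otimes> g x j = g x j \<otimes> z y (q + 1)"
proof (cases "j = 1")
  case True
  then show ?thesis using shift_1 assms by simp
next
  case False
  with assms have "2 \<le> j" by simp
  then show ?thesis
    using assms(4)
  proof (induction j arbitrary: q rule: dec_induct)
    case base
    then show ?case using shift_2 assms by simp
  next
    case (step j)
    then obtain p where p: "q = p + 1" "j < p" by (cases q) auto
    then show ?case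
      using shift_conj[OF assms(1,2) step.hyps(1) p(2) step.IH[OF p(2)]] by simp
  qed
qed

end

end

lemma (in group) eval_word_comm_iff:
  assumes "e \<in> X \<rightarrow> carrier G" "v \<in> words X" "w \<in> words X"
  shows "eval_word G e (word_comm v w) = \<one> \<longleftrightarrow>
    eval_word G e v \<otimes> eval_word G e w = eval_word G e w \<otimes> eval_word G e v"
proof -
  have c: "eval_word G e v \<in> carrier G" "eval_word G e w \<in> carrier G"
    using assms by auto
  have "eval_word G e (word_comm v w)
      = (eval_word G e v \<otimes> eval_word G e w) \<otimes> inv (eval_word G e w \<otimes> eval_word G e v)"
    unfolding word_comm_def using assms c
    by (simp add: eval_word_append[of e X] eval_word_inv[of e X] m_assoc inv_mult_group)
  then show ?thesis
    using c inv_solve_right'[of "\<one>" "eval_word G e v \<otimes> eval_word G e w" "eval_word G e w \<otimes> eval_word G e v"]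
    by auto
qed

lemma conj_a_0: "conj_a a 0 w = w"
  by (simp add: conj_a_def)

lemma conj_a_Suc: "conj_a a (Suc m) w = [(Gen a 1, False)] @ conj_a a m w @ [(Gen a 1, True)]"
  by (simp add: conj_a_def replicate_append_same)

lemma words_conj_a: "Gen a 1 \<in> X \<Longrightarrow> w \<in> words X \<Longrightarrow> conj_a a m w \<in> words X"
  by (induction m) (auto simp: conj_a_0 conj_a_Suc)

lemma (in group) eval_word_conj_a_Suc:
  assumes "e \<in> X \<rightarrow> carrier G" "Gen a 1 \<in> X" "w \<in> words X"
  shows "eval_word G e (conj_a a m w) \<otimes> e (Gen a 1) = e (Gen a 1) \<otimes> eval_word G e (conj_a a (Suc m) w)"
proof -
  have c: "e (Gen a 1) \<in> carrier G" "conj_a a m w \<in> words X"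
    using assms words_conj_a by auto
  then have "eval_word G e (conj_a a m w) \<in> carrier G"
    using assms(1) by simp
  then show ?thesis
    unfolding conj_a_Suc using assms c by (simp add: eval_word_append[of e X])
qed

lemma conj_a_add: "conj_a a (m + n) w = conj_a a m (conj_a a n w)"
proof -
  have "replicate (m + n) (Gen a 1, True) = replicate n (Gen a 1, True) @ replicate m (Gen a 1, True)"
    by (simp only: add.commute[of m n] replicate_add)
  then show ?thesis by (simp add: conj_a_def replicate_add)
qed

lemma short_eq:
  assumes "X = Gen \<or> X = Hat" "2 \<le> k"
  shows "short a (X c k) = conj_a a (k - 2) (pos (X c 2))"
proof (cases "k = 2")
  case True
  then show ?thesis using assms by (auto simp: conj_a_0)
next
  case False
  then show ?thesis using assms by auto
qed

lemma short_conj: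
  assumes "X = Gen \<or> X = Hat" "2 \<le> k"
  shows "short a (X c (k + m)) = conj_a a m (short a (X c k))"
proof -
  have "short a (X c (k + m)) = conj_a a (k + m - 2) (pos (X c 2))"
    by (rule short_eq) (use assms in auto)
  also have "k + m - 2 = m + (k - 2)" using assms by simp
  finally show ?thesis by (simp only: conj_a_add short_eq[OF assms])
qed

section \<open>Universal properties of the fraction groups\<close>


lemma forest_comp_vine:
  "forest_comp [vine a n] (replicate n Leaf @ [vine a d]) = [vine a (n + d)]"
  by (induction n) simp_all

lemma (in shift_letters) tw_vine:
  "(\<And>i. 1 \<le> i \<Longrightarrow> h a i = \<one>) \<Longrightarrow> 1 \<le> j \<Longrightarrow> tw h (vine a n) j = \<one>"
  by (induction n arbitrary: j) simp_all

\<comment> \<open>The number 1 is the base point of the fraction group and has to stay in this form.\<close>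
declare One_nat_def [simp del]

context ore_skein_category
begin

text \<open>With \<open>Suc j\<close> roots the \<open>j\<close>th one is not the last. By the results on padding below, more roots would give the same element.\<close>

definition \<gamma> :: "'a gen \<Rightarrow> ('a forest set \<times> 'a forest set) set" where
  "\<gamma> l = (case l of Gen c j \<Rightarrow> C.\<kappa> (cl (elementary c j (Suc j))) | Hat c j \<Rightarrow> C.\<kappa> (cl (elementary c j j)))"

definition \<beta> :: "'a \<Rightarrow> nat \<Rightarrow> ((nat \<Rightarrow> 'a forest set) \<times> (nat \<Rightarrow> 'a forest set)) set" where
  "\<beta> c j = I.\<kappa> (emb (elementary c j j))"

abbreviation "GG \<equiv> C.frac_group 1"
abbreviation "HH \<equiv> I.frac_group ()"

lemma forest_ge1: "f \<noteq> [] \<Longrightarrow> 1 \<le> length f" "f \<noteq> [] \<Longrightarrow> 1 \<le> forest_leaves f"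
  using length_le_forest_leaves[of f] by (cases f; simp)+

lemma \<kappa>_cl_closed: "f \<in> forests S \<Longrightarrow> f \<noteq> [] \<Longrightarrow> C.\<kappa> (cl f) \<in> carrier GG"
  by (intro C.\<kappa>_closed) (simp_all add: forest_ge1)

lemma \<kappa>_cl_comp:
  assumes "f \<in> forests S" "k \<in> forests S" "f \<noteq> []" "length k = forest_leaves f"
  shows "C.\<kappa> (cl (forest_comp f k)) = C.\<kappa> (cl f) \<otimes>\<^bsub>GG\<^esub> C.\<kappa> (cl k)"
proof -
  have "k \<noteq> []" using assms(3,4) forest_ge1[of f] by auto
  then show ?thesis
    using assms C.\<kappa>_comp[of "cl f" "cl k"] forest_ge1[of f] forest_ge1[of k] by simp
qed

lemma \<kappa>_cl_id: "C.\<kappa> (cl (replicate (Suc n) Leaf)) = \<one>\<^bsub>GG\<^esub>"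
proof -
  have "C.\<kappa> (cl (replicate (Suc n) Leaf)) = C.frac 1 (\<rho> (Suc n)) (\<rho> (Suc n))"
    using C.comp_idt[of "\<rho> (Suc n)" "Suc n"] by (simp add: C.\<kappa>_def del: replicate_Suc)
  also have "\<dots> = \<one>\<^bsub>GG\<^esub>"
    by (rule C.frac_self) simp_all
  finally show ?thesis .
qed

lemma \<kappa>_vine: "C.\<kappa> (cl [vine a n]) = \<one>\<^bsub>GG\<^esub>"
  using C.\<kappa>_\<rho>[of "Suc n"] by (simp add: \<rho>_def)

lemma group_GG: "group GG"
  by (rule C.group_frac_group)

text \<open>A vertex of colour \<open>a\<close> at the last leaf lengthens the comb, and all combs are trivial in the group.\<close>

lemma \<kappa>_last_a: "C.\<kappa> (cl (replicate n Leaf @ [Node Leaf a Leaf])) = \<one>\<^bsub>GG\<^esub>"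
proof -
  interpret GG: group GG by (rule group_GG)
  have c: "C.\<kappa> (cl (replicate n Leaf @ [Node Leaf a Leaf])) \<in> carrier GG"
    by (rule \<kappa>_cl_closed) simp_all
  have "vine a 1 = Node Leaf a Leaf" by (simp add: One_nat_def)
  then have "forest_comp [vine a n] (replicate n Leaf @ [Node Leaf a Leaf]) = [vine a (n + 1)]"
    using forest_comp_vine[of a n 1] by (simp only:)
  moreover have "C.\<kappa> (cl (forest_comp [vine a n] (replicate n Leaf @ [Node Leaf a Leaf])))
      = C.\<kappa> (cl [vine a n]) \<otimes>\<^bsub>GG\<^esub> C.\<kappa> (cl (replicate n Leaf @ [Node Leaf a Leaf]))"
    by (rule \<kappa>_cl_comp) (simp_all add: set_vine)
  ultimately have "\<one>\<^bsub>GG\<^esub> = \<one>\<^bsub>GG\<^esub> \<otimes>\<^bsub>GG\<^esub> C.\<kappa> (cl (replicate n Leaf @ [Node Leaf a Leaf]))"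
    by (simp only: \<kappa>_vine)
  then show ?thesis
    using c by simp
qed

text \<open>One trivial tree at the end is as good as two. A vertex of the colour \<open>a\<close> at the last leaf is invisible in the
  group, and whether it is attached before or after the other trees makes the difference between two trivial
  trees and one.\<close>

lemma \<kappa>_pad:
  assumes "f \<in> forests S"
  shows "C.\<kappa> (cl (f @ [Leaf, Leaf])) = C.\<kappa> (cl (f @ [Leaf]))"
proof -
  interpret GG: group GG by (rule group_GG)
  let ?Y = "[Node Leaf a Leaf]"
  have c: "C.\<kappa> (cl (f @ [Leaf, Leaf])) \<in> carrier GG" "C.\<kappa> (cl (f @ [Leaf])) \<in> carrier GG"
    using assms by (auto intro!: \<kappa>_cl_closed)
  have "forest_comp (f @ [Leaf]) (replicate (forest_leaves f) Leaf @ ?Y) = f @ ?Y"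
    by (simp add: forest_comp_append forest_comp_id_right One_nat_def)
  moreover have "forest_comp (replicate (length f) Leaf @ ?Y) (f @ [Leaf, Leaf]) = f @ ?Y"
    by (simp add: forest_comp_append forest_comp_id_left One_nat_def)
  moreover have "C.\<kappa> (cl (forest_comp (f @ [Leaf]) (replicate (forest_leaves f) Leaf @ ?Y)))
      = C.\<kappa> (cl (f @ [Leaf])) \<otimes>\<^bsub>GG\<^esub> C.\<kappa> (cl (replicate (forest_leaves f) Leaf @ ?Y))"
    by (rule \<kappa>_cl_comp) (use assms in simp_all)
  moreover have "C.\<kappa> (cl (forest_comp (replicate (length f) Leaf @ ?Y) (f @ [Leaf, Leaf])))
      = C.\<kappa> (cl (replicate (length f) Leaf @ ?Y)) \<otimes>\<^bsub>GG\<^esub> C.\<kappa> (cl (f @ [Leaf, Leaf]))"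
    by (rule \<kappa>_cl_comp) (use assms in simp_all)
  ultimately show ?thesis
    using c by (simp add: \<kappa>_last_a)
qed

lemma \<kappa>_pad_many: "f \<in> forests S \<Longrightarrow> C.\<kappa> (cl (f @ replicate (Suc k) Leaf)) = C.\<kappa> (cl (f @ [Leaf]))"
proof (induction k)
  case (Suc k)
  have "C.\<kappa> (cl ((f @ replicate k Leaf) @ [Leaf, Leaf])) = C.\<kappa> (cl ((f @ replicate k Leaf) @ [Leaf]))"
    using Suc.prems by (intro \<kappa>_pad) simp
  with Suc show ?case by (simp add: replicate_app_Cons_same)
qed simp

sublocale GF: forest_functor GG S "\<lambda>c j. \<gamma> (Gen c j)" "\<lambda>c j. \<gamma> (Hat c j)" "\<lambda>f. C.\<kappa> (cl f)"
proof (intro forest_functor.intro group_GG forest_functor_axioms.intro)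
  fix c i n assume *: "c \<in> S" "1 \<le> i" "i \<le> (n :: nat)"
  show "C.\<kappa> (cl (elementary c i n)) = (if i = n then \<gamma> (Hat c i) else \<gamma> (Gen c i))"
  proof (cases "i = n")
    case True
    then show ?thesis by (simp add: \<gamma>_def)
  next
    case False
    define k where "k = n - Suc i"
    have "elementary c i n = (replicate (i - 1) Leaf @ [Node Leaf c Leaf]) @ replicate (Suc k) Leaf"
      "elementary c i (Suc i) = (replicate (i - 1) Leaf @ [Node Leaf c Leaf]) @ [Leaf]"
      using * False by (auto simp add: elementary_def k_def Suc_diff_Suc simp flip: replicate_Suc) simp
    then show ?thesis
      using \<kappa>_pad_many[of "replicate (i - 1) Leaf @ [Node Leaf c Leaf]" k] * False by (simp add: \<gamma>_def)
  qed
qed (rule \<kappa>_cl_closed \<kappa>_cl_comp \<kappa>_cl_id; assumption)+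

lemma \<gamma>_hat_a: "1 \<le> j \<Longrightarrow> \<gamma> (Hat a j) = \<one>\<^bsub>GG\<^esub>"
  using \<kappa>_last_a[of "j - 1"] by (simp add: \<gamma>_def elementary_def)

lemma \<gamma>_closed: "c \<in> S \<Longrightarrow> 1 \<le> j \<Longrightarrow> \<gamma> (Gen c j) \<in> carrier GG" "c \<in> S \<Longrightarrow> 1 \<le> j \<Longrightarrow> \<gamma> (Hat c j) \<in> carrier GG"
  by (rule GF.gh_closed; assumption)+

lemma tw_\<gamma>_skein:
  assumes "(u, u') \<in> R" "1 \<le> j"
  shows "GF.tw (\<lambda>c j. \<gamma> (Gen c j)) u j = GF.tw (\<lambda>c j. \<gamma> (Gen c j)) u' j"
    and "GF.tw (\<lambda>c j. \<gamma> (Hat c j)) u j = GF.tw (\<lambda>c j. \<gamma> (Hat c j)) u' j"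
proof -
  note R = skein_relation[OF assms(1)]
  have "cl (replicate (j - 1) Leaf @ [u] @ replicate k Leaf) = cl (replicate (j - 1) Leaf @ [u'] @ replicate k Leaf)" for k :: nat
    using assms(1) by (intro cl_eqI rel_append skein_rel.base skein_rel.refl) simp_all
  then have "GF.tw (if k = 0 then \<lambda>c j. \<gamma> (Hat c j) else (\<lambda>c j. \<gamma> (Gen c j))) u j
      = GF.tw (if k = 0 then \<lambda>c j. \<gamma> (Hat c j) else (\<lambda>c j. \<gamma> (Gen c j))) u' j" for k :: nat
    using GF.F_placed_tree[OF R(1) assms(2), of k] GF.F_placed_tree[OF R(2) assms(2), of k] by simp
  from this[of 0] this[of 1]
  show "GF.tw (\<lambda>c j. \<gamma> (Gen c j)) u j = GF.tw (\<lambda>c j. \<gamma> (Gen c j)) u' j"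
      "GF.tw (\<lambda>c j. \<gamma> (Hat c j)) u j = GF.tw (\<lambda>c j. \<gamma> (Hat c j)) u' j"
    by simp_all
qed

lemma generate_GG:
  assumes X: "\<And>c j. c \<in> S \<Longrightarrow> 1 \<le> j \<Longrightarrow> \<gamma> (Gen c j) \<in> generate GG X"
    "\<And>c j. c \<in> S \<Longrightarrow> 1 \<le> j \<Longrightarrow> \<gamma> (Hat c j) \<in> generate GG X"
    and sub: "X \<subseteq> carrier GG"
  shows "carrier GG \<subseteq> generate GG X"
proof
  have tree: "C.\<kappa> Z \<in> generate GG X" if Z: "Z \<in> ForC S R" "roots Z = 1" for Z
  proof -
    obtain f where f: "f \<in> forests S" "Z = cl f" using ForCE[OF Z(1)] .
    then obtain t where "f = [t]" using Z(2) by (auto simp: One_nat_def length_Suc_conv)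
    with f show ?thesis
      using GF.F_placed_tree[of t 1 0] GF.tw_generate[where h' = "\<lambda>c j. \<gamma> (Hat c j)" and X = X and t = t and j = 1, OF X] by simp
  qed
  fix A assume "A \<in> carrier GG"
  then obtain t s where ts: "t \<in> ForC S R" "s \<in> ForC S R" "roots t = 1" "roots s = 1" "leaves t = leaves s"
      "A = C.frac 1 t s"
    by (rule C.frac_groupE)
  obtain f where f: "f \<in> forests S" "t = cl f" using ForCE[OF ts(1)] .
  have "leaves t \<in> {1..}"
    using f ts(3) forest_ge1[of f] by (cases f) auto
  then have "A = C.\<kappa> t \<otimes>\<^bsub>GG\<^esub> inv\<^bsub>GG\<^esub> (C.\<kappa> s)"
    unfolding ts(6) using ts by (intro C.\<kappa>_fraction) simp_all
  then show "A \<in> generate GG X"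
    using tree[OF ts(1,3)] tree[OF ts(2,4)] group.generate_m_inv_closed[OF group_GG sub] by (auto intro: generate.eng)
qed

text \<open>The values of forests define a functor to \<open>K\<close>, hence a homomorphism of the group of fractions. A comb consists of vertices with
  the letters \<^term>\<open>h a j = \<one>\<^bsub>K\<^esub>\<close>, so it has a trivial value and the homomorphism sends \<^term>\<open>C.\<kappa> (cl f)\<close> to the value
  of \<open>f\<close>.\<close>

lemma GG_universal:
  assumes "shift_letters K S g" "shift_letters.shifted K S g h" "\<And>j. 1 \<le> j \<Longrightarrow> h a j = \<one>\<^bsub>K\<^esub>"
    and skein: "\<And>u u' i. (u, u') \<in> R \<Longrightarrow> i \<in> {1, 2} \<Longrightarrow> tree_word K g g u i = tree_word K g g u' i"
      "\<And>u u' i. (u, u') \<in> R \<Longrightarrow> i \<in> {1, 2} \<Longrightarrow> tree_word K g h u i = tree_word K g h u' i"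
  obtains \<psi> where "\<psi> \<in> hom GG K"
    "\<And>c j. c \<in> S \<Longrightarrow> 1 \<le> j \<Longrightarrow> \<psi> (\<gamma> (Gen c j)) = g c j" "\<And>c j. c \<in> S \<Longrightarrow> 1 \<le> j \<Longrightarrow> \<psi> (\<gamma> (Hat c j)) = h c j"
proof -
  interpret K: shift_letters K S g by fact
  note h = assms(2)
  have inv: "K.fw h f 1 = K.fw h f' 1" if "(f, f') \<in> rel" for f f'
    using K.fw_skein_invariant[OF presentation h _ _ that, of 1]
      K.tw_eq_from_12[OF h a_S skein_relation(1,2) skein(2)]
      K.tw_eq_from_12[OF K.shifted_g a_S skein_relation(1,2) skein(1)] by simp
  define \<Phi> where "\<Phi> X = K.fw h (SOME f. f \<in> forests S \<and> X = cl f) 1" for X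
  have \<Phi>: "\<Phi> (cl f) = K.fw h f 1" if f: "f \<in> forests S" for f
  proof -
    let ?f = "SOME f'. f' \<in> forests S \<and> cl f = cl f'"
    have "?f \<in> forests S \<and> cl f = cl ?f"
      by (rule someI[of _ f]) (use f in simp)
    then have "(f, ?f) \<in> rel" using f cl_eq_iff by blast
    then show ?thesis unfolding \<Phi>_def using inv by metis
  qed
  have closed: "\<Phi> X \<in> carrier K" if "X \<in> ForC S R" for X
    using that by (elim ForCE) (simp add: \<Phi> h)
  have functorial: "\<Phi> (ForC_comp S R X Y) = \<Phi> X \<otimes>\<^bsub>K\<^esub> \<Phi> Y"
    if "X \<in> ForC S R" "Y \<in> ForC S R" "leaves X = roots Y" for X Y
    using that by (elim ForCE) (simp add: \<Phi> h forest_comp_forests K.fw_comp)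
  obtain \<psi> where \<psi>: "\<psi> \<in> hom GG K"
      "\<And>t s. (t, s) \<in> C.pairs 1 \<Longrightarrow> \<psi> (C.frac 1 t s) = \<Phi> t \<otimes>\<^bsub>K\<^esub> inv\<^bsub>K\<^esub> (\<Phi> s)"
    using C.frac_group_hom[of K \<Phi> 1, OF K.is_group closed functorial] by blast
  have \<rho>: "\<Phi> (\<rho> n) = \<one>\<^bsub>K\<^esub>" for n
    using assms(3) K.tw_vine[of h a 1 "n - 1"] by (simp add: \<rho>_def \<Phi> set_vine)
  have \<kappa>: "\<psi> (C.\<kappa> (cl f)) = K.fw h f 1" if f: "f \<in> forests S" "f \<noteq> []" for f
  proof -
    have "length f \<in> {1..}" "forest_leaves f \<in> {1..}"
      using f forest_ge1[of f] by simp_all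
    then have "\<psi> (C.\<kappa> (cl f)) = \<Phi> (ForC_comp S R (\<rho> (length f)) (cl f)) \<otimes>\<^bsub>K\<^esub> inv\<^bsub>K\<^esub> \<Phi> (\<rho> (forest_leaves f))"
      unfolding C.\<kappa>_def using f by (subst \<psi>(2)) simp_all
    also have "\<dots> = K.fw h f 1"
      using f \<open>length f \<in> {1..}\<close> h by (simp add: functorial \<rho> \<Phi>)
    finally show ?thesis .
  qed
  show ?thesis
  proof (rule that[OF \<psi>(1)])
    fix c j assume *: "c \<in> S" "1 \<le> (j :: nat)"
    show "\<psi> (\<gamma> (Gen c j)) = g c j" "\<psi> (\<gamma> (Hat c j)) = h c j"
      using * K.fw_elementary[OF h, of c j "Suc j" 1] K.fw_elementary[OF h, of c j j 1]
        GF.elementary_ne[of j "Suc j" c] GF.elementary_ne[of j j c]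
      by (simp_all add: \<gamma>_def \<kappa>)
  qed
qed

lemma group_HH: "group HH"
  by (rule I.group_frac_group)

lemma \<kappa>_emb_closed: "f \<in> forests S \<Longrightarrow> I.\<kappa> (emb f) \<in> carrier HH"
  by (rule I.\<kappa>_closed) (simp_all add: emb_closed)

lemma \<kappa>_emb_comp:
  assumes "f \<in> forests S" "k \<in> forests S" "length k = forest_leaves f"
  shows "I.\<kappa> (emb (forest_comp f k)) = I.\<kappa> (emb f) \<otimes>\<^bsub>HH\<^esub> I.\<kappa> (emb k)"
  unfolding seq_comp_emb[OF assms, symmetric] by (rule I.\<kappa>_comp) (use assms in \<open>simp_all add: emb_closed\<close>)

lemma emb_replicate: "emb (replicate n Leaf) = emb []"
  using emb_pad[of "[]" n] by simp

lemma emb_elementary: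
  assumes "1 \<le> i" "i \<le> n"
  shows "emb (elementary c i n) = emb (elementary c i i)"
proof -
  have "elementary c i n = elementary c i i @ replicate (n - i) Leaf"
    using assms by (simp add: elementary_def)
  then show ?thesis by (simp add: emb_pad)
qed

sublocale HF: forest_functor HH S \<beta> \<beta> "\<lambda>f. I.\<kappa> (emb f)"
proof (intro forest_functor.intro group_HH forest_functor_axioms.intro)
  fix n show "I.\<kappa> (emb (replicate (Suc n) Leaf)) = \<one>\<^bsub>HH\<^esub>"
    unfolding emb_replicate by (rule I.\<kappa>_\<rho>) simp
next
  fix c i n assume "c \<in> S" "1 \<le> i" "i \<le> (n :: nat)"
  then show "I.\<kappa> (emb (elementary c i n)) = (if i = n then \<beta> c i else \<beta> c i)"
    using emb_elementary[of i n c] by (simp only: if_cancel \<beta>_def)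
qed (rule \<kappa>_emb_closed \<kappa>_emb_comp; assumption)+

lemma tw_\<beta>_skein:
  assumes "(u, u') \<in> R" "1 \<le> j"
  shows "HF.tw \<beta> u j = HF.tw \<beta> u' j"
proof -
  note R = skein_relation[OF assms(1)]
  have "(replicate (j - 1) Leaf @ [u], replicate (j - 1) Leaf @ [u']) \<in> rel"
    using assms(1) by (intro rel_append skein_rel.base skein_rel.refl) simp_all
  then have "emb (replicate (j - 1) Leaf @ [u]) = emb (replicate (j - 1) Leaf @ [u'])"
    using R by (subst emb_eq_iff) simp_all
  then show ?thesis
    using HF.F_placed_tree[OF R(1) assms(2), of 0] HF.F_placed_tree[OF R(2) assms(2), of 0] by simp
qed

lemma \<kappa>_emb_word: "f \<in> forests S \<Longrightarrow> I.\<kappa> (emb f) = HF.fw \<beta> f 1"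
  using HF.F_forest[of f 1] I.\<kappa>_\<rho>[of "()"] by (cases "f = []") simp_all

lemma HH_elem:
  assumes "A \<in> carrier HH"
  obtains f k where "f \<in> forests S" "k \<in> forests S" "forest_leaves f = forest_leaves k"
    "A = I.frac () (emb f) (emb k)" "A = I.\<kappa> (emb f) \<otimes>\<^bsub>HH\<^esub> inv\<^bsub>HH\<^esub> (I.\<kappa> (emb k))"
proof -
  obtain t s where ts: "t \<in> carrier (ForC_inf S R)" "s \<in> carrier (ForC_inf S R)" "A = I.frac () t s"
    using assms by (rule I.frac_groupE)
  from ts(1,2) obtain f k where fk: "f \<in> forests S" "k \<in> forests S" "t = emb f" "s = emb k"
      "forest_leaves f = forest_leaves k"
    by (rule emb_same_leaves)
  moreover have "I.frac () t s = I.\<kappa> t \<otimes>\<^bsub>HH\<^esub> inv\<^bsub>HH\<^esub> (I.\<kappa> s)"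
    by (rule I.\<kappa>_fraction) (use ts in \<open>simp_all add: I.pairs_iff\<close>)
  ultimately show ?thesis
    using that ts(3) by simp
qed

lemma generate_HH:
  assumes X: "\<And>c j. c \<in> S \<Longrightarrow> 1 \<le> j \<Longrightarrow> \<beta> c j \<in> generate HH X"
    and sub: "X \<subseteq> carrier HH"
  shows "carrier HH \<subseteq> generate HH X"
proof
  have gen: "I.\<kappa> (emb f) \<in> generate HH X" if "f \<in> forests S" for f
    unfolding \<kappa>_emb_word[OF that] using that by (intro HF.fw_generate X) simp_all
  fix A assume "A \<in> carrier HH"
  then obtain f k where fk: "f \<in> forests S" "k \<in> forests S"
      and A: "A = I.\<kappa> (emb f) \<otimes>\<^bsub>HH\<^esub> inv\<^bsub>HH\<^esub> (I.\<kappa> (emb k))"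
    by (rule HH_elem)
  show "A \<in> generate HH X"
    unfolding A using gen[OF fk(1)] group.generate_m_inv_closed[OF group_HH sub gen[OF fk(2)]]
    by (rule generate.eng)
qed

text \<open>With \<open>h = g\<close> the value of a finite forest does not change if trivial trees follow, so it is a function
  of the infinite forest.\<close>

lemma HH_universal:
  assumes "shift_letters K S g"
    and skein: "\<And>u u' i. (u, u') \<in> R \<Longrightarrow> i \<in> {1, 2} \<Longrightarrow> tree_word K g g u i = tree_word K g g u' i"
  obtains \<psi> where "\<psi> \<in> hom HH K" "\<And>f. f \<in> forests S \<Longrightarrow> \<psi> (I.\<kappa> (emb f)) = forest_word K g g f 1"
    "\<And>c j. c \<in> S \<Longrightarrow> 1 \<le> j \<Longrightarrow> \<psi> (\<beta> c j) = g c j"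
proof -
  interpret K: shift_letters K S g by fact
  have inv: "K.fw g f 1 = K.fw g f' 1" if "(f, f') \<in> rel" for f f'
    using K.fw_skein_invariant[OF presentation K.shifted_g _ _ that, of 1]
      K.tw_eq_from_12[OF K.shifted_g a_S skein_relation(1,2) skein] by simp
  have pad: "K.fw g (f @ replicate n Leaf) 1 = K.fw g f 1" if "f \<in> forests S" for f n
    using that K.fw_append[OF K.shifted_g that, of "replicate n Leaf" 1] K.shifted_g by (cases "n = 0") simp_all
  have emb_inv: "K.fw g f 1 = K.fw g f' 1" if "f \<in> forests S" "f' \<in> forests S" "emb f = emb f'" for f f'
  proof -
    let ?f = "f @ replicate (length f') Leaf" and ?f' = "f' @ replicate (length f) Leaf"
    have "emb ?f = emb ?f'" using that by (simp add: emb_pad)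
    then have "(?f, ?f') \<in> rel"
      by (subst (asm) emb_eq_iff) (use that in simp_all)
    from inv[OF this] show ?thesis using pad that by simp
  qed
  define \<Phi> where "\<Phi> t = K.fw g (SOME f. f \<in> forests S \<and> t = emb f) 1" for t
  have \<Phi>: "\<Phi> (emb f) = K.fw g f 1" if f: "f \<in> forests S" for f
  proof -
    let ?f = "SOME f'. f' \<in> forests S \<and> emb f = emb f'"
    have "?f \<in> forests S \<and> emb f = emb ?f"
      by (rule someI[of _ f]) (use f in simp)
    then show ?thesis unfolding \<Phi>_def using emb_inv f by metis
  qed
  have closed: "\<Phi> t \<in> carrier K" if "t \<in> carrier (ForC_inf S R)" for t
    using that by (elim carrier_ForC_inf) (simp add: \<Phi> K.shifted_g)
  have functorial: "\<Phi> (seq_comp S R s t) = \<Phi> s \<otimes>\<^bsub>K\<^esub> \<Phi> t"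
    if st: "s \<in> carrier (ForC_inf S R)" "t \<in> carrier (ForC_inf S R)" for s t
  proof -
    obtain F G H where "F \<in> forests S" "G \<in> forests S" "s = emb F" "t = emb G" "length G = forest_leaves F"
      using emb_chain[OF st st(2)] by metis
    then show ?thesis
      by (simp add: seq_comp_emb \<Phi> forest_comp_forests K.fw_comp K.shifted_g)
  qed
  obtain \<psi> where \<psi>: "\<psi> \<in> hom HH K"
      "\<And>t s. (t, s) \<in> I.pairs () \<Longrightarrow> \<psi> (I.frac () t s) = \<Phi> t \<otimes>\<^bsub>K\<^esub> inv\<^bsub>K\<^esub> (\<Phi> s)"
    using I.frac_group_hom[of K \<Phi> "()", OF K.is_group closed functorial] by blast
  have \<kappa>: "\<psi> (I.\<kappa> (emb f)) = K.fw g f 1" if f: "f \<in> forests S" for f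
  proof -
    have "I.\<kappa> (emb f) = I.frac () (emb f) (emb [])"
      unfolding I.\<kappa>_def using I.idt_comp[of "emb f" "()"] emb_closed[OF f] by simp
    then have "\<psi> (I.\<kappa> (emb f)) = \<Phi> (emb f) \<otimes>\<^bsub>K\<^esub> inv\<^bsub>K\<^esub> \<Phi> (emb [])"
      using \<psi>(2)[of "emb f" "emb []"] emb_closed[OF f] emb_closed[of "[]"] by (simp add: I.pairs_iff)
    then show ?thesis
      using f by (simp add: \<Phi> K.shifted_g)
  qed
  show ?thesis
  proof (rule that[OF \<psi>(1) \<kappa>])
    fix c j assume *: "c \<in> S" "1 \<le> (j :: nat)"
    then show "\<psi> (\<beta> c j) = g c j"
      using K.fw_elementary[OF K.shifted_g, of c j j 1] by (simp add: \<beta>_def \<kappa>)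
  qed
qed

section \<open>The embedding of the group of infinite forests\<close>

text \<open>The comb of \<open>f @ [Leaf]\<close> cancels, and leaves the rest of the comb of \<open>k @ [Leaf]\<close> as a part of the last
  tree on the other side. Both last trees end with the last tree \<open>l\<close> of \<open>h\<close>, so the number of leaves shows that the
  rest is trivial and that \<open>f\<close> and \<open>k\<close> have the same number of roots. The last trees can then be split off.\<close>

lemma vine_comp_cancel:
  assumes fk: "f \<in> forests S" "k \<in> forests S" "forest_leaves f = forest_leaves k" and le: "length f \<le> length k"
    and h: "h \<in> forests S" "length h = forest_leaves f + 1"
    and eq: "(forest_comp [vine a (length f)] (forest_comp (f @ [Leaf]) h),
      forest_comp [vine a (length k)] (forest_comp (k @ [Leaf]) h)) \<in> rel"
  obtains h0 where "h0 \<in> forests S" "length h0 = forest_leaves f" "(forest_comp f h0, forest_comp k h0) \<in> rel"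
proof -
  obtain h0 hl where hh: "h = h0 @ hl" "length h0 = forest_leaves f" "length hl = 1"
    using split_forest[OF h(2)] by metis
  then obtain l where l: "hl = [l]" by (auto simp: One_nat_def length_Suc_conv)
  define d where "d = length k - length f"
  have len: "length k = length f + d" using le by (simp add: d_def)
  have comp: "forest_comp (f @ [Leaf]) h = forest_comp f h0 @ [l]" "forest_comp (k @ [Leaf]) h = forest_comp k h0 @ [l]"
    using hh l fk(3) by (simp_all add: forest_comp_append One_nat_def)
  obtain P Q where PQ: "forest_comp k h0 = P @ Q" "length P = length f" "length Q = d"
    using split_forest[of "forest_comp k h0" "length f" d] len by auto
  have mem: "h0 \<in> forests S" "set_tree l \<subseteq> S" "forest_comp f h0 \<in> forests S" "P @ Q \<in> forests S"
    using h hh l fk forest_comp_forests[of h0 f S] forest_comp_forests[of h0 k S]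
    by (simp_all flip: PQ(1))
  let ?v = "replicate (length f) Leaf @ [vine a d]"
  have v: "[vine a (length k)] = forest_comp [vine a (length f)] ?v"
    unfolding len by (simp only: forest_comp_vine)
  have shape: "?v \<in> forests S" "length (P @ Q @ [l]) = forest_leaves ?v" "P @ Q @ [l] \<in> forests S"
    using mem PQ by (simp_all add: set_vine)
  have "forest_comp [vine a (length k)] (P @ Q @ [l]) = forest_comp [vine a (length f)] (forest_comp ?v (P @ Q @ [l]))"
    unfolding v by (rule forest_comp_assoc) (use shape in simp_all)
  with eq have "(forest_comp [vine a (length f)] (forest_comp f h0 @ [l]),
      forest_comp [vine a (length f)] (forest_comp ?v (P @ Q @ [l]))) \<in> rel"
    unfolding comp PQ by simp
  then have "cl (forest_comp [vine a (length f)] (forest_comp f h0 @ [l]))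
      = cl (forest_comp [vine a (length f)] (forest_comp ?v (P @ Q @ [l])))"
    by (rule cl_eqI)
  moreover have "forest_comp ?v (P @ Q @ [l]) \<in> forests S"
    by (rule forest_comp_forests) (use shape in simp_all)
  ultimately have "ForC_comp S R (cl [vine a (length f)]) (cl (forest_comp f h0 @ [l]))
      = ForC_comp S R (cl [vine a (length f)]) (cl (forest_comp ?v (P @ Q @ [l])))"
    using mem by (subst (1 2) comp_cl) (simp_all add: set_vine)
  then have "cl (forest_comp f h0 @ [l]) = cl (forest_comp ?v (P @ Q @ [l]))"
    by (rule C.left_cancel[rotated -1])
       (use mem \<open>forest_comp ?v (P @ Q @ [l]) \<in> forests S\<close> in \<open>simp_all add: set_vine\<close>)
  then have "(forest_comp f h0 @ [l], forest_comp ?v (P @ Q @ [l])) \<in> rel"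
    using mem \<open>forest_comp ?v (P @ Q @ [l]) \<in> forests S\<close> by (subst (asm) cl_eq_iff) simp_all
  moreover have "forest_comp ?v (P @ Q @ [l]) = P @ [graft (vine a d) (Q @ [l])]"
    using PQ forest_comp_id_left[of P] by (simp add: forest_comp_append)
  ultimately have rel: "(forest_comp f h0, P) \<in> rel" "([l], [graft (vine a d) (Q @ [l])]) \<in> rel"
    using rel_appendD[of "forest_comp f h0" "[l]" P] PQ(2) by auto
  have "size1 l = forest_leaves Q + size1 l"
    using tree_rel_leaves[OF rel(2)] size1_graft[of "Q @ [l]" "vine a d"] PQ(3) by simp
  then have "Q = []"
    using length_le_forest_leaves[of Q] by simp
  with rel(1) PQ(1) have "(forest_comp f h0, forest_comp k h0) \<in> rel"
    by simp
  with that mem hh(2) show ?thesis by metis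
qed

text \<open>If \<open>f k\<inverse>\<close> maps to \<open>1\<close> then the forests \<open>f\<close> and \<open>k\<close>, each followed by one trivial tree and placed on its
  comb, have a common expansion. It contains one of \<open>f\<close> and \<open>k\<close>.\<close>

lemma HH_embeds:
  obtains \<eta> where "\<eta> \<in> hom HH GG" "inj_on \<eta> (carrier HH)"
    "\<And>c j. c \<in> S \<Longrightarrow> 1 \<le> j \<Longrightarrow> \<eta> (\<beta> c j) = \<gamma> (Gen c j)"
proof (rule HH_universal[OF GF.shift_letters_axioms])
  fix u u' i assume "(u, u') \<in> R" "i \<in> {1, 2 :: nat}"
  then show "GF.tw (\<lambda>c j. \<gamma> (Gen c j)) u i = GF.tw (\<lambda>c j. \<gamma> (Gen c j)) u' i"
    by (intro tw_\<gamma>_skein(1)) auto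
next
  fix \<eta> assume \<eta>: "\<eta> \<in> hom HH GG"
      "\<And>f. f \<in> forests S \<Longrightarrow> \<eta> (I.\<kappa> (emb f)) = GF.fw (\<lambda>c j. \<gamma> (Gen c j)) f 1"
      "\<And>c j. c \<in> S \<Longrightarrow> 1 \<le> j \<Longrightarrow> \<eta> (\<beta> c j) = \<gamma> (Gen c j)"
  interpret \<eta>: group_hom HH GG \<eta>
    using \<eta>(1) group_HH group_GG by (simp add: group_hom_def group_hom_axioms_def)
  have \<eta>_\<kappa>: "\<eta> (I.\<kappa> (emb f)) = C.\<kappa> (cl (f @ [Leaf]))" if f: "f \<in> forests S" for f
    using \<eta>(2)[OF f] GF.F_forest[of "f @ [Leaf]" 1] f GF.shifted_g
      GF.fw_append[OF GF.shifted_h f, of "[Leaf]" 1] by simp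
  have "A = \<one>\<^bsub>HH\<^esub>" if A: "A \<in> carrier HH" "\<eta> A = \<one>\<^bsub>GG\<^esub>" for A
  proof -
    obtain f k where fk: "f \<in> forests S" "k \<in> forests S" "forest_leaves f = forest_leaves k"
        and Af: "A = I.frac () (emb f) (emb k)" and A\<kappa>: "A = I.\<kappa> (emb f) \<otimes>\<^bsub>HH\<^esub> inv\<^bsub>HH\<^esub> (I.\<kappa> (emb k))"
      using HH_elem[OF A(1)] .
    have c: "I.\<kappa> (emb f) \<in> carrier HH" "I.\<kappa> (emb k) \<in> carrier HH"
        "C.\<kappa> (cl (f @ [Leaf])) \<in> carrier GG" "C.\<kappa> (cl (k @ [Leaf])) \<in> carrier GG"
      using fk by (auto intro!: \<kappa>_emb_closed \<kappa>_cl_closed)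
    have "C.\<kappa> (cl (f @ [Leaf])) \<otimes>\<^bsub>GG\<^esub> inv\<^bsub>GG\<^esub> (C.\<kappa> (cl (k @ [Leaf]))) = \<one>\<^bsub>GG\<^esub>"
      using A(2) fk c unfolding A\<kappa> by (simp add: \<eta>_\<kappa>)
    then have eq: "C.\<kappa> (cl (f @ [Leaf])) = C.\<kappa> (cl (k @ [Leaf]))"
      using c GF.inv_solve_right'[of "\<one>\<^bsub>GG\<^esub>" "C.\<kappa> (cl (f @ [Leaf]))" "C.\<kappa> (cl (k @ [Leaf]))"] by simp
    obtain X where X: "X \<in> ForC S R" "roots X = leaves (cl (f @ [Leaf]))"
        "ForC_comp S R (\<rho> (roots (cl (f @ [Leaf])))) (ForC_comp S R (cl (f @ [Leaf])) X)
        = ForC_comp S R (\<rho> (roots (cl (k @ [Leaf])))) (ForC_comp S R (cl (k @ [Leaf])) X)"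
    proof (rule C.\<kappa>_eqD[OF _ _ _ _ _ _ eq])
      fix X assume X: "X \<in> ForC S R" "roots X = leaves (cl (f @ [Leaf]))"
        "ForC_comp S R (ForC_comp S R (\<rho> (roots (cl (f @ [Leaf])))) (cl (f @ [Leaf]))) X
        = ForC_comp S R (ForC_comp S R (\<rho> (roots (cl (k @ [Leaf])))) (cl (k @ [Leaf]))) X"
      then show thesis
        using fk by (intro that[OF X(1,2)]) (simp add: C.comp_assoc)
    qed (use fk in simp_all)
    obtain h where h: "h \<in> forests S" "X = cl h" using ForCE[OF X(1)] .
    have len: "length h = forest_leaves f + 1" using X(2) fk h by simp
    have forests: "forest_comp (f @ [Leaf]) h \<in> forests S" "forest_comp (k @ [Leaf]) h \<in> forests S"
      using len fk h by (auto intro!: forest_comp_forests)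
    then have "(forest_comp [vine a (length f)] (forest_comp (f @ [Leaf]) h),
        forest_comp [vine a (length k)] (forest_comp (k @ [Leaf]) h)) \<in> rel"
      using X(3) fk h len
      by (simp add: \<rho>_def set_vine cl_eq_iff forest_comp_forests del: forest_comp.simps)
    then obtain h0 where h0: "h0 \<in> forests S" "length h0 = forest_leaves f" "(forest_comp f h0, forest_comp k h0) \<in> rel"
      using vine_comp_cancel[OF fk _ h(1) len] vine_comp_cancel[OF fk(2,1) fk(3)[symmetric] _ h(1)] len fk(3)
      by (metis le_cases skein_rel.sym)
    have "emb (forest_comp f h0) = emb (forest_comp k h0)"
      using h0 fk skein_rel_invariants[OF h0(3)] by (subst emb_eq_iff) simp_all
    then have "seq_comp S R (emb f) (emb h0) = seq_comp S R (emb k) (emb h0)"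
      using fk h0 by (simp add: seq_comp_emb)
    then show ?thesis
      unfolding Af using fk h0(1) by (intro I.frac_eq_one[of _ _ _ "emb h0"]) (simp_all add: I.pairs_iff emb_closed)
  qed
  then have "inj_on \<eta> (carrier HH)"
    by (intro \<eta>.inj_on_one_iff[THEN iffD2]) blast
  with \<eta> that show ?thesis by blast
qed

text \<open>The relations are between words of the same length, so that there is a homomorphism to the integers that sends each letter
  to 1.\<close>

lemma infinite_HH: "infinite (carrier HH)"
proof -
  interpret Z: group integer_group by simp
  interpret Z: shift_letters integer_group S "\<lambda>_ _. 1 :: int"
    by standard simp_all
  have tw: "tree_word integer_group (\<lambda>_ _. 1) (\<lambda>_ _. 1) t j = int (size t)" for t :: "'a tree" and j
    by (induction t arbitrary: j) simp_all
  have skein: "tree_word integer_group (\<lambda>_ _. 1) (\<lambda>_ _. 1) u i = tree_word integer_group (\<lambda>_ _. 1) (\<lambda>_ _. 1) u' i"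
    if "(u, u') \<in> R" for u u' i
    using skein_relation(3)[OF that] by (simp add: tw size1_size)
  obtain \<psi> where \<psi>: "\<psi> \<in> hom HH integer_group" "\<psi> (\<beta> a 1) = 1"
    using HH_universal[OF Z.shift_letters_axioms skein] a_S by (metis order_refl)
  interpret H: group HH by (rule group_HH)
  interpret \<psi>: group_hom HH integer_group \<psi>
    using \<psi>(1) group_HH by (simp add: group_hom_def group_hom_axioms_def)
  have \<beta>: "\<beta> a 1 \<in> carrier HH" by (rule HF.gh_closed) simp_all
  have "\<psi> (\<beta> a 1 [^]\<^bsub>HH\<^esub> n) = int n" for n :: nat
    using \<beta> \<psi>(2) by (induction n) (simp_all add: \<psi>.hom_nat_pow)
  then have "inj (\<lambda>n :: nat. \<beta> a 1 [^]\<^bsub>HH\<^esub> n)"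
    by (metis injI of_nat_eq_iff)
  moreover have "range (\<lambda>n :: nat. \<beta> a 1 [^]\<^bsub>HH\<^esub> n) \<subseteq> carrier HH"
    using \<beta> HF.nat_pow_closed by blast
  ultimately show ?thesis
    by (meson finite_subset infinite_UNIV_nat finite_imageD)
qed

end

section \<open>Changing generators and relations\<close>

lemma has_presentation_cong:
  assumes "\<And>x. x \<in> X \<Longrightarrow> \<gamma> x = \<gamma>' x"
  shows "has_presentation G X rels \<gamma> \<longleftrightarrow> has_presentation G X rels \<gamma>'"
  using assms by (simp add: has_presentation_def)

lemma has_presentation_add_trivial:
  assumes pres: "has_presentation G X rels \<gamma>" and T: "T \<subseteq> {(v, v) | v. v \<in> words X}"
  shows "has_presentation G X (rels \<union> T) \<gamma>"
proof -
  note group = has_presentation_group[OF pres] and closed = has_presentation_closed[OF pres]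
  have rels: "rels \<union> T \<subseteq> words X \<times> words X"
    using has_presentation_words[OF pres] T by auto
  obtain \<psi> where \<psi>: "\<psi> \<in> hom G (presented_group X (rels \<union> T))"
      "\<And>x. x \<in> X \<Longrightarrow> \<psi> (\<gamma> x) = presented_gen X (rels \<union> T) x"
    using has_presentation_hom[OF pres group_presented_group[OF rels] presented_gen_closed[OF rels]]
      presented_group_rel[OF rels] by (metis UnI1)
  show ?thesis
  proof (rule has_presentationI[OF rels group closed _ _ \<psi>])
    fix v w assume "(v, w) \<in> rels \<union> T"
    then show "eval_word G \<gamma> v = eval_word G \<gamma> w"
      using has_presentation_rel[OF pres] T by auto
  qed (simp_all add: has_presentation_generate[OF pres])
qed

lemma has_presentation_rename:
  assumes pres: "has_presentation G X rels \<gamma>" and f: "inj_on f X"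
  defines "ren \<equiv> map (\<lambda>l. (f (fst l), snd l))"
  shows "has_presentation G (f ` X) ((\<lambda>r. (ren (fst r), ren (snd r))) ` rels) (\<gamma> \<circ> inv_into X f)"
proof -
  let ?rels = "(\<lambda>r. (ren (fst r), ren (snd r))) ` rels"
  note group = has_presentation_group[OF pres] and closed = has_presentation_closed[OF pres]
    and words = has_presentation_words[OF pres]
  have ren_words: "ren v \<in> words (f ` X)" if "v \<in> words X" for v
    using that by (induction v) (auto simp: ren_def)
  have rels: "?rels \<subseteq> words (f ` X) \<times> words (f ` X)"
    using words ren_words by auto
  have eval: "eval_word K e (ren v) = eval_word K (e \<circ> f) v" for K :: "('k, 'l) monoid_scheme" and e v
    by (induction v) (simp_all add: ren_def)
  let ?P = "presented_group (f ` X) ?rels" and ?p = "presented_gen (f ` X) ?rels"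
  have p: "?p \<circ> f \<in> X \<rightarrow> carrier ?P"
    using presented_gen_closed[OF rels] by auto
  have hold: "eval_word ?P (?p \<circ> f) v = eval_word ?P (?p \<circ> f) w" if "(v, w) \<in> rels" for v w
    unfolding eval[symmetric] by (rule presented_group_rel[OF rels]) (use that in force)
  obtain \<psi> where \<psi>: "\<psi> \<in> hom G ?P" "\<And>x. x \<in> X \<Longrightarrow> \<psi> (\<gamma> x) = (?p \<circ> f) x"
    using has_presentation_hom[OF pres group_presented_group[OF rels] p hold] by blast
  have img: "(\<gamma> \<circ> inv_into X f) ` f ` X = \<gamma> ` X"
    using f by (auto simp: image_iff)
  show ?thesis
  proof (rule has_presentationI[OF rels group _ _ _ \<psi>(1)])
    show "\<gamma> \<circ> inv_into X f \<in> f ` X \<rightarrow> carrier G"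
      using closed f by auto
    show "carrier G \<subseteq> generate G ((\<gamma> \<circ> inv_into X f) ` f ` X)"
      unfolding img by (simp add: has_presentation_generate[OF pres])
  next
    fix v w assume "(v, w) \<in> ?rels"
    then obtain v' w' where vw: "(v', w') \<in> rels" "v = ren v'" "w = ren w'" by auto
    then have "v' \<in> words X" "w' \<in> words X" using words by auto
    then have "eval_word G (\<gamma> \<circ> inv_into X f) (ren v') = eval_word G \<gamma> v'"
        "eval_word G (\<gamma> \<circ> inv_into X f) (ren w') = eval_word G \<gamma> w'"
      unfolding eval by (auto intro!: group.eval_word_cong[OF group] simp: f)
    then show "eval_word G (\<gamma> \<circ> inv_into X f) v = eval_word G (\<gamma> \<circ> inv_into X f) w"
      using has_presentation_rel[OF pres vw(1)] vw by simp
  next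
    fix x assume "x \<in> f ` X"
    then show "\<psi> ((\<gamma> \<circ> inv_into X f) x) = ?p x"
      using \<psi>(2) f by auto
  qed
qed

lemma finitely_presentedI:
  assumes "has_presentation G X rels \<gamma>" "finite X" "finite rels"
  shows "finitely_presented G"
proof -
  obtain f :: "_ \<Rightarrow> nat" where "inj_on f X"
    using finite_imp_inj_to_nat_seg[OF assms(2)] by metis
  from has_presentation_rename[OF assms(1) this] show ?thesis
    unfolding finitely_presented_def using assms(2,3) by blast
qed

lemma finitely_generatedI:
  assumes "has_presentation G X rels \<gamma>" "finite X"
  shows "finitely_generated G"
  unfolding finitely_generated_def
  using assms has_presentation_generate[OF assms(1)] has_presentation_closed[OF assms(1)]
  by (intro exI[of _ "\<gamma> ` X"]) auto

lemma infinite_trivial_relations: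
  assumes "x \<in> X"
  shows "infinite {(v, v) | v. v \<in> words X}"
proof
  assume fin: "finite {(v, v) | v. v \<in> words X}"
  have "replicate n (x, True) \<in> words X" for n
    using assms by (induction n) simp_all
  then have "range (\<lambda>n. (replicate n (x, True), replicate n (x, True))) \<subseteq> {(v, v) | v. v \<in> words X}"
    by auto
  then have "finite (range (\<lambda>n. (replicate n (x, True), replicate n (x, True))))"
    using fin by (rule finite_subset)
  moreover have "inj (\<lambda>n. (replicate n (x, True), replicate n (x, True)))"
    by (rule injI) simp
  ultimately show False
    using finite_imageD by fastforce
qed

text \<open>Coincidences among the relations can make a presentation smaller than the count of its
  relations suggests; trivial relations \<open>v = v\<close> make up for them.\<close>

lemma has_presentation_exact_card:
  assumes pres: "has_presentation G X rels \<gamma>" and "finite rels" "card rels \<le> n" "x \<in> X"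
  shows "\<exists>rels'. finite rels' \<and> card rels' = n \<and> has_presentation G X rels' \<gamma>"
proof -
  have "infinite ({(v, v) | v. v \<in> words X} - rels)"
    using infinite_trivial_relations[OF assms(4)] assms(2) by simp
  then obtain T where T: "finite T" "card T = n - card rels" "T \<subseteq> {(v, v) | v. v \<in> words X} - rels"
    using infinite_arbitrarily_large[of _ "n - card rels"] by blast
  then have "card (rels \<union> T) = n"
    using assms(2,3) by (subst card_Un_disjoint) auto
  moreover have "has_presentation G X (rels \<union> T) \<gamma>"
    using T(3) by (intro has_presentation_add_trivial[OF pres]) auto
  ultimately show ?thesis
    using T(1) assms(2) by blast
qed

section \<open>The letters and words of the presentations\<close>

lemma gens_mem [simp]: "Gen c j \<in> gens S J \<longleftrightarrow> c \<in> S \<and> j \<in> J" "Hat c j \<notin> gens S J"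
    "Hat c j \<in> hat_gens S J \<longleftrightarrow> c \<in> S \<and> j \<in> J" "Gen c j \<notin> hat_gens S J"
  by (auto simp: gens_def hat_gens_def)

lemma words_short:
  assumes "X = Gen \<or> X = Hat" "Gen a 1 \<in> Y" "X c 1 \<in> Y" "X c 2 \<in> Y" "1 \<le> k"
  shows "short a (X c k) \<in> words Y"
proof (cases "k = 1")
  case True
  then show ?thesis using assms by auto
next
  case False
  then show ?thesis
    using assms by (simp add: short_eq words_conj_a)
qed

context group
begin

lemma eval_short_1: "X = Gen \<or> X = Hat \<Longrightarrow> e (X c k) \<in> carrier G \<Longrightarrow> k \<le> 2 \<Longrightarrow>
    eval_word G e (short a (X c k)) = e (X c k)"
  by auto

lemma eval_short_shift:
  assumes "e \<in> Y \<rightarrow> carrier G" "X = Gen \<or> X = Hat" "Gen a 1 \<in> Y" "X c 1 \<in> Y" "X c 2 \<in> Y" "2 \<le> k"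
  shows "eval_word G e (short a (X c k)) \<otimes> e (Gen a 1) = e (Gen a 1) \<otimes> eval_word G e (short a (X c (k + 1)))"
  using eval_word_conj_a_Suc[OF assms(1,3) words_short[OF assms(2-5)], of k 0] short_conj[OF assms(2,6), of a c 1] assms(6)
  by (simp add: conj_a_0 One_nat_def)

lemma eval_short:
  assumes e: "\<And>k. 1 \<le> k \<Longrightarrow> e (X c k) \<in> carrier G" "e (Gen a 1) \<in> carrier G" and X: "X = Gen \<or> X = Hat"
    and shift: "\<And>k. 2 \<le> k \<Longrightarrow> e (X c k) \<otimes> e (Gen a 1) = e (Gen a 1) \<otimes> e (X c (k + 1))"
    and "1 \<le> k"
  shows "eval_word G e (short a (X c k)) = e (X c k)"
proof (cases "k = 1")
  case True
  then show ?thesis using eval_short_1[OF X] e by simp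
next
  case False
  then have "2 \<le> k" using \<open>1 \<le> k\<close> by simp
  then show ?thesis
  proof (induction k rule: dec_induct)
    case base
    then show ?case using eval_short_1[OF X] e by simp
  next
    case (step k)
    let ?Y = "{Gen a 1, X c 1, X c 2}"
    have Y: "e \<in> ?Y \<rightarrow> carrier G" using e by auto
    have "eval_word G e (short a (X c (k + 1))) \<in> carrier G"
      using eval_word_closed[OF Y] words_short[OF X, of a ?Y c "k + 1"] by simp
    moreover have "e (Gen a 1) \<otimes> eval_word G e (short a (X c (k + 1))) = e (Gen a 1) \<otimes> e (X c (k + 1))"
      using eval_short_shift[OF Y X, of a c k] shift[of k] step by simp
    ultimately show ?case
      unfolding Suc_eq_plus1 using e by simp
  qed
qed

text \<open>Since \<open>y\<^sub>i\<^sub>+\<^sub>j a\<^sub>1 = a\<^sub>1 y\<^sub>i\<^sub>+\<^sub>j\<^sub>+\<^sub>1\<close>, the relation that \<open>a\<^sub>1\<inverse> x\<^sub>i\<close> commutes with \<open>y\<^sub>i\<^sub>+\<^sub>j\<^sub>+\<^sub>1\<close> is a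
  shift relation for \<open>x\<^sub>i\<close>, multiplied by \<open>a\<^sub>1\<inverse>\<close>.\<close>

lemma comm_rel_iff:
  assumes e: "e \<in> Y \<rightarrow> carrier G" and X: "X = Gen \<or> X = Hat"
    and Y: "Gen a 1 \<in> Y" "Gen x i \<in> Y" "X y 1 \<in> Y" "X y 2 \<in> Y" and ij: "1 \<le> i" "1 \<le> j"
  shows "eval_word G e (word_comm ([(Gen a 1, False)] @ pos (Gen x i)) (conj_a a j (short a (X y (i + 1))))) = \<one>
    \<longleftrightarrow> eval_word G e (short a (X y (i + j))) \<otimes> e (Gen x i)
      = e (Gen x i) \<otimes> eval_word G e (short a (X y (i + j + 1)))"
proof -
  define A u z z' where "A = e (Gen a 1)" and "u = e (Gen x i)"
    and "z = eval_word G e (short a (X y (i + j)))" and "z' = eval_word G e (short a (X y (i + j + 1)))"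
  have words: "short a (X y k) \<in> words Y" if "1 \<le> k" for k
    using words_short[OF X Y(1,3,4) that] .
  have c: "A \<in> carrier G" "u \<in> carrier G" "z \<in> carrier G" "z' \<in> carrier G"
    using e Y ij words by (auto simp: A_def u_def z_def z'_def)
  have "conj_a a j (short a (X y (i + 1))) = short a (X y (i + j + 1))"
    using short_conj[OF X, of "i + 1" a y j] ij by (simp add: ac_simps)
  then have "eval_word G e (word_comm ([(Gen a 1, False)] @ pos (Gen x i)) (conj_a a j (short a (X y (i + 1))))) = \<one>
      \<longleftrightarrow> inv A \<otimes> u \<otimes> z' = z' \<otimes> (inv A \<otimes> u)"
    using eval_word_comm_iff[OF e, of "[(Gen a 1, False)] @ pos (Gen x i)" "short a (X y (i + j + 1))"]
      words[of "i + j + 1"] Y c by (simp add: pos_def A_def u_def z'_def)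
  also have "\<dots> \<longleftrightarrow> u \<otimes> z' = A \<otimes> z' \<otimes> inv A \<otimes> u"
  proof
    assume "inv A \<otimes> u \<otimes> z' = z' \<otimes> (inv A \<otimes> u)"
    then have "A \<otimes> (inv A \<otimes> u \<otimes> z') = A \<otimes> (z' \<otimes> (inv A \<otimes> u))" by simp
    then show "u \<otimes> z' = A \<otimes> z' \<otimes> inv A \<otimes> u" using c by (simp add: m_assoc)
  next
    assume "u \<otimes> z' = A \<otimes> z' \<otimes> inv A \<otimes> u"
    then have "inv A \<otimes> (u \<otimes> z') = inv A \<otimes> (A \<otimes> z' \<otimes> inv A \<otimes> u)" by simp
    then show "inv A \<otimes> u \<otimes> z' = z' \<otimes> (inv A \<otimes> u)" using c by (simp add: m_assoc)
  qed
  also have "A \<otimes> z' = z \<otimes> A"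
    using eval_short_shift[OF e X Y(1,3,4), of "i + j"] ij by (simp add: A_def z_def z'_def)
  also have "z \<otimes> A \<otimes> inv A \<otimes> u = z \<otimes> u"
    using c by (simp add: m_assoc)
  finally show ?thesis
    unfolding u_def z_def z'_def by auto
qed

text \<open>The commutation relations are shift relations for two values of each index. The remaining shift relations
  follow by \<open>shift_all\<close>, since the abbreviated letters are conjugates of each other by \<open>a\<^sub>1\<close>.\<close>

lemma comm_rels_shift:
  assumes e: "e \<in> Y \<rightarrow> carrier G" and a: "a \<in> S" and X: "X = Gen \<or> X = Hat"
    and Y: "gens S {1, 2} \<subseteq> Y" "\<And>c. c \<in> S \<Longrightarrow> X c 1 \<in> Y \<and> X c 2 \<in> Y"
    and hold: "\<And>v w. (v, w) \<in> comm_rels Gen S a \<union> comm_rels X S a \<Longrightarrow> eval_word G e v = eval_word G e w"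
    and "x \<in> S" "y \<in> S" "1 \<le> j" "j < q"
  shows "eval_word G e (short a (X y q)) \<otimes> eval_word G e (short a (Gen x j))
    = eval_word G e (short a (Gen x j)) \<otimes> eval_word G e (short a (X y (q + 1)))"
proof -
  let ?v = "\<lambda>X c k. eval_word G e (short a (X c k))"
  have mem: "Gen c 1 \<in> Y" "Gen c 2 \<in> Y" if "c \<in> S" for c
    using Y(1) that by auto
  have closed: "?v X c k \<in> carrier G" "?v Gen c k \<in> carrier G" if "c \<in> S" "1 \<le> k" for c k
    using words_short[OF X, of a Y c k] words_short[of Gen a Y c k] that e Y(2)[of c] mem a by auto
  have A: "?v Gen a 1 = e (Gen a 1)"
    using mem[OF a] e by (intro eval_short_1) auto
  have conj: "?v Z c k \<otimes> ?v Gen a 1 = ?v Gen a 1 \<otimes> ?v Z c (k + 1)"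
    if "Z = Gen \<or> Z = X" "c \<in> S" "2 \<le> k" for Z c k
    unfolding A using that mem a Y(2) X by (intro eval_short_shift[OF e]) auto
  have base: "?v Z c (i + k) \<otimes> ?v Gen b i = ?v Gen b i \<otimes> ?v Z c (i + k + 1)"
    if *: "Z = Gen \<or> Z = X" "b \<in> S" "c \<in> S" "i \<in> {1, 2}" "k \<in> {1, 2}" "(b, i) \<noteq> (a, 1)" for Z b c i k
  proof -
    have "(word_comm ([(Gen a 1, False)] @ pos (Gen b i)) (conj_a a k (short a (Z c (i + 1)))), [])
        \<in> comm_rels Gen S a \<union> comm_rels X S a"
      using * unfolding comm_rels_def by blast
    from hold[OF this] have "eval_word G e (word_comm ([(Gen a 1, False)] @ pos (Gen b i))
        (conj_a a k (short a (Z c (i + 1))))) = \<one>"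
      by simp
    moreover have "?v Gen b i = e (Gen b i)"
      using * mem e by (intro eval_short_1) auto
    ultimately show ?thesis
      using comm_rel_iff[OF e, of Z a b i c k] * X mem a Y(2) by auto
  qed
  show ?thesis
    by (rule shift_all[of a S "?v Gen" "?v X"])
       (fact a closed assms(7-) conj[OF disjI1[OF HOL.refl]] conj[OF disjI2[OF HOL.refl]]
         base[OF disjI1[OF HOL.refl]] base[OF disjI2[OF HOL.refl]])+
qed

end

lemma comm_rels_words:
  assumes "a \<in> S" "X = Gen \<or> X = Hat" "gens S {1, 2} \<subseteq> Y" "\<And>c. c \<in> S \<Longrightarrow> X c 1 \<in> Y \<and> X c 2 \<in> Y"
  shows "comm_rels X S a \<subseteq> words Y \<times> words Y"
proof -
  have mem: "Gen c 1 \<in> Y" "Gen c 2 \<in> Y" if "c \<in> S" for c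
    using assms(3) that by auto
  have "conj_a a j (short a (X y k)) \<in> words Y" if "y \<in> S" "1 \<le> k" for y k j
    using words_conj_a words_short[OF assms(2), of a Y y k] assms(4)[OF that(1)] mem[OF assms(1)] that(2)
    by simp
  then show ?thesis
    using mem assms(1) by (auto simp: comm_rels_def word_comm_def)
qed

lemma (in shift_letters) U_letters_value:
  assumes "factorisation u cs" "set_tree u \<subseteq> S" "1 \<le> j"
    and v: "\<And>c k. c \<in> S \<Longrightarrow> 1 \<le> k \<Longrightarrow> v (Gen c k) = g c k"
  shows "letter_prod K v (U_letters cs j) = tw g u j"
proof -
  let ?v = "\<lambda>l. case l of Gen c k \<Rightarrow> g c k | Hat c k \<Rightarrow> g c k"
  have "letter_prod K v (U_letters cs j) = letter_prod K ?v (U_letters cs j)"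
    using factorisation_colours[OF assms(1,2)] assms(3)
    by (intro letter_prod_cong) (fastforce simp: U_letters_def v)
  also have "\<dots> = tw g u j"
    using assms(1-3) by (intro letter_prod_factorisation(1)[OF shifted_g]) simp_all
  finally show ?thesis .
qed

lemma U_letters_mem:
  assumes "factorisation u cs" "set_tree u \<subseteq> S" "1 \<le> j" "l \<in> set (U_letters cs j)"
  shows "\<exists>c\<in>S. \<exists>k\<ge>1. l = Gen c k"
proof -
  obtain c i where ci: "(c, i) \<in> set cs" "l = Gen c (i + j - 1)"
    using assms(4) by (auto simp: U_letters_def)
  moreover have "c \<in> S" "1 \<le> i + j - 1"
    using factorisation_colours[OF assms(1,2) ci(1)] assms(3) by (simp, linarith)
  ultimately show ?thesis by blast
qed

lemma U_hat_letters_mem: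
  assumes "factorisation u cs" "set_tree u \<subseteq> S" "1 \<le> j" "l \<in> set (U_hat_letters cs j)"
  shows "\<exists>c\<in>S. \<exists>k\<ge>1. l = Gen c k \<or> l = Hat c k"
proof -
  obtain m where m: "m < length cs"
      "l = (case cs ! m of (c, i) \<Rightarrow> if i = Suc m then Hat c (i + j - 1) else Gen c (i + j - 1))"
    using assms(4) by (auto simp: U_hat_letters_def)
  obtain c i where ci: "cs ! m = (c, i)" by (cases "cs ! m")
  then have "c \<in> S" "1 \<le> i + j - 1"
    using factorisation_colours[OF assms(1,2), of c i] nth_mem[OF m(1)] assms(3) by (simp, force)
  moreover have "l = Gen c (i + j - 1) \<or> l = Hat c (i + j - 1)"
    using m(2) ci by (simp split: if_splits)
  ultimately show ?thesis by blast
qed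

lemma all_skein_word_rels:
  "(\<forall>p q. (p, q) \<in> skein_word_rels L \<sigma> R w w' \<longrightarrow> P p q) \<longleftrightarrow>
    (\<forall>u u'. (u, u') \<in> R \<longrightarrow> (\<forall>i\<in>{1, 2}.
      P (concat (map \<sigma> (L (w (u, u')) i))) (concat (map \<sigma> (L (w' (u, u')) i)))))"
  unfolding skein_word_rels_def by fast

locale factorised_skein_category = ore_skein_category +
  fixes w w' :: "'a tree \<times> 'a tree \<Rightarrow> ('a \<times> nat) list"
  assumes factorisations: "\<And>u u'. (u, u') \<in> R \<Longrightarrow> factorisation u (w (u, u')) \<and> factorisation u' (w' (u, u'))"
begin

context
  fixes K :: "('k, 'm) monoid_scheme" and Y :: "'a gen set" and e :: "'a gen \<Rightarrow> 'k"
    and \<sigma> :: "'a gen \<Rightarrow> 'a gen word" and g :: "'a \<Rightarrow> nat \<Rightarrow> 'k"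
  assumes e: "e \<in> Y \<rightarrow> carrier K"
    and \<sigma>: "\<And>c k. c \<in> S \<Longrightarrow> 1 \<le> k \<Longrightarrow> \<sigma> (Gen c k) \<in> words Y"
    and g: "\<And>c k. c \<in> S \<Longrightarrow> 1 \<le> k \<Longrightarrow> eval_word K e (\<sigma> (Gen c k)) = g c k"
    and K: "shift_letters K S g"
begin

interpretation K: shift_letters K S g by (rule K)

text \<open>The word of a factorisation has the value of the tree. So the relation does not depend on the choice of the
  factorisation.\<close>

lemma skein_word_rels_iff:
  "(\<forall>p q. (p, q) \<in> skein_word_rels U_letters \<sigma> R w w' \<longrightarrow> eval_word K e p = eval_word K e q)
    \<longleftrightarrow> (\<forall>u u'. (u, u') \<in> R \<longrightarrow> (\<forall>i\<in>{1, 2}. K.tw g u i = K.tw g u' i))"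
proof -
  have eval: "eval_word K e (concat (map \<sigma> (U_letters cs i))) = K.tw g u i"
    if f: "factorisation u cs" "set_tree u \<subseteq> S" and i: "1 \<le> i" for u cs i
  proof -
    have words: "\<sigma> l \<in> words Y" if "l \<in> set (U_letters cs i)" for l
      using U_letters_mem[OF f i that] \<sigma> by auto
    have "eval_word K e (concat (map \<sigma> (U_letters cs i))) = letter_prod K (\<lambda>l. eval_word K e (\<sigma> l)) (U_letters cs i)"
      by (rule K.eval_word_concat[OF e words])
    also have "\<dots> = K.tw g u i"
      by (rule K.U_letters_value[OF f i g])
    finally show ?thesis .
  qed
  have "eval_word K e (concat (map \<sigma> (U_letters (w (u, u')) i))) = K.tw g u i"
      "eval_word K e (concat (map \<sigma> (U_letters (w' (u, u')) i))) = K.tw g u' i"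
    if "(u, u') \<in> R" "1 \<le> i" for u u' i
    using eval factorisations[OF that(1)] skein_relation[OF that(1)] that(2) by simp_all
  then show ?thesis
    unfolding all_skein_word_rels by simp
qed

lemma skein_word_rels_hat_iff:
  assumes \<sigma>': "\<And>c k. c \<in> S \<Longrightarrow> 1 \<le> k \<Longrightarrow> \<sigma> (Hat c k) \<in> words Y"
    and h: "\<And>c k. c \<in> S \<Longrightarrow> 1 \<le> k \<Longrightarrow> eval_word K e (\<sigma> (Hat c k)) = h c k"
    and shifted: "K.shifted h"
  shows "(\<forall>p q. (p, q) \<in> skein_word_rels U_hat_letters \<sigma> R w w' \<longrightarrow> eval_word K e p = eval_word K e q)
    \<longleftrightarrow> (\<forall>u u'. (u, u') \<in> R \<longrightarrow> (\<forall>i\<in>{1, 2}. K.tw h u i = K.tw h u' i))"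
proof -
  have eval: "eval_word K e (concat (map \<sigma> (U_hat_letters cs i))) = K.tw h u i"
    if f: "factorisation u cs" "set_tree u \<subseteq> S" and i: "1 \<le> i" for u cs i
  proof -
    have words: "\<sigma> l \<in> words Y" if "l \<in> set (U_hat_letters cs i)" for l
      using U_hat_letters_mem[OF f i that] \<sigma> \<sigma>' by auto
    have "eval_word K e (concat (map \<sigma> (U_hat_letters cs i)))
        = letter_prod K (\<lambda>l. eval_word K e (\<sigma> l)) (U_hat_letters cs i)"
      by (rule K.eval_word_concat[OF e words])
    also have "\<dots> = K.tw h u i"
      by (rule K.letter_prod_factorisation(2)[OF shifted g h f i])
    finally show ?thesis .
  qed
  have "eval_word K e (concat (map \<sigma> (U_hat_letters (w (u, u')) i))) = K.tw h u i"
      "eval_word K e (concat (map \<sigma> (U_hat_letters (w' (u, u')) i))) = K.tw h u' i"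
    if "(u, u') \<in> R" "1 \<le> i" for u u' i
    using eval factorisations[OF that(1)] skein_relation[OF that(1)] that(2) by simp_all
  then show ?thesis
    unfolding all_skein_word_rels by simp
qed

end

lemma skein_word_rels_words:
  assumes "\<And>c k. c \<in> S \<Longrightarrow> 1 \<le> k \<Longrightarrow> \<sigma> (Gen c k) \<in> words Y"
  shows "skein_word_rels U_letters \<sigma> R w w' \<subseteq> words Y \<times> words Y"
proof -
  have words: "concat (map \<sigma> (U_letters cs i)) \<in> words Y"
    if "factorisation u cs" "set_tree u \<subseteq> S" "1 \<le> i" for u cs i
    using U_letters_mem[OF that] assms by (intro words_concat) auto
  have "\<forall>p q. (p, q) \<in> skein_word_rels U_letters \<sigma> R w w' \<longrightarrow> p \<in> words Y \<and> q \<in> words Y"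
    unfolding all_skein_word_rels
  proof (intro allI impI ballI)
    fix u u' i assume r: "(u, u') \<in> R" and i: "i \<in> {1, 2 :: nat}"
    have "1 \<le> i" using i by auto
    then show "concat (map \<sigma> (U_letters (w (u, u')) i)) \<in> words Y \<and> concat (map \<sigma> (U_letters (w' (u, u')) i)) \<in> words Y"
      using words[of u "w (u, u')" i] words[of u' "w' (u, u')" i] factorisations[OF r] skein_relation[OF r]
      by blast
  qed
  then show ?thesis by auto
qed

lemma skein_word_rels_hat_words:
  assumes "\<And>c k. c \<in> S \<Longrightarrow> 1 \<le> k \<Longrightarrow> \<sigma> (Gen c k) \<in> words Y" "\<And>c k. c \<in> S \<Longrightarrow> 1 \<le> k \<Longrightarrow> \<sigma> (Hat c k) \<in> words Y"
  shows "skein_word_rels U_hat_letters \<sigma> R w w' \<subseteq> words Y \<times> words Y"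
proof -
  have words: "concat (map \<sigma> (U_hat_letters cs i)) \<in> words Y"
    if "factorisation u cs" "set_tree u \<subseteq> S" "1 \<le> i" for u cs i
    using assms by (intro words_concat) (auto dest!: U_hat_letters_mem[OF that])
  have "\<forall>p q. (p, q) \<in> skein_word_rels U_hat_letters \<sigma> R w w' \<longrightarrow> p \<in> words Y \<and> q \<in> words Y"
    unfolding all_skein_word_rels
  proof (intro allI impI ballI)
    fix u u' i assume r: "(u, u') \<in> R" and i: "i \<in> {1, 2 :: nat}"
    have "1 \<le> i" using i by auto
    then show "concat (map \<sigma> (U_hat_letters (w (u, u')) i)) \<in> words Y \<and> concat (map \<sigma> (U_hat_letters (w' (u, u')) i)) \<in> words Y"
      using words[of u "w (u, u')" i] words[of u' "w' (u, u')" i] factorisations[OF r] skein_relation[OF r]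
      by blast
  qed
  then show ?thesis by auto
qed

section \<open>Groups that satisfy the relations\<close>

\<comment> \<open>In what follows the abbreviations enter through their values only.\<close>
declare short.simps [simp del]

definition "rels_inf_H = shift_rels Gen S \<union> skein_word_rels U_letters pos R w w'"
definition "rels_inf_G = shift_rels Gen S \<union> shift_rels Hat S \<union> hat_a_rels a {1..}
  \<union> skein_word_rels U_letters pos R w w' \<union> skein_word_rels U_hat_letters pos R w w'"
definition "rels_fin_H = comm_rels Gen S a \<union> skein_word_rels U_letters (short a) R w w'"
definition "rels_fin_G = comm_rels Hat S a \<union> comm_rels Gen S a \<union> hat_a_rels a {1, 2}
  \<union> skein_word_rels U_letters (short a) R w w' \<union> skein_word_rels U_hat_letters (short a) R w w'"

definition holds_in :: "('k, 'm) monoid_scheme \<Rightarrow> ('a gen \<Rightarrow> 'k) \<Rightarrow> ('a gen word \<times> 'a gen word) set \<Rightarrow> bool" where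
  "holds_in K e rels \<longleftrightarrow> (\<forall>p q. (p, q) \<in> rels \<longrightarrow> eval_word K e p = eval_word K e q)"

lemma holds_in_Un [simp]: "holds_in K e (A \<union> B) \<longleftrightarrow> holds_in K e A \<and> holds_in K e B"
  unfolding holds_in_def by blast

lemma holds_inD: "holds_in K e rels \<Longrightarrow> (p, q) \<in> rels \<Longrightarrow> eval_word K e p = eval_word K e q"
  unfolding holds_in_def by blast

lemma shift_rels_hold_iff:
  assumes "group K" "X = Gen \<or> X = Hat" "\<And>c j. c \<in> S \<Longrightarrow> 1 \<le> j \<Longrightarrow> e (Gen c j) \<in> carrier K"
    "\<And>c j. c \<in> S \<Longrightarrow> 1 \<le> j \<Longrightarrow> e (X c j) \<in> carrier K"
  shows "holds_in K e (shift_rels X S) \<longleftrightarrow> (\<forall>x\<in>S. \<forall>y\<in>S. \<forall>j\<ge>1. \<forall>q>j.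
    e (X x q) \<otimes>\<^bsub>K\<^esub> e (Gen y j) = e (Gen y j) \<otimes>\<^bsub>K\<^esub> e (X x (q + 1)))"
proof -
  interpret group K by fact
  have eval: "eval_word K e (pos (X x q) @ pos (Gen y j)) = e (X x q) \<otimes>\<^bsub>K\<^esub> e (Gen y j)"
      "eval_word K e (pos (Gen y j) @ pos (X x (q + 1))) = e (Gen y j) \<otimes>\<^bsub>K\<^esub> e (X x (q + 1))"
    if "x \<in> S" "y \<in> S" "1 \<le> j" "j < q" for x y q j
    using assms(3)[of y j] assms(4)[of x q] assms(4)[of x "q + 1"] that by (simp_all add: pos_def)
  show ?thesis
  proof
    assume h: "holds_in K e (shift_rels X S)"
    show "\<forall>x\<in>S. \<forall>y\<in>S. \<forall>j\<ge>1. \<forall>q>j. e (X x q) \<otimes>\<^bsub>K\<^esub> e (Gen y j) = e (Gen y j) \<otimes>\<^bsub>K\<^esub> e (X x (q + 1))"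
    proof (intro ballI allI impI)
      fix x y j q assume *: "x \<in> S" "y \<in> S" "1 \<le> j" "j < (q :: nat)"
      then have "(pos (X x q) @ pos (Gen y j), pos (Gen y j) @ pos (X x (q + 1))) \<in> shift_rels X S"
        unfolding shift_rels_def by blast
      from holds_inD[OF h this] show "e (X x q) \<otimes>\<^bsub>K\<^esub> e (Gen y j) = e (Gen y j) \<otimes>\<^bsub>K\<^esub> e (X x (q + 1))"
        using eval[OF *] by simp
    qed
  next
    assume *: "\<forall>x\<in>S. \<forall>y\<in>S. \<forall>j\<ge>1. \<forall>q>j. e (X x q) \<otimes>\<^bsub>K\<^esub> e (Gen y j) = e (Gen y j) \<otimes>\<^bsub>K\<^esub> e (X x (q + 1))"
    show "holds_in K e (shift_rels X S)"
      unfolding holds_in_def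
    proof (intro allI impI)
      fix p q assume "(p, q) \<in> shift_rels X S"
      then obtain x y n j where **: "p = pos (X x n) @ pos (Gen y j)" "q = pos (Gen y j) @ pos (X x (n + 1))"
          "x \<in> S" "y \<in> S" "1 \<le> j" "j < n"
        unfolding shift_rels_def by blast
      then show "eval_word K e p = eval_word K e q"
        unfolding **(1,2) eval[OF **(3-6)] using * by blast
    qed
  qed
qed

lemma letters_of_rels_inf:
  assumes K: "group K" and e: "e \<in> gens S {1..} \<rightarrow> carrier K" and hold: "holds_in K e rels_inf_H"
  shows "shift_letters K S (\<lambda>c j. e (Gen c j))"
    and "(u, u') \<in> R \<Longrightarrow> i \<in> {1, 2} \<Longrightarrow>
      tree_word K (\<lambda>c j. e (Gen c j)) (\<lambda>c j. e (Gen c j)) u i = tree_word K (\<lambda>c j. e (Gen c j)) (\<lambda>c j. e (Gen c j)) u' i"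
proof -
  interpret K: group K by fact
  have c: "e (Gen c j) \<in> carrier K" if "c \<in> S" "1 \<le> j" for c j
    using e that by auto
  show letters: "shift_letters K S (\<lambda>c j. e (Gen c j))"
  proof (intro shift_letters.intro K shift_letters_axioms.intro)
    fix x y j q assume "x \<in> S" "y \<in> S" "1 \<le> j" "j < (q :: nat)"
    then show "e (Gen x q) \<otimes>\<^bsub>K\<^esub> e (Gen y j) = e (Gen y j) \<otimes>\<^bsub>K\<^esub> e (Gen x (q + 1))"
      using hold shift_rels_hold_iff[OF K, of Gen e] c by (simp add: rels_inf_H_def)
  qed (rule c)
  have "holds_in K e (skein_word_rels U_letters pos R w w')"
    using hold by (simp add: rels_inf_H_def)
  then show "(u, u') \<in> R \<Longrightarrow> i \<in> {1, 2} \<Longrightarrow>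
      tree_word K (\<lambda>c j. e (Gen c j)) (\<lambda>c j. e (Gen c j)) u i = tree_word K (\<lambda>c j. e (Gen c j)) (\<lambda>c j. e (Gen c j)) u' i"
    unfolding holds_in_def using c by (subst (asm) skein_word_rels_iff[OF e _ _ letters]) auto
qed

lemma letters_of_rels_fin:
  assumes K: "group K" and e: "e \<in> Y \<rightarrow> carrier K" and Y: "gens S {1, 2} \<subseteq> Y"
    and hold: "holds_in K e rels_fin_H"
  defines "g \<equiv> \<lambda>c j. eval_word K e (short a (Gen c j))"
  shows "shift_letters K S g"
    and "(u, u') \<in> R \<Longrightarrow> i \<in> {1, 2} \<Longrightarrow> tree_word K g g u i = tree_word K g g u' i"
proof -
  interpret K: group K by fact
  have mem: "Gen c 1 \<in> Y" "Gen c 2 \<in> Y" if "c \<in> S" for c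
    using Y that by auto
  have words: "short a (Gen c k) \<in> words Y" if "c \<in> S" "1 \<le> k" for c k
    using words_short[of Gen a Y c k] mem that a_S by simp
  show letters: "shift_letters K S g"
  proof (intro shift_letters.intro K shift_letters_axioms.intro)
    fix x y j q assume *: "x \<in> S" "y \<in> S" "1 \<le> j" "j < (q :: nat)"
    show "g x q \<otimes>\<^bsub>K\<^esub> g y j = g y j \<otimes>\<^bsub>K\<^esub> g x (q + 1)"
      unfolding g_def
      by (rule K.comm_rels_shift[where X = Gen, OF e a_S _ Y _ _ *(2,1,3,4)])
         (use mem hold in \<open>auto simp: rels_fin_H_def intro: holds_inD\<close>)
  next
    fix c j assume "c \<in> S" "1 \<le> (j :: nat)"
    then show "g c j \<in> carrier K"
      unfolding g_def by (intro K.eval_word_closed[OF e] words)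
  qed
  have "holds_in K e (skein_word_rels U_letters (short a) R w w')"
    using hold by (simp add: rels_fin_H_def)
  then show "(u, u') \<in> R \<Longrightarrow> i \<in> {1, 2} \<Longrightarrow> tree_word K g g u i = tree_word K g g u' i"
    unfolding holds_in_def using words by (subst (asm) skein_word_rels_iff[OF e _ _ letters]) (auto simp: g_def)
qed

lemma rels_inf_G_hom:
  assumes K: "group K" and e: "e \<in> gens S {1..} \<union> hat_gens S {1..} \<rightarrow> carrier K" and hold: "holds_in K e rels_inf_G"
  obtains \<psi> where "\<psi> \<in> hom GG K" "\<And>x. x \<in> gens S {1..} \<union> hat_gens S {1..} \<Longrightarrow> \<psi> (\<gamma> x) = e x"
proof -
  interpret K: group K by fact
  have c: "e (Gen c j) \<in> carrier K" "e (Hat c j) \<in> carrier K" if "c \<in> S" "1 \<le> j" for c j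
    using e that by auto
  have "holds_in K e rels_inf_H"
    using hold by (simp add: rels_inf_G_def rels_inf_H_def)
  moreover have "e \<in> gens S {1..} \<rightarrow> carrier K" using e by auto
  ultimately have letters: "shift_letters K S (\<lambda>c j. e (Gen c j))"
    and skein: "\<And>u u' i. (u, u') \<in> R \<Longrightarrow> i \<in> {1, 2} \<Longrightarrow>
      tree_word K (\<lambda>c j. e (Gen c j)) (\<lambda>c j. e (Gen c j)) u i = tree_word K (\<lambda>c j. e (Gen c j)) (\<lambda>c j. e (Gen c j)) u' i"
    using letters_of_rels_inf[OF K] by blast+
  interpret K: shift_letters K S "\<lambda>c j. e (Gen c j)" by (rule letters)
  have shifted: "K.shifted (\<lambda>c j. e (Hat c j))"
    unfolding K.shifted_def using hold c shift_rels_hold_iff[OF K, of Hat e] by (simp add: rels_inf_G_def)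
  have hat_a: "e (Hat a j) = \<one>\<^bsub>K\<^esub>" if "1 \<le> j" for j
  proof -
    have "(pos (Hat a j), []) \<in> hat_a_rels a {1..}"
      using that by (auto simp: hat_a_rels_def)
    then show ?thesis
      using holds_inD[OF hold, of "pos (Hat a j)" "[]"] c(2)[OF a_S that] by (simp add: rels_inf_G_def)
  qed
  have "holds_in K e (skein_word_rels U_hat_letters pos R w w')"
    using hold by (simp add: rels_inf_G_def)
  then have skein_hat: "K.tw (\<lambda>c j. e (Hat c j)) u i = K.tw (\<lambda>c j. e (Hat c j)) u' i"
    if "(u, u') \<in> R" "i \<in> {1, 2}" for u u' i
    unfolding holds_in_def using c that shifted
    by (subst (asm) skein_word_rels_hat_iff[OF e _ _ letters]) auto
  obtain \<psi> where \<psi>: "\<psi> \<in> hom GG K"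
    "\<And>c j. c \<in> S \<Longrightarrow> 1 \<le> j \<Longrightarrow> \<psi> (\<gamma> (Gen c j)) = e (Gen c j)" "\<And>c j. c \<in> S \<Longrightarrow> 1 \<le> j \<Longrightarrow> \<psi> (\<gamma> (Hat c j)) = e (Hat c j)"
    using GG_universal[OF letters shifted hat_a skein skein_hat] by blast
  then show ?thesis
    by (intro that[of \<psi>]) (auto simp: gens_def hat_gens_def)
qed

text \<open>The abbreviations \<open>short a\<close> provide letters of all indices. They satisfy the infinitely many relations by
  the results on small indices.\<close>

lemma rels_fin_G_hom:
  assumes K: "group K" and e: "e \<in> gens S {1, 2} \<union> hat_gens S {1, 2} \<rightarrow> carrier K" and hold: "holds_in K e rels_fin_G"
  obtains \<psi> where "\<psi> \<in> hom GG K" "\<And>x. x \<in> gens S {1, 2} \<union> hat_gens S {1, 2} \<Longrightarrow> \<psi> (\<gamma> x) = e x"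
proof -
  interpret K: group K by fact
  let ?Y = "gens S {1, 2} \<union> hat_gens S {1, 2}"
  let ?g = "\<lambda>c j. eval_word K e (short a (Gen c j))" and ?h = "\<lambda>c j. eval_word K e (short a (Hat c j))"
  have Y: "gens S {1, 2} \<subseteq> ?Y" by blast
  have H: "holds_in K e rels_fin_H"
    using hold by (simp add: rels_fin_G_def rels_fin_H_def)
  note letters = letters_of_rels_fin(1)[OF K e Y H] and skein = letters_of_rels_fin(2)[OF K e Y H]
  interpret K: shift_letters K S ?g by (rule letters)
  have words: "short a (Gen c k) \<in> words ?Y" "short a (Hat c k) \<in> words ?Y" if "c \<in> S" "1 \<le> k" for c k
    using words_short[of Gen a ?Y c k] words_short[of Hat a ?Y c k] that a_S by simp_all
  have shifted: "K.shifted ?h"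
    unfolding K.shifted_def
  proof (intro conjI ballI allI impI)
    fix x y j q assume *: "x \<in> S" "y \<in> S" "1 \<le> j" "j < (q :: nat)"
    show "?h x q \<otimes>\<^bsub>K\<^esub> ?g y j = ?g y j \<otimes>\<^bsub>K\<^esub> ?h x (q + 1)"
      by (rule K.comm_rels_shift[where X = Hat, OF e a_S _ Y _ _ *(2,1,3,4)])
         (use hold in \<open>auto simp: rels_fin_G_def intro: holds_inD\<close>)
  next
    fix c j assume "c \<in> S" "1 \<le> (j :: nat)"
    then show "?h c j \<in> carrier K"
      by (intro K.eval_word_closed[OF e] words)
  qed
  have small: "?g c j = e (Gen c j)" "?h c j = e (Hat c j)" if "c \<in> S" "j \<in> {1, 2}" for c j
    using Pi_mem[OF e, of "Gen c j"] Pi_mem[OF e, of "Hat c j"] that by (auto intro!: K.eval_short_1)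
  have hat_a_12: "?h a j = \<one>\<^bsub>K\<^esub>" if "j \<in> {1, 2}" for j
  proof -
    have "(pos (Hat a j), []) \<in> hat_a_rels a {1, 2}"
      using that by (auto simp: hat_a_rels_def)
    moreover have "e (Hat a j) \<in> carrier K"
      using e that a_S by auto
    ultimately show ?thesis
      using holds_inD[OF hold, of "pos (Hat a j)" "[]"] small(2)[OF a_S that] by (simp add: rels_fin_G_def)
  qed
  have hat_a: "?h a j = \<one>\<^bsub>K\<^esub>" if "1 \<le> j" for j
  proof (cases "j = 1")
    case True
    then show ?thesis using hat_a_12 by simp
  next
    case False
    with that have "2 \<le> j" by simp
    then show ?thesis
    proof (induction j rule: dec_induct)
      case base
      then show ?case using hat_a_12 by simp
    next
      case (step j)
      have "\<one>\<^bsub>K\<^esub> \<otimes>\<^bsub>K\<^esub> e (Gen a 1) = e (Gen a 1) \<otimes>\<^bsub>K\<^esub> ?h a (j + 1)"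
        using K.eval_short_shift[OF e, of Hat a a j] step a_S by simp
      moreover have "e (Gen a 1) \<in> carrier K"
        using e a_S by auto
      moreover have "?h a (j + 1) \<in> carrier K"
        by (intro K.eval_word_closed[OF e] words a_S) simp
      ultimately show ?case
        by (simp add: Suc_eq_plus1)
    qed
  qed
  have "holds_in K e (skein_word_rels U_hat_letters (short a) R w w')"
    using hold by (simp add: rels_fin_G_def)
  then have skein_hat: "K.tw ?h u i = K.tw ?h u' i" if "(u, u') \<in> R" "i \<in> {1, 2}" for u u' i
    unfolding holds_in_def using words that shifted
    by (subst (asm) skein_word_rels_hat_iff[OF e _ _ letters, where h = ?h]) auto
  obtain \<psi> where \<psi>: "\<psi> \<in> hom GG K"
    "\<And>c j. c \<in> S \<Longrightarrow> 1 \<le> j \<Longrightarrow> \<psi> (\<gamma> (Gen c j)) = ?g c j" "\<And>c j. c \<in> S \<Longrightarrow> 1 \<le> j \<Longrightarrow> \<psi> (\<gamma> (Hat c j)) = ?h c j"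
    using GG_universal[OF letters shifted hat_a skein skein_hat] by blast
  then show ?thesis
    by (intro that[of \<psi>]) (auto simp: gens_def hat_gens_def small)
qed

lemma rels_inf_H_hom:
  assumes K: "group K" and e: "e \<in> gens S {1..} \<rightarrow> carrier K" and hold: "holds_in K e rels_inf_H"
  obtains \<psi> where "\<psi> \<in> hom HH K" "\<And>c j. c \<in> S \<Longrightarrow> 1 \<le> j \<Longrightarrow> \<psi> (\<beta> c j) = e (Gen c j)"
proof (rule HH_universal[OF letters_of_rels_inf(1)[OF assms]])
  fix u u' i assume "(u, u') \<in> R" "i \<in> {1, 2 :: nat}"
  then show "tree_word K (\<lambda>c j. e (Gen c j)) (\<lambda>c j. e (Gen c j)) u i
      = tree_word K (\<lambda>c j. e (Gen c j)) (\<lambda>c j. e (Gen c j)) u' i"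
    by (rule letters_of_rels_inf(2)[OF assms])
next
  fix \<psi> assume "\<psi> \<in> hom HH K" "\<And>c j. c \<in> S \<Longrightarrow> 1 \<le> j \<Longrightarrow> \<psi> (\<beta> c j) = e (Gen c j)"
  then show thesis
    by (rule that)
qed

lemma rels_fin_H_hom:
  assumes K: "group K" and e: "e \<in> gens S {1, 2} \<rightarrow> carrier K" and hold: "holds_in K e rels_fin_H"
  obtains \<psi> where "\<psi> \<in> hom HH K" "\<And>c j. c \<in> S \<Longrightarrow> j \<in> {1, 2} \<Longrightarrow> \<psi> (\<beta> c j) = e (Gen c j)"
proof (rule HH_universal[OF letters_of_rels_fin(1)[OF K e order_refl hold]])
  interpret K: group K by fact
  fix u u' i assume "(u, u') \<in> R" "i \<in> {1, 2 :: nat}"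
  then show "tree_word K (\<lambda>c j. eval_word K e (short a (Gen c j))) (\<lambda>c j. eval_word K e (short a (Gen c j))) u i
      = tree_word K (\<lambda>c j. eval_word K e (short a (Gen c j))) (\<lambda>c j. eval_word K e (short a (Gen c j))) u' i"
    by (rule letters_of_rels_fin(2)[OF K e order_refl hold])
next
  interpret K: group K by fact
  fix \<psi> assume \<psi>: "\<psi> \<in> hom HH K"
      "\<And>c j. c \<in> S \<Longrightarrow> 1 \<le> j \<Longrightarrow> \<psi> (\<beta> c j) = eval_word K e (short a (Gen c j))"
  have "\<psi> (\<beta> c j) = e (Gen c j)" if "c \<in> S" "j \<in> {1, 2}" for c j
    using \<psi>(2)[of c j] K.eval_short_1[of Gen e c j a] Pi_mem[OF e, of "Gen c j"] that by auto
  with \<psi>(1) show thesis by (rule that)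
qed

text \<open>Conversely, if there are letters of all indices that satisfy the shift relations, then those of index
  \<open>\<ge> 3\<close> are the conjugates which the abbreviations stand for, and the commutation relations are among the shift relations.\<close>

lemma rels_hold:
  assumes letters: "shift_letters K S (\<lambda>c j. e (Gen c j))"
    and skein: "\<And>u u' i. (u, u') \<in> R \<Longrightarrow> i \<in> {1, 2} \<Longrightarrow>
      tree_word K (\<lambda>c j. e (Gen c j)) (\<lambda>c j. e (Gen c j)) u i = tree_word K (\<lambda>c j. e (Gen c j)) (\<lambda>c j. e (Gen c j)) u' i"
  shows "holds_in K e rels_inf_H" "holds_in K e rels_fin_H"
    and "shift_letters.shifted K S (\<lambda>c j. e (Gen c j)) (\<lambda>c j. e (X c j)) \<Longrightarrow> X = Gen \<or> X = Hat \<Longrightarrow>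
      holds_in K e (shift_rels X S) \<and> holds_in K e (comm_rels X S a)"
    and "shift_letters.shifted K S (\<lambda>c j. e (Gen c j)) (\<lambda>c j. e (X c j)) \<Longrightarrow> X = Gen \<or> X = Hat \<Longrightarrow>
      c \<in> S \<Longrightarrow> 1 \<le> k \<Longrightarrow> eval_word K e (short a (X c k)) = e (X c k)"
proof -
  interpret K: shift_letters K S "\<lambda>c j. e (Gen c j)" by (rule letters)
  have short: "eval_word K e (short a (X c k)) = e (X c k)"
    if "K.shifted (\<lambda>c j. e (X c j))" "X = Gen \<or> X = Hat" "c \<in> S" "1 \<le> k" for X c k
    using that K.shifted_closed[OF that(1)] K.shifted_shift[OF that(1)] K.g_closed a_S
    by (intro K.eval_short) auto
  have shift: "holds_in K e (shift_rels X S) \<and> holds_in K e (comm_rels X S a)"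
    if X: "K.shifted (\<lambda>c j. e (X c j))" "X = Gen \<or> X = Hat" for X
  proof
    show "holds_in K e (shift_rels X S)"
      using shift_rels_hold_iff[OF K.is_group X(2)] X(1) K.g_closed unfolding K.shifted_def by blast
    show "holds_in K e (comm_rels X S a)"
      unfolding holds_in_def
    proof (intro allI impI)
      fix p q assume "(p, q) \<in> comm_rels X S a"
      then obtain x y i j where *: "p = word_comm ([(Gen a 1, False)] @ pos (Gen x i)) (conj_a a j (short a (X y (i + 1))))"
          "q = []" "x \<in> S" "y \<in> S" "i \<in> {1, 2}" "j \<in> {1, 2}"
        unfolding comm_rels_def by blast
      let ?Y = "{Gen a 1, Gen x i, X y 1, X y 2}"
      have i: "1 \<le> i" "1 \<le> j" using * by auto
      have Y: "e \<in> ?Y \<rightarrow> carrier K"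
        using * i K.g_closed K.shifted_closed[OF X(1)] a_S by auto
      have "e (X y (i + j)) \<otimes>\<^bsub>K\<^esub> e (Gen x i) = e (Gen x i) \<otimes>\<^bsub>K\<^esub> e (X y (i + j + 1))"
        using K.shifted_shift[OF X(1) *(4,3) i(1), of "i + j"] i(2) by simp
      then have "eval_word K e p = \<one>\<^bsub>K\<^esub>"
        unfolding *(1) using K.comm_rel_iff[OF Y X(2), of a x i y j] short[OF X *(4)] i
        by simp
      then show "eval_word K e p = eval_word K e q"
        by (simp add: *(2))
    qed
  qed
  have e: "e \<in> gens S {1..} \<rightarrow> carrier K"
    using K.g_closed by (auto simp: gens_def)
  have words: "short a (Gen c k) \<in> words (gens S {1..})" if "c \<in> S" "1 \<le> k" for c k
    using words_short[of Gen a "gens S {1..}" c k] that a_S by simp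
  have "holds_in K e (skein_word_rels U_letters pos R w w')"
    unfolding holds_in_def using skein K.g_closed by (subst skein_word_rels_iff[OF e _ _ letters]) auto
  moreover have "holds_in K e (skein_word_rels U_letters (short a) R w w')"
    unfolding holds_in_def using skein short[OF K.shifted_g] words
    by (subst skein_word_rels_iff[OF e _ _ letters]) auto
  ultimately show "holds_in K e rels_inf_H" "holds_in K e rels_fin_H"
    using shift[OF K.shifted_g] by (simp_all add: rels_inf_H_def rels_fin_H_def)
  show "K.shifted (\<lambda>c j. e (X c j)) \<Longrightarrow> X = Gen \<or> X = Hat \<Longrightarrow>
      holds_in K e (shift_rels X S) \<and> holds_in K e (comm_rels X S a)"
    using shift by blast
  show "K.shifted (\<lambda>c j. e (X c j)) \<Longrightarrow> X = Gen \<or> X = Hat \<Longrightarrow>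
      c \<in> S \<Longrightarrow> 1 \<le> k \<Longrightarrow> eval_word K e (short a (X c k)) = e (X c k)"
    using short by blast
qed

end

text \<open>Conjugation by \<open>a\<^sub>1\<close> yields the letters of larger index.\<close>

lemma (in shift_letters) shifted_generate:
  assumes h: "shifted h" and X: "X \<subseteq> carrier K" and a: "a \<in> S" "g a 1 \<in> generate K X"
    and c: "c \<in> S" "h c 1 \<in> generate K X" "h c 2 \<in> generate K X" and "1 \<le> j"
  shows "h c j \<in> generate K X"
proof (cases "j = 1")
  case False
  with \<open>1 \<le> j\<close> have "2 \<le> j" by simp
  then show ?thesis
  proof (induction j rule: dec_induct)
    case (step j)
    have "h c (j + 1) = inv (g a 1) \<otimes> (h c j \<otimes> g a 1)"
      using shifted_shift[OF h c(1) a(1), of 1 j] step(1) shifted_closed[OF h c(1), of "j + 1"] g_closed[OF a(1), of 1]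
      by simp
    then show ?case
      using step.IH a(2) generate_m_inv_closed[OF X a(2)] by (simp add: Suc_eq_plus1 generate.eng)
  qed (rule c)
qed (use c in simp)

section \<open>Numbers of generators and relations\<close>

lemma comm_rels_image:
  "comm_rels X S a = (\<lambda>((x, i), (y, j)).
      (word_comm ([(Gen a 1, False)] @ pos (Gen x i)) (conj_a a j (short a (X y (i + 1)))), []))
    ` ((S \<times> {1, 2} - {(a, 1)}) \<times> (S \<times> {1, 2}))" (is "_ = ?f ` ?A")
proof
  show "comm_rels X S a \<subseteq> ?f ` ?A"
  proof
    fix r assume "r \<in> comm_rels X S a"
    then obtain x y i j where *: "r = ?f ((x, i), (y, j))" "x \<in> S" "y \<in> S" "i \<in> {1, 2}" "j \<in> {1, 2}" "(x, i) \<noteq> (a, 1)"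
      unfolding comm_rels_def by auto
    then have "((x, i), (y, j)) \<in> ?A" by simp
    with *(1) show "r \<in> ?f ` ?A" by (rule image_eqI)
  qed
  show "?f ` ?A \<subseteq> comm_rels X S a"
    unfolding comm_rels_def by fastforce
qed

lemma card_comm_rels:
  assumes "finite S" "a \<in> S"
  shows "finite (comm_rels X S a)" "card (comm_rels X S a) \<le> 4 * (card S)\<^sup>2 - 2 * card S"
proof -
  have card: "card ((S \<times> {1, 2 :: nat} - {(a, 1)}) \<times> (S \<times> {1, 2 :: nat})) = (2 * card S - 1) * (2 * card S)"
  proof -
    have pairs: "card (S \<times> {1, 2 :: nat}) = 2 * card S"
      by (simp add: card_cartesian_product One_nat_def)
    moreover have "card (S \<times> {1, 2 :: nat} - {(a, 1)}) = 2 * card S - 1"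
      using assms pairs by (subst card_Diff_singleton) auto
    ultimately show ?thesis
      by (simp only: card_cartesian_product[of _ "S \<times> {1, 2 :: nat}"])
  qed
  show "finite (comm_rels X S a)"
    unfolding comm_rels_image using assms by simp
  have "card (comm_rels X S a) \<le> (2 * card S - 1) * (2 * card S)"
    unfolding comm_rels_image card[symmetric] using assms by (intro card_image_le) simp
  also have "\<dots> = 4 * (card S)\<^sup>2 - 2 * card S"
    by (simp add: power2_eq_square diff_mult_distrib)
  finally show "card (comm_rels X S a) \<le> 4 * (card S)\<^sup>2 - 2 * card S" .
qed

lemma card_skein_word_rels:
  assumes "finite R"
  shows "finite (skein_word_rels L \<sigma> R w w')" "card (skein_word_rels L \<sigma> R w w') \<le> 2 * card R"
proof -
  have img: "skein_word_rels L \<sigma> R w w'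
      = (\<lambda>(r, i). (concat (map \<sigma> (L (w r) i)), concat (map \<sigma> (L (w' r) i)))) ` (R \<times> {1, 2})"
    unfolding skein_word_rels_def by force
  show "finite (skein_word_rels L \<sigma> R w w')"
    unfolding img using assms by simp
  have "card (skein_word_rels L \<sigma> R w w') \<le> card (R \<times> {1, 2 :: nat})"
    unfolding img using assms by (intro card_image_le) simp
  then show "card (skein_word_rels L \<sigma> R w w') \<le> 2 * card R"
    by (simp add: card_cartesian_product One_nat_def)
qed

lemma card_hat_a_rels: "finite (hat_a_rels a {1, 2})" "card (hat_a_rels a {1, 2}) \<le> 2"
proof -
  have img: "hat_a_rels a {1, 2} = (\<lambda>n. (pos (Hat a n), [])) ` {1, 2}"
    unfolding hat_a_rels_def by blast
  show "finite (hat_a_rels a {1, 2})"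
    unfolding img by simp
  show "card (hat_a_rels a {1, 2}) \<le> 2"
    unfolding img by (rule order_trans[OF card_image_le]) simp_all
qed

lemma card_gens:
  assumes "finite S"
  shows "finite (gens S {1, 2} \<union> hat_gens S {1, 2})" "card (gens S {1, 2} \<union> hat_gens S {1, 2}) = 4 * card S"
proof -
  have img: "gens S {1, 2} = (\<lambda>(b, j). Gen b j) ` (S \<times> {1, 2})" "hat_gens S {1, 2} = (\<lambda>(b, j). Hat b j) ` (S \<times> {1, 2})"
    unfolding gens_def hat_gens_def by auto
  show fin: "finite (gens S {1, 2} \<union> hat_gens S {1, 2})"
    unfolding img using assms by simp
  have "card (gens S {1, 2}) = 2 * card S" "card (hat_gens S {1, 2}) = 2 * card S"
    unfolding img by (subst card_image; auto simp: inj_on_def card_cartesian_product One_nat_def)+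
  moreover have "gens S {1, 2} \<inter> hat_gens S {1, 2} = {}"
    unfolding gens_def hat_gens_def by auto
  ultimately show "card (gens S {1, 2} \<union> hat_gens S {1, 2}) = 4 * card S"
    using fin by (subst card_Un_disjoint) simp_all
qed

section \<open>The presentations of the fraction groups\<close>

context factorised_skein_category
begin

abbreviation "gens_fin \<equiv> gens S {1, 2} \<union> hat_gens S {1, 2}"
abbreviation "gens_inf \<equiv> gens S {1..} \<union> hat_gens S {1..}"

lemma short_words:
  assumes "c \<in> S" "1 \<le> k"
  shows "short a (Gen c k) \<in> words (gens S {1, 2})" "short a (Gen c k) \<in> words gens_fin" "short a (Hat c k) \<in> words gens_fin"
  using words_short[of Gen a "gens S {1, 2}" c k] words_short[of Gen a gens_fin c k] words_short[of Hat a gens_fin c k]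
    assms a_S by simp_all

lemma shift_rels_words:
  assumes "X = Gen \<or> X = Hat" "gens S {1..} \<subseteq> Y" "\<And>c k. c \<in> S \<Longrightarrow> 1 \<le> k \<Longrightarrow> X c k \<in> Y"
  shows "shift_rels X S \<subseteq> words Y \<times> words Y"
proof -
  have "Gen c k \<in> Y" if "c \<in> S" "1 \<le> k" for c k
    using assms(2) that by auto
  then show ?thesis
    using assms(3) by (auto simp: shift_rels_def)
qed

lemma rels_words:
  "rels_inf_H \<subseteq> words (gens S {1..}) \<times> words (gens S {1..})"
  "rels_inf_G \<subseteq> words gens_inf \<times> words gens_inf"
  "rels_fin_H \<subseteq> words (gens S {1, 2}) \<times> words (gens S {1, 2})"
  "rels_fin_G \<subseteq> words gens_fin \<times> words gens_fin"
proof -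
  show "rels_inf_H \<subseteq> words (gens S {1..}) \<times> words (gens S {1..})"
    unfolding rels_inf_H_def
    by (intro Un_least shift_rels_words skein_word_rels_words) auto
  have "hat_a_rels a {1..} \<subseteq> words gens_inf \<times> words gens_inf"
    by (auto simp: hat_a_rels_def)
  then show "rels_inf_G \<subseteq> words gens_inf \<times> words gens_inf"
    unfolding rels_inf_G_def
    by (intro Un_least shift_rels_words skein_word_rels_words skein_word_rels_hat_words) auto
  show "rels_fin_H \<subseteq> words (gens S {1, 2}) \<times> words (gens S {1, 2})"
    unfolding rels_fin_H_def
    by (intro Un_least comm_rels_words skein_word_rels_words short_words) auto
  have "hat_a_rels a {1, 2} \<subseteq> words gens_fin \<times> words gens_fin"
    by (auto simp: hat_a_rels_def)
  then show "rels_fin_G \<subseteq> words gens_fin \<times> words gens_fin"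
    unfolding rels_fin_G_def
    by (intro Un_least comm_rels_words skein_word_rels_words skein_word_rels_hat_words short_words) auto
qed

lemma skein_12:
  assumes "(u, u') \<in> R" "i \<in> {1, 2}"
  shows "GF.tw (\<lambda>c j. \<gamma> (Gen c j)) u i = GF.tw (\<lambda>c j. \<gamma> (Gen c j)) u' i"
    and "GF.tw (\<lambda>c j. \<gamma> (Hat c j)) u i = GF.tw (\<lambda>c j. \<gamma> (Hat c j)) u' i"
    and "HF.tw \<beta> u i = HF.tw \<beta> u' i"
proof -
  have "1 \<le> i" using assms(2) by auto
  then show "GF.tw (\<lambda>c j. \<gamma> (Gen c j)) u i = GF.tw (\<lambda>c j. \<gamma> (Gen c j)) u' i"
      "GF.tw (\<lambda>c j. \<gamma> (Hat c j)) u i = GF.tw (\<lambda>c j. \<gamma> (Hat c j)) u' i"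
      "HF.tw \<beta> u i = HF.tw \<beta> u' i"
    using tw_\<gamma>_skein tw_\<beta>_skein assms(1) by blast+
qed

lemma \<gamma>_mem: "\<gamma> \<in> gens_inf \<rightarrow> carrier GG" "\<gamma> \<in> gens_fin \<rightarrow> carrier GG"
  using \<gamma>_closed by (auto simp: gens_def hat_gens_def)

lemma rels_G_hold: "holds_in GG \<gamma> rels_inf_G" "holds_in GG \<gamma> rels_fin_G"
proof -
  note letters = GF.shift_letters_axioms
  note H = rels_hold(1,2)[OF letters skein_12(1)]
  note hat = rels_hold(3)[OF letters skein_12(1) GF.shifted_h disjI2[OF HOL.refl]]
  have short: "eval_word GG \<gamma> (short a (Gen c k)) = \<gamma> (Gen c k)"
      "eval_word GG \<gamma> (short a (Hat c k)) = \<gamma> (Hat c k)" if "c \<in> S" "1 \<le> k" for c k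
    using rels_hold(4)[OF letters skein_12(1) GF.shifted_g disjI1[OF HOL.refl] that]
      rels_hold(4)[OF letters skein_12(1) GF.shifted_h disjI2[OF HOL.refl] that] by blast+
  have hat_a: "holds_in GG \<gamma> (hat_a_rels a J)" if "J \<subseteq> {1..}" for J
    unfolding holds_in_def hat_a_rels_def using that \<gamma>_hat_a by (auto simp: pos_def)
  have "holds_in GG \<gamma> (skein_word_rels U_hat_letters pos R w w')"
    unfolding holds_in_def using skein_12(2) \<gamma>_closed
    by (subst skein_word_rels_hat_iff[OF \<gamma>_mem(1) _ _ letters _ _ GF.shifted_h]) auto
  then show "holds_in GG \<gamma> rels_inf_G"
    using H(1) hat hat_a[of "{1..}"] by (simp add: rels_inf_G_def rels_inf_H_def)
  have "holds_in GG \<gamma> (skein_word_rels U_hat_letters (short a) R w w')"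
    unfolding holds_in_def using skein_12(2) short short_words
    by (subst skein_word_rels_hat_iff[OF \<gamma>_mem(2) _ _ letters _ _ GF.shifted_h]) auto
  then show "holds_in GG \<gamma> rels_fin_G"
    using H(2) hat hat_a[of "{1, 2}"] by (simp add: rels_fin_G_def rels_fin_H_def)
qed

lemma \<gamma>_generate:
  assumes "X \<subseteq> gens_inf" "gens_fin \<subseteq> X" "c \<in> S" "1 \<le> j"
  shows "\<gamma> (Gen c j) \<in> generate GG (\<gamma> ` X)" "\<gamma> (Hat c j) \<in> generate GG (\<gamma> ` X)"
proof -
  have sub: "\<gamma> ` X \<subseteq> carrier GG"
    using \<gamma>_mem(1) assms(1) by blast
  have incl: "\<gamma> l \<in> generate GG (\<gamma> ` X)" if "l \<in> gens_fin" for l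
    using that assms(2) by (intro generate.incl) blast
  show "\<gamma> (Gen c j) \<in> generate GG (\<gamma> ` X)"
    by (rule GF.shifted_generate[OF GF.shifted_g sub a_S _ assms(3) _ _ assms(4)])
       (use assms(3) in \<open>auto intro!: incl\<close>)
  show "\<gamma> (Hat c j) \<in> generate GG (\<gamma> ` X)"
    by (rule GF.shifted_generate[OF GF.shifted_h sub a_S _ assms(3) _ _ assms(4)])
       (use assms(3) in \<open>auto intro!: incl\<close>)
qed

lemma generate_GG_gens:
  assumes "X \<subseteq> gens_inf" "gens_fin \<subseteq> X"
  shows "carrier GG \<subseteq> generate GG (\<gamma> ` X)"
proof (rule generate_GG)
  show "\<gamma> ` X \<subseteq> carrier GG"
    using \<gamma>_mem(1) assms(1) by blast
qed (rule \<gamma>_generate[OF assms]; assumption)+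

text \<open>In each of the four cases below, the homomorphism back to the presented group exists because its generators
  satisfy the relations.\<close>

lemma presentation_inf_G: "has_presentation GG gens_inf rels_inf_G \<gamma>"
proof -
  note words = rels_words(2)
  have "holds_in (presented_group gens_inf rels_inf_G) (presented_gen gens_inf rels_inf_G) rels_inf_G"
    using presented_group_rel[OF words] by (simp add: holds_in_def)
  then obtain \<psi> where \<psi>: "\<psi> \<in> hom GG (presented_group gens_inf rels_inf_G)"
      "\<And>x. x \<in> gens_inf \<Longrightarrow> \<psi> (\<gamma> x) = presented_gen gens_inf rels_inf_G x"
    using rels_inf_G_hom[OF group_presented_group[OF words] presented_gen_closed[OF words]] by blast
  have "carrier GG \<subseteq> generate GG (\<gamma> ` gens_inf)"
    by (rule generate_GG_gens) (auto simp: gens_def hat_gens_def)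
  then show ?thesis
    using has_presentationI[OF words group_GG \<gamma>_mem(1) holds_inD[OF rels_G_hold(1)] _ \<psi>] by blast
qed

lemma presentation_fin_G: "has_presentation GG gens_fin rels_fin_G \<gamma>"
proof -
  note words = rels_words(4)
  have "holds_in (presented_group gens_fin rels_fin_G) (presented_gen gens_fin rels_fin_G) rels_fin_G"
    using presented_group_rel[OF words] by (simp add: holds_in_def)
  then obtain \<psi> where \<psi>: "\<psi> \<in> hom GG (presented_group gens_fin rels_fin_G)"
      "\<And>x. x \<in> gens_fin \<Longrightarrow> \<psi> (\<gamma> x) = presented_gen gens_fin rels_fin_G x"
    using rels_fin_G_hom[OF group_presented_group[OF words] presented_gen_closed[OF words]] by blast
  have "carrier GG \<subseteq> generate GG (\<gamma> ` gens_fin)"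
    by (rule generate_GG_gens) (auto simp: gens_def hat_gens_def)
  then show ?thesis
    using has_presentationI[OF words group_GG \<gamma>_mem(2) holds_inD[OF rels_G_hold(2)] _ \<psi>] by blast
qed

text \<open>The value at hatted symbols is a default value.\<close>

definition \<beta>' :: "'a gen \<Rightarrow> ((nat \<Rightarrow> 'a forest set) \<times> (nat \<Rightarrow> 'a forest set)) set" where
  "\<beta>' l = (case l of Gen c j \<Rightarrow> \<beta> c j | Hat c j \<Rightarrow> \<beta> c j)"

lemma \<beta>'_Gen [simp]: "\<beta>' (Gen c j) = \<beta> c j"
  by (simp add: \<beta>'_def)

lemma \<beta>'_mem: "\<beta>' \<in> gens S {1..} \<rightarrow> carrier HH" "\<beta>' \<in> gens S {1, 2} \<rightarrow> carrier HH"
  using HF.gh_closed(1) by (auto simp: gens_def)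

lemma rels_H_hold: "holds_in HH \<beta>' rels_inf_H" "holds_in HH \<beta>' rels_fin_H"
  using rels_hold(1,2)[of HH \<beta>'] HF.shift_letters_axioms skein_12(3) by simp_all

lemma generate_HH_gens:
  assumes "X \<subseteq> gens S {1..}" "gens S {1, 2} \<subseteq> X"
  shows "carrier HH \<subseteq> generate HH (\<beta>' ` X)"
proof (rule generate_HH)
  show sub: "\<beta>' ` X \<subseteq> carrier HH"
    using \<beta>'_mem(1) assms(1) by blast
  have incl: "\<beta> c j \<in> generate HH (\<beta>' ` X)" if "c \<in> S" "j \<in> {1, 2}" for c j
  proof -
    have "Gen c j \<in> X" using assms(2) that by auto
    then have "\<beta>' (Gen c j) \<in> generate HH (\<beta>' ` X)"
      by (intro generate.incl imageI)
    then show ?thesis by simp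
  qed
  fix c j assume *: "c \<in> S" "1 \<le> (j :: nat)"
  show "\<beta> c j \<in> generate HH (\<beta>' ` X)"
    by (rule HF.shifted_generate[OF HF.shifted_g sub a_S incl[OF a_S] *(1) incl[OF *(1)] incl[OF *(1)] *(2)])
       simp_all
qed

lemma presentation_inf_H: "has_presentation HH (gens S {1..}) rels_inf_H \<beta>'"
proof -
  note words = rels_words(1)
  let ?P = "presented_group (gens S {1..}) rels_inf_H" and ?p = "presented_gen (gens S {1..}) rels_inf_H"
  have "holds_in ?P ?p rels_inf_H"
    using presented_group_rel[OF words] by (simp add: holds_in_def)
  then obtain \<psi> where \<psi>: "\<psi> \<in> hom HH ?P" "\<And>c j. c \<in> S \<Longrightarrow> 1 \<le> j \<Longrightarrow> \<psi> (\<beta> c j) = ?p (Gen c j)"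
    using rels_inf_H_hom[OF group_presented_group[OF words] presented_gen_closed[OF words]] by blast
  have "carrier HH \<subseteq> generate HH (\<beta>' ` gens S {1..})"
    by (rule generate_HH_gens) (auto simp: gens_def)
  moreover have "\<psi> (\<beta>' x) = ?p x" if "x \<in> gens S {1..}" for x
    using that \<psi>(2) by (auto simp: gens_def)
  ultimately show ?thesis
    using has_presentationI[OF words group_HH \<beta>'_mem(1) holds_inD[OF rels_H_hold(1)] _ \<psi>(1)] by blast
qed

lemma presentation_fin_H: "has_presentation HH (gens S {1, 2}) rels_fin_H \<beta>'"
proof -
  note words = rels_words(3)
  let ?P = "presented_group (gens S {1, 2}) rels_fin_H" and ?p = "presented_gen (gens S {1, 2}) rels_fin_H"
  have "holds_in ?P ?p rels_fin_H"
    using presented_group_rel[OF words] by (simp add: holds_in_def)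
  then obtain \<psi> where \<psi>: "\<psi> \<in> hom HH ?P" "\<And>c j. c \<in> S \<Longrightarrow> j \<in> {1, 2} \<Longrightarrow> \<psi> (\<beta> c j) = ?p (Gen c j)"
    using rels_fin_H_hom[OF group_presented_group[OF words] presented_gen_closed[OF words]] by blast
  have "carrier HH \<subseteq> generate HH (\<beta>' ` gens S {1, 2})"
    by (rule generate_HH_gens) (auto simp: gens_def)
  moreover have "\<psi> (\<beta>' x) = ?p x" if "x \<in> gens S {1, 2}" for x
    using that \<psi>(2) by (auto simp: gens_def)
  ultimately show ?thesis
    using has_presentationI[OF words group_HH \<beta>'_mem(2) holds_inD[OF rels_H_hold(2)] _ \<psi>(1)] by blast
qed

text \<open>The image of the embedding is the subgroup generated by the images of the generators of the finite presentation.\<close>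

lemma H_subgroup_iso:
  obtains \<theta> where "\<theta> \<in> iso (GG\<lparr>carrier := generate GG (\<gamma> ` gens S {1, 2})\<rparr>) HH"
    "\<And>x. x \<in> gens S {1..} \<Longrightarrow> \<theta> (\<gamma> x) = \<beta>' x"
proof -
  obtain \<eta> where \<eta>: "\<eta> \<in> hom HH GG" "inj_on \<eta> (carrier HH)"
      "\<And>c j. c \<in> S \<Longrightarrow> 1 \<le> j \<Longrightarrow> \<eta> (\<beta> c j) = \<gamma> (Gen c j)"
    using HH_embeds by blast
  interpret \<eta>: group_hom HH GG \<eta>
    using \<eta>(1) group_HH group_GG by (simp add: group_hom_def group_hom_axioms_def)
  have \<eta>_gens: "\<eta> (\<beta>' x) = \<gamma> x" if "x \<in> gens S {1..}" for x
    using that \<eta>(3) by (auto simp: gens_def)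
  have "\<eta> ` \<beta>' ` gens S {1, 2} = (\<lambda>x. \<eta> (\<beta>' x)) ` gens S {1, 2}"
    by (simp only: image_image)
  also have "\<dots> = \<gamma> ` gens S {1, 2}"
    by (intro image_cong HOL.refl \<eta>_gens) (auto simp: gens_def)
  finally have img: "generate GG (\<gamma> ` gens S {1, 2}) = \<eta> ` carrier HH"
    using \<eta>.generate_img[of "\<beta>' ` gens S {1, 2}"] has_presentation_generate[OF presentation_fin_H]
      funcset_image[OF \<beta>'_mem(2)] by simp
  have "\<eta> \<in> iso HH (GG\<lparr>carrier := \<eta> ` carrier HH\<rparr>)"
    using \<eta>(1,2) by (auto simp: iso_def hom_def bij_betw_def)
  then have "inv_into (carrier HH) \<eta> \<in> iso (GG\<lparr>carrier := generate GG (\<gamma> ` gens S {1, 2})\<rparr>) HH"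
    unfolding img by (rule group.iso_set_sym[OF group_HH])
  moreover have "inv_into (carrier HH) \<eta> (\<gamma> x) = \<beta>' x" if "x \<in> gens S {1..}" for x
    using inv_into_f_f[OF \<eta>(2) Pi_mem[OF \<beta>'_mem(1) that]] \<eta>_gens[OF that] by simp
  ultimately show ?thesis
    by (rule that)
qed

lemma infinite_GG: "infinite (carrier GG)"
proof (rule HH_embeds)
  fix \<eta> assume \<eta>: "\<eta> \<in> hom HH GG" "inj_on \<eta> (carrier HH)"
  show ?thesis
  proof
    assume "finite (carrier GG)"
    then have "finite (\<eta> ` carrier HH)"
      using hom_carrier[OF \<eta>(1)] by (rule finite_subset[rotated])
    then show False
      using finite_imageD[OF _ \<eta>(2)] infinite_HH by blast
  qed
qed

text \<open>Different symbols may name the same element of the group. Since the group is infinite, further elements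
  bring a generating set to the stated size.\<close>

lemma generating_set_card:
  assumes "finite S"
  shows "\<exists>A\<subseteq>carrier GG. card A = 4 * card S - 2 \<and> generate GG A = carrier GG"
proof -
  interpret GG: group GG by (rule group_GG)
  define B where "B = \<gamma> ` (gens_fin - {Hat a 1, Hat a 2})"
  have sub: "B \<subseteq> carrier GG"
    using \<gamma>_mem(2) by (auto simp: B_def)
  have "card (gens_fin - {Hat a 1, Hat a 2}) = 4 * card S - 2"
    using card_gens[OF assms] a_S by (subst card_Diff_subset) simp_all
  then have B: "finite B" "card B \<le> 4 * card S - 2"
    using card_image_le[of "gens_fin - {Hat a 1, Hat a 2}" \<gamma>] card_gens(1)[OF assms] by (auto simp: B_def)
  have "\<gamma> ` gens_fin \<subseteq> generate GG B"
  proof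
    fix z assume "z \<in> \<gamma> ` gens_fin"
    then obtain x where x: "x \<in> gens_fin" "z = \<gamma> x" by blast
    show "z \<in> generate GG B"
    proof (cases "x = Hat a 1 \<or> x = Hat a 2")
      case True
      then show ?thesis using x \<gamma>_hat_a generate.one by auto
    next
      case False
      then show ?thesis using x by (auto simp: B_def intro!: generate.incl)
    qed
  qed
  then have "generate GG (\<gamma> ` gens_fin) \<subseteq> generate GG B"
    by (rule GF.generate_subgroup_incl[OF _ GF.generate_is_subgroup[OF sub]])
  then have gen: "carrier GG \<subseteq> generate GG B"
    using has_presentation_generate[OF presentation_fin_G] by simp
  have "infinite (carrier GG - B)"
    using infinite_GG B(1) by simp
  then obtain C where C: "finite C" "card C = 4 * card S - 2 - card B" "C \<subseteq> carrier GG - B"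
    using infinite_arbitrarily_large[of _ "4 * card S - 2 - card B"] by blast
  have "card (B \<union> C) = 4 * card S - 2"
    using B C by (subst card_Un_disjoint) auto
  moreover have BC: "B \<union> C \<subseteq> carrier GG"
    using sub C(3) by blast
  moreover have "generate GG (B \<union> C) = carrier GG"
    using GF.mono_generate[of B "B \<union> C"] gen GF.generate_incl[OF BC] by blast
  ultimately show ?thesis by blast
qed

lemma card_rels_fin_G:
  assumes "finite S" "finite R"
  shows "finite rels_fin_G" "card rels_fin_G \<le> 4 * card R + 8 * (card S)\<^sup>2 - 4 * card S + 2"
proof -
  show "finite rels_fin_G"
    unfolding rels_fin_G_def
    by (intro finite_UnI card_comm_rels(1) card_hat_a_rels(1) card_skein_word_rels(1) assms a_S)
  have "card rels_fin_G \<le> card (comm_rels Hat S a) + card (comm_rels Gen S a) + card (hat_a_rels a {1, 2})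
      + card (skein_word_rels U_letters (short a) R w w') + card (skein_word_rels U_hat_letters (short a) R w w')"
    unfolding rels_fin_G_def by (intro order_trans[OF card_Un_le] add_mono order_refl)
  also have "\<dots> \<le> (4 * (card S)\<^sup>2 - 2 * card S) + (4 * (card S)\<^sup>2 - 2 * card S) + 2 + 2 * card R + 2 * card R"
    by (intro add_mono card_comm_rels(2)[OF assms(1) a_S] card_hat_a_rels(2) card_skein_word_rels(2)[OF assms(2)])
  also have "\<dots> = 4 * card R + 8 * (card S)\<^sup>2 - 4 * card S + 2"
  proof -
    have "2 * card S \<le> 4 * (card S)\<^sup>2"
      by (simp add: power2_eq_square)
    then show ?thesis by linarith
  qed
  finally show "card rels_fin_G \<le> 4 * card R + 8 * (card S)\<^sup>2 - 4 * card S + 2" .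
qed

lemma finite_rels_fin_H: "finite S \<Longrightarrow> finite R \<Longrightarrow> finite rels_fin_H"
  unfolding rels_fin_H_def by (intro finite_UnI card_comm_rels(1) card_skein_word_rels(1) a_S)

end

theorem theorem1:
  fixes S :: "'c set" and R :: "('c tree \<times> 'c tree) set" and a :: 'c
    and w w' :: "'c tree \<times> 'c tree \<Rightarrow> ('c \<times> nat) list"
    and G :: "('c forest set \<times> 'c forest set) set monoid"
    and H :: "((nat \<Rightarrow> 'c forest set) \<times> (nat \<Rightarrow> 'c forest set)) set monoid"
  assumes "skein_presentation S R" and "Ore_category S R" and "a \<in> S"
    and "\<And>u u'. (u, u') \<in> R \<Longrightarrow> factorisation u (w (u, u')) \<and> factorisation u' (w' (u, u'))"
    and G_def: "G = Frac_tree S R" and H_def: "H = Frac (ForC_inf S R)"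
  shows "\<exists>\<gamma> :: 'c gen \<Rightarrow> ('c forest set \<times> 'c forest set) set.
    \<comment> \<open>(A)\<close>
    has_presentation G (gens S {1, 2} \<union> hat_gens S {1, 2})
      (comm_rels Hat S a \<union> comm_rels Gen S a \<union> hat_a_rels a {1, 2}
        \<union> skein_word_rels U_letters (short a) R w w'
        \<union> skein_word_rels U_hat_letters (short a) R w w') \<gamma> \<and>
    (finite S \<longrightarrow> finitely_generated G \<and>
      (\<exists>A \<subseteq> carrier G. card A = 4 * card S - 2 \<and> generate G A = carrier G)) \<and>
    (finite S \<and> finite R \<longrightarrow> finitely_presented G \<and>
      (\<exists>rels. finite rels \<and> card rels = 4 * card R + 8 * (card S)\<^sup>2 - 4 * card S + 2 \<and>
        has_presentation G (gens S {1, 2} \<union> hat_gens S {1, 2}) rels \<gamma>)) \<and>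
    (finite S \<longrightarrow> finitely_generated H) \<and>
    (finite S \<and> finite R \<longrightarrow> finitely_presented H) \<and>
    \<comment> \<open>(C) for G\<close>
    has_presentation G (gens S {1..} \<union> hat_gens S {1..})
      (shift_rels Gen S \<union> shift_rels Hat S \<union> hat_a_rels a {1..}
        \<union> skein_word_rels U_letters pos R w w'
        \<union> skein_word_rels U_hat_letters pos R w w') \<gamma> \<and>
    \<comment> \<open>(B), and (C) for H\<close>
    (\<exists>\<theta> \<in> iso (G\<lparr>carrier := generate G (\<gamma> ` gens S {1, 2})\<rparr>) H.
      has_presentation H (gens S {1, 2})
        (comm_rels Gen S a \<union> skein_word_rels U_letters (short a) R w w') (\<theta> \<circ> \<gamma>) \<and>
      has_presentation H (gens S {1..})
        (shift_rels Gen S \<union> skein_word_rels U_letters pos R w w') (\<theta> \<circ> \<gamma>))"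
proof -
  interpret factorised_skein_category S R a w w'
    by unfold_locales (use assms in blast)+
  have GH: "G = GG" "H = HH"
    using Frac_tree_eq Frac_ForC_inf_eq by (simp_all add: G_def H_def)
  obtain \<theta> where \<theta>: "\<theta> \<in> iso (GG\<lparr>carrier := generate GG (\<gamma> ` gens S {1, 2})\<rparr>) HH"
      "\<And>x. x \<in> gens S {1..} \<Longrightarrow> \<theta> (\<gamma> x) = \<beta>' x"
    using H_subgroup_iso by blast
  have "has_presentation HH (gens S {1, 2}) rels_fin_H (\<theta> \<circ> \<gamma>)"
    using presentation_fin_H by (subst has_presentation_cong[of _ _ \<beta>']) (auto simp: \<theta>(2) gens_def)
  moreover have "has_presentation HH (gens S {1..}) rels_inf_H (\<theta> \<circ> \<gamma>)"
    using presentation_inf_H by (subst has_presentation_cong[of _ _ \<beta>']) (auto simp: \<theta>(2))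
  moreover have "finite (gens S {1, 2})" if "finite S"
    using card_gens(1)[OF that] by simp
  moreover have "\<exists>rels. finite rels \<and> card rels = 4 * card R + 8 * (card S)\<^sup>2 - 4 * card S + 2 \<and>
      has_presentation GG gens_fin rels \<gamma>" if "finite S" "finite R"
    using that has_presentation_exact_card[OF presentation_fin_G card_rels_fin_G[OF that], of "Gen a 1"] a_S by simp
  ultimately show ?thesis
    unfolding GH using presentation_fin_G presentation_inf_G \<theta>(1) generating_set_card
      finitely_generatedI[OF presentation_fin_G card_gens(1)]
      finitely_presentedI[OF presentation_fin_G card_gens(1) card_rels_fin_G(1)]
      finitely_generatedI[OF presentation_fin_H] finitely_presentedI[OF presentation_fin_H _ finite_rels_fin_H]
    unfolding rels_fin_G_def rels_inf_G_def rels_fin_H_def rels_inf_H_def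
    by (intro exI[of _ \<gamma>] conjI impI bexI[of _ \<theta>]) auto
qed

end
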